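(* Let $(R,\mathfrak m)$ be a commutative Noetherian local ring, $\mathfrak a$ a proper ideal of $R$, $M$ an $R$-module, and let $n$ be a non-negative integer such that $H^i_{\mathfrak a}(M)=0$ for all $i\neq n$. (i) If $\operatorname{injdim}_R M<\infty$, then $\operatorname{injdim}_R H^n_{\mathfrak a}(M)<\infty$. (ii) If $M$ is finitely generated and $\operatorname{injdim}_R H^n_{\mathfrak a}(M)<\infty$, then $\operatorname{injdim}_R M<\infty$. Furthermore, if $M$ is non-zero and finitely generated, then $\operatorname{injdim}_R H^n_{\mathfrak a}(M)=\operatorname{injdim}_R M-n$.
   Context: $H^i_{\mathfrak a}(M)$ is the $i$-th local cohomology module of $M$ with respect to $\mathfrak a$, and $\operatorname{injdim}$ is the usual injective dimension, with the convention that the injective dimension of the zero module is $-\infty$. *)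

theory Defs
  imports "HOL-Library.Extended_Real" "HOL-Algebra.Ideal_Product" "HOL-Algebra.Ring_Divisibility"
    "HOL-Algebra.Module"
begin

definition local_ring :: "('r, 'x) ring_scheme \<Rightarrow> 'r set \<Rightarrow> bool" where
  "local_ring R \<mm> \<longleftrightarrow> cring R \<and> maximalideal \<mm> R \<and> (\<forall>J. maximalideal J R \<longrightarrow> J = \<mm>)"

definition mod_hom ::
  "('r, 'x) ring_scheme \<Rightarrow> ('r, 'a) module \<Rightarrow> ('r, 'b) module \<Rightarrow> ('a \<Rightarrow> 'b) set" where
  "mod_hom R M N = {f \<in> carrier M \<rightarrow> carrier N.
     (\<forall>x\<in>carrier M. \<forall>y\<in>carrier M. f (x \<oplus>\<^bsub>M\<^esub> y) = f x \<oplus>\<^bsub>N\<^esub> f y) \<and>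
     (\<forall>r\<in>carrier R. \<forall>x\<in>carrier M. f (r \<odot>\<^bsub>M\<^esub> x) = r \<odot>\<^bsub>N\<^esub> f x)}"

definition finitely_generated_module ::
  "('r, 'x) ring_scheme \<Rightarrow> ('r, 'a) module \<Rightarrow> bool" where
  "finitely_generated_module R M \<longleftrightarrow>
     (\<exists>S. finite S \<and> S \<subseteq> carrier M \<and>
        (\<forall>x\<in>carrier M. \<exists>c\<in>S \<rightarrow> carrier R. x = (\<Oplus>\<^bsub>M\<^esub>s\<in>S. c s \<odot>\<^bsub>M\<^esub> s)))"

abbreviation zero_module :: "('r, 'a) module \<Rightarrow> bool" where
  "zero_module M \<equiv> carrier M = {\<zero>\<^bsub>M\<^esub>}"

text \<open>
  HOL cannot quantify over types inside a definition, so "all modules" has to be read as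
  "all modules whose elements lie in a fixed large enough type". For a module with elements in
  \<open>'a\<close> over a ring with elements in \<open>'r\<close> we use the following type \<open>U\<close>. It is infinite, it contains
  copies of \<open>'r\<close> and of \<open>'a\<close>, and the functions from \<open>'r\<close> to \<open>U\<close> are as many as the elements
  of \<open>U\<close> (if \<open>'r\<close> is infinite then \<open>'r \<times> 'r\<close> has the cardinality of \<open>'r\<close>; if \<open>'r\<close> is finite
  then a finite power of the infinite type \<open>U\<close> has the cardinality of \<open>U\<close>). Consequently:

  \<^item> Every module \<open>N\<close> in \<open>U\<close> embeds into an injective module in \<open>U\<close>, namely
    \<open>Hom\<^sub>\<int>(R, D)\<close> with \<open>D\<close> a divisible hull of the group \<open>N\<close> (at most \<open>|U|\<close> elements). Quotients of
    modules in \<open>U\<close> are again isomorphic to modules in \<open>U\<close>. So every \<open>M\<close> has an injective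
    resolution in \<open>U\<close>. If \<open>M\<close> has an injective resolution of length \<open>d\<close> in any type
    whatsoever, then the \<open>d\<close>-th cosyzygy of the resolution in \<open>U\<close> is injective too, and truncating
    there yields a resolution of length \<open>d\<close> in \<open>U\<close>.
  \<^item> \<open>R\<close> and its ideals have copies in \<open>U\<close>, so by Baer's criterion the extension property
    against modules in \<open>U\<close> gives it against modules in every type.
\<close>

type_synonym ('r, 'a) universe = "'r \<Rightarrow> 'a \<times> nat"

definition injective_module :: "('r, 'x) ring_scheme \<Rightarrow> ('r, 'a) module \<Rightarrow> bool" where
  "injective_module R I \<longleftrightarrow> module R I \<and>
     (\<forall>(A :: ('r, ('r, 'a) universe) module) (B :: ('r, ('r, 'a) universe) module) j f.
        module R A \<and> module R B \<and> j \<in> mod_hom R A B \<and> inj_on j (carrier A) \<and> f \<in> mod_hom R A I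
        \<longrightarrow> (\<exists>g\<in>mod_hom R B I. \<forall>x\<in>carrier A. g (j x) = f x))"

text \<open>Exactness of \<open>0 \<rightarrow> M \<rightarrow> E 0 \<rightarrow> E 1 \<rightarrow> \<dots>\<close>, with \<open>\<epsilon>\<close> the augmentation and
  \<open>\<delta> i\<close> the map from \<open>E i\<close> to \<open>E (i + 1)\<close>.\<close>

definition injective_resolution ::
  "('r, 'x) ring_scheme \<Rightarrow> ('r, 'a) module \<Rightarrow> ('a \<Rightarrow> 'e) \<Rightarrow>
     (nat \<Rightarrow> ('r, 'e) module) \<Rightarrow> (nat \<Rightarrow> 'e \<Rightarrow> 'e) \<Rightarrow> bool" where
  "injective_resolution R M \<epsilon> E \<delta> \<longleftrightarrow>
     (\<forall>i. injective_module R (E i)) \<and>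
     \<epsilon> \<in> mod_hom R M (E 0) \<and> (\<forall>i. \<delta> i \<in> mod_hom R (E i) (E (Suc i))) \<and>
     inj_on \<epsilon> (carrier M) \<and>
     \<epsilon> ` carrier M = a_kernel (E 0) (E 1) (\<delta> 0) \<and>
     (\<forall>i. \<delta> i ` carrier (E i) = a_kernel (E (Suc i)) (E (Suc (Suc i))) (\<delta> (Suc i)))"

text \<open>Here the infimum of the empty set is \<open>\<infinity>\<close>.\<close>

definition injdim :: "('r, 'x) ring_scheme \<Rightarrow> ('r, 'a) module \<Rightarrow> ereal" where
  "injdim R M =
     (if zero_module M then - \<infinity>
      else Inf {ereal (real d) | d.
             \<exists>\<epsilon> (E :: nat \<Rightarrow> ('r, ('r, 'a) universe) module) \<delta>.
               injective_resolution R M \<epsilon> E \<delta> \<and> (\<forall>i>d. zero_module (E i))})"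

primrec ideal_power :: "('r, 'x) ring_scheme \<Rightarrow> 'r set \<Rightarrow> nat \<Rightarrow> 'r set" where
  "ideal_power R \<aa> 0 = carrier R"
| "ideal_power R \<aa> (Suc k) = ideal_prod R \<aa> (ideal_power R \<aa> k)"

text \<open>The \<open>\<aa>\<close>-torsion submodule \<open>\<Gamma>\<^sub>\<aa>(M)\<close>. On homomorphisms the functor \<open>\<Gamma>\<^sub>\<aa>\<close> is restriction.\<close>

definition torsion_part ::
  "('r, 'x) ring_scheme \<Rightarrow> 'r set \<Rightarrow> ('r, 'a) module \<Rightarrow> ('r, 'a) module" where
  "torsion_part R \<aa> M =
     M\<lparr>carrier := {x \<in> carrier M. \<exists>k. \<forall>r\<in>ideal_power R \<aa> k. r \<odot>\<^bsub>M\<^esub> x = \<zero>\<^bsub>M\<^esub>}\<rparr>"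

text \<open>The fields \<open>mult\<close> and \<open>one\<close> of a module record play no role.\<close>

definition quotient_module :: "('r, 'a) module \<Rightarrow> 'a set \<Rightarrow> ('r, 'a set) module" where
  "quotient_module M N =
     \<lparr>carrier = a_rcosets\<^bsub>M\<^esub> N, monoid.mult = undefined, one = undefined,
      zero = N, add = set_add M,
      smult = (\<lambda>r C. \<Union>x\<in>C. N +>\<^bsub>M\<^esub> (r \<odot>\<^bsub>M\<^esub> x))\<rparr>"

definition cocycles ::
  "(nat \<Rightarrow> ('r, 'e) module) \<Rightarrow> (nat \<Rightarrow> 'e \<Rightarrow> 'e) \<Rightarrow> nat \<Rightarrow> 'e set" where
  "cocycles C \<delta> i = a_kernel (C i) (C (Suc i)) (\<delta> i)"

definition coboundaries ::
  "(nat \<Rightarrow> ('r, 'e) module) \<Rightarrow> (nat \<Rightarrow> 'e \<Rightarrow> 'e) \<Rightarrow> nat \<Rightarrow> 'e set" where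
  "coboundaries C \<delta> i =
     (case i of 0 \<Rightarrow> {\<zero>\<^bsub>C 0\<^esub>} | Suc j \<Rightarrow> \<delta> j ` carrier (C j))"

definition cohomology ::
  "(nat \<Rightarrow> ('r, 'e) module) \<Rightarrow> (nat \<Rightarrow> 'e \<Rightarrow> 'e) \<Rightarrow> nat \<Rightarrow> ('r, 'e set) module" where
  "cohomology C \<delta> i =
     quotient_module ((C i)\<lparr>carrier := cocycles C \<delta> i\<rparr>) (coboundaries C \<delta> i)"

text \<open>\<open>H\<^sup>i\<^sub>\<aa>(M)\<close> is the \<open>i\<close>-th right derived functor of \<open>\<Gamma>\<^sub>\<aa>\<close> at \<open>M\<close>, computed from a chosen injective
  resolution of \<open>M\<close>; the choice matters only up to isomorphism.\<close>

definition local_cohomology ::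
  "('r, 'x) ring_scheme \<Rightarrow> 'r set \<Rightarrow> ('r, 'a) module \<Rightarrow> nat
     \<Rightarrow> ('r, ('r, 'a) universe set) module" where
  "local_cohomology R \<aa> M i =
     (let (E, \<delta>) = (SOME (E :: nat \<Rightarrow> ('r, ('r, 'a) universe) module, \<delta>).
                      \<exists>\<epsilon>. injective_resolution R M \<epsilon> E \<delta>)
      in cohomology (\<lambda>j. torsion_part R \<aa> (E j)) \<delta> i)"

end

theory Submission
  imports Defs "HOL-Algebra.IntRing" "HOL-Library.Equipollence"
begin

text \<open>
  Let \<open>E\<close> be an injective resolution of \<open>M\<close>, and let \<open>C = \<Gamma>\<^sub>\<aa>(E)\<close>. Over a Noetherian ring \<open>\<Gamma>\<^sub>\<aa>\<close> preserves
  injectivity (\<open>baer_torsion\<close>), so \<open>C\<close> is a complex of injective modules, and its only cohomology is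
  \<open>H = H\<^sup>n\<^sub>\<aa>(M)\<close>. Below degree \<open>n\<close> the complex is exact, hence it splits, its coboundaries in degree \<open>n\<close> are
  injective, and after removing them from \<open>C n\<close> the part of \<open>C\<close> from degree \<open>n\<close> on becomes an injective
  resolution of \<open>H\<close> (\<open>cohomology_resolution\<close>). Injective dimensions can be read off from this: a module
  has injective dimension at most \<open>d\<close> if and only if the \<open>d\<close>-th cosyzygy in one, equivalently in every,
  injective resolution is injective (\<open>injdim_leI\<close>, \<open>injdim_leD\<close>, \<open>baer_cocycles_compare\<close>). Cosyzygies
  appear as the modules of cocycles of a resolution.

  Upper bound: if the \<open>t\<close>-th cosyzygy of \<open>M\<close> is injective, then so is its torsion part, which is the
  module of cocycles of \<open>C\<close> in degree \<open>t\<close>. For \<open>t \<ge> n\<close> this bounds the injective dimension of \<open>H\<close> by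
  \<open>t - n\<close>, and for \<open>t < n\<close> it shows that \<open>C\<close> is exact in degree \<open>n\<close>, so that \<open>H = 0\<close>.

  Lower bound, for finitely generated \<open>M\<close>: elements killed by \<open>\<mm>\<close> are \<open>\<aa>\<close>-torsion, so \<open>E\<close> and \<open>C\<close> give
  the same \<open>Ext\<^sup>j(R/\<mm>, M)\<close>, and for \<open>j > n\<close> this is \<open>Ext\<^bsup>j-n\<^esup>(R/\<mm>, H)\<close>. It vanishes for \<open>j > n + d\<close> if \<open>H\<close>
  has injective dimension at most \<open>d\<close>. By an argument of Bass (\<open>ext_vanishing_from_residue_field\<close>) the
  same vanishing then holds for all \<open>Ext\<^sup>j(R/I, M)\<close>, and by Baer's criterion \<open>M\<close> has injective dimension
  at most \<open>n + d\<close>. If \<open>H\<close> is zero, the argument starts in degree \<open>0\<close> and shows \<open>M = Ext\<^sup>0(R, M) = 0\<close>. So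
  \<open>M \<noteq> 0\<close> implies \<open>H \<noteq> 0\<close>, and both bounds together give the equality.

  Two points shape the formal development. First, Ext enters only through cyclic modules \<open>R/I\<close>, and a
  map from \<open>R/I\<close> is an element killed by \<open>I\<close>; so all homological arguments become
  statements on lifting elements to elements with the same annihilator.
  Secondly, injectivity is defined by test modules in one fixed type. Baer's criterion
  (\<open>injective_module_iff_baer\<close>) removes this restriction, and
  a resolution in the prescribed type exists because a module embeds into an injective module of
  characters, inside which, over a Noetherian ring, a small injective submodule can be generated
  (\<open>injective_resolution_exists\<close>).
\<close>

section \<open>Submodules and homomorphisms\<close>

abbreviation sub :: "('r, 'a) module \<Rightarrow> 'a set \<Rightarrow> ('r, 'a) module" where
  "sub M X \<equiv> M\<lparr>carrier := X\<rparr>"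

lemma (in module) add_diff [simp]:
  "\<lbrakk>x \<in> carrier M; y \<in> carrier M\<rbrakk> \<Longrightarrow> y \<oplus>\<^bsub>M\<^esub> (x \<ominus>\<^bsub>M\<^esub> y) = x"
  by (metis M.add.inv_closed M.add.m_comm M.add.m_assoc M.l_neg M.minus_eq M.r_zero)

lemma (in module) smult_diff:
  "\<lbrakk>r \<in> carrier R; x \<in> carrier M; y \<in> carrier M\<rbrakk>
    \<Longrightarrow> r \<odot>\<^bsub>M\<^esub> (x \<ominus>\<^bsub>M\<^esub> y) = r \<odot>\<^bsub>M\<^esub> x \<ominus>\<^bsub>M\<^esub> r \<odot>\<^bsub>M\<^esub> y"
  by (simp add: M.minus_eq smult_r_distr smult_r_minus)

lemma (in module) diff_eq_neg_one:
  "\<lbrakk>x \<in> carrier M; y \<in> carrier M\<rbrakk> \<Longrightarrow> x \<ominus>\<^bsub>M\<^esub> y = x \<oplus>\<^bsub>M\<^esub> (\<ominus> \<one>) \<odot>\<^bsub>M\<^esub> y"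
  by (simp add: M.minus_eq smult_l_minus)

lemma (in module) add_eq_iff_diff:
  "\<lbrakk>x \<in> carrier M; y \<in> carrier M; z \<in> carrier M\<rbrakk> \<Longrightarrow> x \<oplus>\<^bsub>M\<^esub> y = z \<longleftrightarrow> y = z \<ominus>\<^bsub>M\<^esub> x"
  by (metis M.add.l_cancel M.minus_closed add_diff)

lemma (in module) diff_eq_zero_iff [simp]:
  "\<lbrakk>x \<in> carrier M; y \<in> carrier M\<rbrakk> \<Longrightarrow> x \<ominus>\<^bsub>M\<^esub> y = \<zero>\<^bsub>M\<^esub> \<longleftrightarrow> x = y"
  by (metis add_diff M.r_zero M.minus_eq M.r_neg)

lemma (in module) diff_zero [simp]: "x \<in> carrier M \<Longrightarrow> x \<ominus>\<^bsub>M\<^esub> \<zero>\<^bsub>M\<^esub> = x"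
  by (metis M.l_zero M.minus_closed M.zero_closed add_diff)

lemma module_cring: "module R M \<Longrightarrow> cring R"
  by (simp add: module_def)

lemma submoduleI':
  assumes "module R M" "H \<subseteq> carrier M" "\<zero>\<^bsub>M\<^esub> \<in> H"
    and "\<And>a b. \<lbrakk>a \<in> H; b \<in> H\<rbrakk> \<Longrightarrow> a \<oplus>\<^bsub>M\<^esub> b \<in> H"
    and "\<And>a x. \<lbrakk>a \<in> carrier R; x \<in> H\<rbrakk> \<Longrightarrow> a \<odot>\<^bsub>M\<^esub> x \<in> H"
  shows "submodule H R M"
proof -
  interpret module R M by fact
  have "\<ominus>\<^bsub>M\<^esub> a \<in> H" if "a \<in> H" for a
    using assms(2) assms(5)[of "\<ominus>\<^bsub>R\<^esub> \<one>\<^bsub>R\<^esub>" a] that smult_l_minus[of "\<one>\<^bsub>R\<^esub>" a] by auto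
  with assms show ?thesis by (intro submoduleI) auto
qed

lemma submodule_mem: "submodule X R M \<Longrightarrow> x \<in> X \<Longrightarrow> x \<in> carrier M"
  using submodule.axioms(1)[of X R M] subgroup.subset[of X "add_monoid M"] by auto

lemma submodule_zero: "submodule X R M \<Longrightarrow> \<zero>\<^bsub>M\<^esub> \<in> X"
  using submodule.axioms(1)[of X R M] subgroup.one_closed[of X "add_monoid M"] by auto

lemma submodule_add: "submodule X R M \<Longrightarrow> x \<in> X \<Longrightarrow> y \<in> X \<Longrightarrow> x \<oplus>\<^bsub>M\<^esub> y \<in> X"
  using submodule.axioms(1)[of X R M] subgroup.m_closed[of X "add_monoid M"] by auto

lemmas submodule_smult = submodule.smult_closed

lemma submodule_diff:
  assumes "module R M" "submodule X R M" "x \<in> X" "y \<in> X"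
  shows "x \<ominus>\<^bsub>M\<^esub> y \<in> X"
proof -
  interpret module R M by fact
  show ?thesis
    using assms(2-) submoduleE(3)[OF assms(2), of y] by (simp add: M.minus_eq submodule_add)
qed

lemmas submodule_intros = submodule_mem submodule_zero submodule_add submodule_smult

lemma submodule_module: "module R M \<Longrightarrow> submodule X R M \<Longrightarrow> module R (sub M X)"
  by (rule submodule.submodule_is_module)

lemma submodule_carrier: "module R M \<Longrightarrow> submodule (carrier M) R M"
  by (rule module.carrier_is_submodule)

lemma submodule_singleton_zero:
  assumes "module R M" shows "submodule {\<zero>\<^bsub>M\<^esub>} R M"
proof -
  interpret module R M by fact
  show ?thesis by (rule submoduleI'[OF assms]) auto
qed

lemma submodule_Int:
  assumes "module R M" "submodule X R M" "submodule Y R M"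
  shows "submodule (X \<inter> Y) R M"
  by (rule submoduleI'[OF assms(1)]) (use assms(2,3) in \<open>auto intro: submodule_intros\<close>)

lemma submodule_of_sub:
  assumes "module R M" "submodule X R M" "submodule Y R M" "Y \<subseteq> X"
  shows "submodule Y R (sub M X)"
  by (rule submoduleI'[OF submodule_module[OF assms(1,2)]])
     (use assms in \<open>auto intro: submodule_intros\<close>)

lemma mod_homI:
  assumes "\<And>x. x \<in> carrier M \<Longrightarrow> f x \<in> carrier N"
    and "\<And>x y. \<lbrakk>x \<in> carrier M; y \<in> carrier M\<rbrakk> \<Longrightarrow> f (x \<oplus>\<^bsub>M\<^esub> y) = f x \<oplus>\<^bsub>N\<^esub> f y"
    and "\<And>r x. \<lbrakk>r \<in> carrier R; x \<in> carrier M\<rbrakk> \<Longrightarrow> f (r \<odot>\<^bsub>M\<^esub> x) = r \<odot>\<^bsub>N\<^esub> f x"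
  shows "f \<in> mod_hom R M N"
  using assms by (auto simp: mod_hom_def)

lemma hom_closed: "f \<in> mod_hom R M N \<Longrightarrow> x \<in> carrier M \<Longrightarrow> f x \<in> carrier N"
  and hom_add: "f \<in> mod_hom R M N \<Longrightarrow> x \<in> carrier M \<Longrightarrow> y \<in> carrier M
    \<Longrightarrow> f (x \<oplus>\<^bsub>M\<^esub> y) = f x \<oplus>\<^bsub>N\<^esub> f y"
  and hom_smult: "f \<in> mod_hom R M N \<Longrightarrow> r \<in> carrier R \<Longrightarrow> x \<in> carrier M
    \<Longrightarrow> f (r \<odot>\<^bsub>M\<^esub> x) = r \<odot>\<^bsub>N\<^esub> f x"
  by (auto simp: mod_hom_def)

lemma hom_zero:
  assumes "module R M" "module R N" "f \<in> mod_hom R M N"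
  shows "f \<zero>\<^bsub>M\<^esub> = \<zero>\<^bsub>N\<^esub>"
proof -
  interpret M: module R M by fact
  interpret N: module R N by fact
  show ?thesis
    by (metis M.smult_l_null M.M.zero_closed N.smult_l_null M.R.zero_closed assms(3)
        hom_closed hom_smult)
qed

lemma hom_diff:
  assumes "module R M" "module R N" "f \<in> mod_hom R M N" "x \<in> carrier M" "y \<in> carrier M"
  shows "f (x \<ominus>\<^bsub>M\<^esub> y) = f x \<ominus>\<^bsub>N\<^esub> f y"
proof -
  interpret M: module R M by fact
  interpret N: module R N by fact
  show ?thesis using assms(3-)
    by (simp add: M.diff_eq_neg_one N.diff_eq_neg_one hom_add hom_smult hom_closed)
qed

lemma hom_comp: "f \<in> mod_hom R M N \<Longrightarrow> g \<in> mod_hom R N P \<Longrightarrow> (\<lambda>x. g (f x)) \<in> mod_hom R M P"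
  by (auto simp: mod_hom_def Pi_iff)

lemma hom_restrict: "f \<in> mod_hom R M N \<Longrightarrow> X \<subseteq> carrier M \<Longrightarrow> f \<in> mod_hom R (sub M X) N"
  by (rule mod_homI) (auto simp: mod_hom_def Pi_iff subset_iff)

lemma hom_corestrict: "f \<in> mod_hom R M N \<Longrightarrow> f ` carrier M \<subseteq> Y \<Longrightarrow> f \<in> mod_hom R M (sub N Y)"
  by (auto simp: mod_hom_def Pi_iff)

lemma hom_enlarge: "f \<in> mod_hom R M (sub N Y) \<Longrightarrow> Y \<subseteq> carrier N \<Longrightarrow> f \<in> mod_hom R M N"
  by (auto simp: mod_hom_def Pi_iff)

lemma hom_id_minus:
  assumes "module R M" "\<rho> \<in> mod_hom R M M"
  shows "(\<lambda>x. x \<ominus>\<^bsub>M\<^esub> \<rho> x) \<in> mod_hom R M M"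
proof -
  interpret module R M by fact
  show ?thesis
    by (rule mod_homI)
       (simp_all add: hom_closed[OF assms(2)] hom_add[OF assms(2)] hom_smult[OF assms(2)]
          M.minus_eq M.minus_add M.a_ac smult_r_distr smult_r_minus)
qed

lemma hom_inj_onI:
  assumes "module R M" "module R N" "f \<in> mod_hom R M N"
    and "\<And>x. x \<in> carrier M \<Longrightarrow> f x = \<zero>\<^bsub>N\<^esub> \<Longrightarrow> x = \<zero>\<^bsub>M\<^esub>"
  shows "inj_on f (carrier M)"
proof
  interpret M: module R M by fact
  interpret N: module R N by fact
  fix x y assume "x \<in> carrier M" "y \<in> carrier M" "f x = f y"
  then have "f (x \<ominus>\<^bsub>M\<^esub> y) = \<zero>\<^bsub>N\<^esub>"
    using hom_diff[OF assms(1-3)] hom_closed[OF assms(3)] by simp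
  with assms(4)[of "x \<ominus>\<^bsub>M\<^esub> y"] show "x = y" using \<open>x \<in> _\<close> \<open>y \<in> _\<close> by simp
qed

lemma submodule_image:
  assumes "module R M" "module R N" "f \<in> mod_hom R M N" "submodule X R M"
  shows "submodule (f ` X) R N"
proof (rule submoduleI'[OF assms(2)])
  show "f ` X \<subseteq> carrier N" using assms by (auto intro: hom_closed submodule_mem)
  show "\<zero>\<^bsub>N\<^esub> \<in> f ` X" using assms by (metis hom_zero image_eqI submodule_zero)
  show "a \<oplus>\<^bsub>N\<^esub> b \<in> f ` X" if "a \<in> f ` X" "b \<in> f ` X" for a b
    using that assms(4) hom_add[OF assms(3)]
    by (smt (verit) image_iff submodule_add submodule_mem)
  show "a \<odot>\<^bsub>N\<^esub> x \<in> f ` X" if "a \<in> carrier R" "x \<in> f ` X" for a x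
    using that assms(4) hom_smult[OF assms(3)]
    by (smt (verit) image_iff submodule_smult submodule_mem)
qed

lemma submodule_vimage:
  assumes "module R M" "module R N" "f \<in> mod_hom R M N" "submodule Y R N"
  shows "submodule {x \<in> carrier M. f x \<in> Y} R M"
proof -
  interpret M: module R M by fact
  show ?thesis
    by (rule submoduleI'[OF assms(1)])
       (use assms in \<open>auto simp: hom_add hom_smult hom_zero intro: submodule_intros\<close>)
qed

lemma submodule_kernel:
  assumes "module R M" "module R N" "f \<in> mod_hom R M N"
  shows "submodule (a_kernel M N f) R M"
  using submodule_vimage[OF assms submodule_singleton_zero[OF assms(2)]]
  by (simp add: a_kernel_def')

section \<open>Baer's criterion\<close>

text \<open>
  A homomorphism from a submodule of \<open>A\<close> to \<open>B\<close>, given by its graph. By linearity it is enough to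
  ask for a single value at zero. A partial homomorphism that is defined by a formula in several
  parameters then needs one check of well-definedness, and no choice of representatives.
\<close>

definition linear_graph ::
  "('r, 'x) ring_scheme \<Rightarrow> ('r, 'a) module \<Rightarrow> ('r, 'b) module \<Rightarrow> ('a \<times> 'b) set \<Rightarrow> bool" where
  "linear_graph R A B G \<longleftrightarrow>
     G \<subseteq> carrier A \<times> carrier B \<and> (\<zero>\<^bsub>A\<^esub>, \<zero>\<^bsub>B\<^esub>) \<in> G \<and>
     (\<forall>x y x' y'. (x, y) \<in> G \<longrightarrow> (x', y') \<in> G \<longrightarrow> (x \<oplus>\<^bsub>A\<^esub> x', y \<oplus>\<^bsub>B\<^esub> y') \<in> G) \<and>
     (\<forall>r x y. r \<in> carrier R \<longrightarrow> (x, y) \<in> G \<longrightarrow> (r \<odot>\<^bsub>A\<^esub> x, r \<odot>\<^bsub>B\<^esub> y) \<in> G) \<and>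
     (\<forall>y. (\<zero>\<^bsub>A\<^esub>, y) \<in> G \<longrightarrow> y = \<zero>\<^bsub>B\<^esub>)"

lemma linear_graphI:
  assumes "\<And>x y. (x, y) \<in> G \<Longrightarrow> x \<in> carrier A" "\<And>x y. (x, y) \<in> G \<Longrightarrow> y \<in> carrier B"
    "(\<zero>\<^bsub>A\<^esub>, \<zero>\<^bsub>B\<^esub>) \<in> G"
    "\<And>x y x' y'. (x, y) \<in> G \<Longrightarrow> (x', y') \<in> G \<Longrightarrow> (x \<oplus>\<^bsub>A\<^esub> x', y \<oplus>\<^bsub>B\<^esub> y') \<in> G"
    "\<And>r x y. r \<in> carrier R \<Longrightarrow> (x, y) \<in> G \<Longrightarrow> (r \<odot>\<^bsub>A\<^esub> x, r \<odot>\<^bsub>B\<^esub> y) \<in> G"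
    "\<And>y. (\<zero>\<^bsub>A\<^esub>, y) \<in> G \<Longrightarrow> y = \<zero>\<^bsub>B\<^esub>"
  shows "linear_graph R A B G"
  unfolding linear_graph_def
proof (intro conjI allI impI)
  show "G \<subseteq> carrier A \<times> carrier B" using assms(1,2) by auto
qed (rule assms; assumption)+

lemma linear_graphD:
  assumes "linear_graph R A B G"
  shows "\<And>x y. (x, y) \<in> G \<Longrightarrow> x \<in> carrier A" "\<And>x y. (x, y) \<in> G \<Longrightarrow> y \<in> carrier B"
    "(\<zero>\<^bsub>A\<^esub>, \<zero>\<^bsub>B\<^esub>) \<in> G"
    "\<And>x y x' y'. (x, y) \<in> G \<Longrightarrow> (x', y') \<in> G \<Longrightarrow> (x \<oplus>\<^bsub>A\<^esub> x', y \<oplus>\<^bsub>B\<^esub> y') \<in> G"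
    "\<And>r x y. r \<in> carrier R \<Longrightarrow> (x, y) \<in> G \<Longrightarrow> (r \<odot>\<^bsub>A\<^esub> x, r \<odot>\<^bsub>B\<^esub> y) \<in> G"
    "\<And>y. (\<zero>\<^bsub>A\<^esub>, y) \<in> G \<Longrightarrow> y = \<zero>\<^bsub>B\<^esub>"
  using assms unfolding linear_graph_def by blast+

lemma linear_graph_diff:
  assumes "module R A" "module R B" "linear_graph R A B G" "(x, y) \<in> G" "(x', y') \<in> G"
  shows "(x \<ominus>\<^bsub>A\<^esub> x', y \<ominus>\<^bsub>B\<^esub> y') \<in> G"
proof -
  interpret A: module R A by fact
  interpret B: module R B by fact
  note G = linear_graphD[OF assms(3)]
  have "((\<ominus>\<^bsub>R\<^esub> \<one>\<^bsub>R\<^esub>) \<odot>\<^bsub>A\<^esub> x', (\<ominus>\<^bsub>R\<^esub> \<one>\<^bsub>R\<^esub>) \<odot>\<^bsub>B\<^esub> y') \<in> G"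
    using G(5)[OF _ assms(5)] by simp
  from G(4)[OF assms(4) this] show ?thesis
    using G(1,2)[OF assms(4)] G(1,2)[OF assms(5)] by (simp add: A.diff_eq_neg_one B.diff_eq_neg_one)
qed

lemma linear_graph_unique:
  assumes "module R A" "module R B" "linear_graph R A B G" "(x, y) \<in> G" "(x, y') \<in> G"
  shows "y = y'"
proof -
  interpret A: module R A by fact
  interpret B: module R B by fact
  note G = linear_graphD[OF assms(3)]
  have "x \<ominus>\<^bsub>A\<^esub> x = \<zero>\<^bsub>A\<^esub>" using G(1)[OF assms(4)] by simp
  then have "y \<ominus>\<^bsub>B\<^esub> y' = \<zero>\<^bsub>B\<^esub>"
    using linear_graph_diff[OF assms] G(6) by simp
  then show ?thesis using G(2)[OF assms(4)] G(2)[OF assms(5)] by simp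
qed

definition ring_module :: "('r, 'x) ring_scheme \<Rightarrow> ('r, 'r) module" where
  "ring_module R = \<lparr>carrier = carrier R, monoid.mult = monoid.mult R, one = one R,
     zero = zero R, add = add R, smult = monoid.mult R\<rparr>"

lemma ring_module_simps [simp]:
  "carrier (ring_module R) = carrier R" "zero (ring_module R) = zero R"
  "add (ring_module R) = add R" "smult (ring_module R) = monoid.mult R"
  by (auto simp: ring_module_def)

lemma ring_module: assumes "cring R" shows "module R (ring_module R)"
proof -
  interpret cring R by fact
  show ?thesis
  proof (rule moduleI)
    show "abelian_group (ring_module R)"
      by (rule abelian_groupI) (auto simp: a_ac intro: bexI[of _ "\<ominus>\<^bsub>R\<^esub> _"] l_neg)
  qed (auto simp: assms l_distr r_distr m_assoc)
qed

text \<open>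
  A homomorphism \<open>f\<close> from an ideal \<open>J\<close> to \<open>M\<close> extends to \<open>R\<close> exactly if it is multiplication by an
  element \<open>y\<close>, the value of the extension at \<open>1\<close>. This form of injectivity speaks of ideals only, so it
  does not depend on a choice of type for the test modules.
\<close>

definition baer :: "('r, 'x) ring_scheme \<Rightarrow> ('r, 'a) module \<Rightarrow> bool" where
  "baer R M \<longleftrightarrow> module R M \<and>
     (\<forall>J f. ideal J R \<longrightarrow> (\<forall>a\<in>J. f a \<in> carrier M) \<longrightarrow>
        (\<forall>a\<in>J. \<forall>b\<in>J. f (a \<oplus>\<^bsub>R\<^esub> b) = f a \<oplus>\<^bsub>M\<^esub> f b) \<longrightarrow>
        (\<forall>r\<in>carrier R. \<forall>a\<in>J. f (r \<otimes>\<^bsub>R\<^esub> a) = r \<odot>\<^bsub>M\<^esub> f a) \<longrightarrow>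
        (\<exists>y\<in>carrier M. \<forall>a\<in>J. f a = a \<odot>\<^bsub>M\<^esub> y))"

lemma baer_module: "baer R M \<Longrightarrow> module R M"
  by (simp add: baer_def)

lemma baerI:
  assumes "module R M"
    and "\<And>J f. \<lbrakk>ideal J R; \<And>a. a \<in> J \<Longrightarrow> f a \<in> carrier M;
        \<And>a b. a \<in> J \<Longrightarrow> b \<in> J \<Longrightarrow> f (a \<oplus>\<^bsub>R\<^esub> b) = f a \<oplus>\<^bsub>M\<^esub> f b;
        \<And>r a. r \<in> carrier R \<Longrightarrow> a \<in> J \<Longrightarrow> f (r \<otimes>\<^bsub>R\<^esub> a) = r \<odot>\<^bsub>M\<^esub> f a\<rbrakk>
      \<Longrightarrow> \<exists>y\<in>carrier M. \<forall>a\<in>J. f a = a \<odot>\<^bsub>M\<^esub> y"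
  shows "baer R M"
  unfolding baer_def using assms by auto

lemma baerD:
  assumes "baer R M" "ideal J R" "\<And>a. a \<in> J \<Longrightarrow> f a \<in> carrier M"
    "\<And>a b. a \<in> J \<Longrightarrow> b \<in> J \<Longrightarrow> f (a \<oplus>\<^bsub>R\<^esub> b) = f a \<oplus>\<^bsub>M\<^esub> f b"
    "\<And>r a. r \<in> carrier R \<Longrightarrow> a \<in> J \<Longrightarrow> f (r \<otimes>\<^bsub>R\<^esub> a) = r \<odot>\<^bsub>M\<^esub> f a"
  obtains y where "y \<in> carrier M" "\<And>a. a \<in> J \<Longrightarrow> f a = a \<odot>\<^bsub>M\<^esub> y"
proof -
  have "\<exists>y\<in>carrier M. \<forall>a\<in>J. f a = a \<odot>\<^bsub>M\<^esub> y"
    using assms(1)[unfolded baer_def] assms(2-) by auto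
  then show thesis using that by auto
qed

lemma idealI':
  assumes "cring R" "J \<subseteq> carrier R" "\<zero>\<^bsub>R\<^esub> \<in> J"
    and "\<And>a b. \<lbrakk>a \<in> J; b \<in> J\<rbrakk> \<Longrightarrow> a \<oplus>\<^bsub>R\<^esub> b \<in> J"
    and "\<And>r a. \<lbrakk>r \<in> carrier R; a \<in> J\<rbrakk> \<Longrightarrow> r \<otimes>\<^bsub>R\<^esub> a \<in> J"
  shows "ideal J R"
proof -
  interpret cring R by fact
  show ?thesis
  proof (rule idealI)
    show "subgroup J (add_monoid R)"
    proof (rule add.subgroupI)
      show "\<ominus>\<^bsub>R\<^esub> a \<in> J" if "a \<in> J" for a
        using assms(2) assms(5)[of "\<ominus>\<^bsub>R\<^esub> \<one>\<^bsub>R\<^esub>" a] that l_minus[of "\<one>\<^bsub>R\<^esub>" a] by auto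
    qed (use assms in auto)
    show "x \<otimes>\<^bsub>R\<^esub> a \<in> J" if "a \<in> J" "x \<in> carrier R" for a x using assms that by simp
    show "a \<otimes>\<^bsub>R\<^esub> x \<in> J" if "a \<in> J" "x \<in> carrier R" for a x
      using assms that m_comm[of a x] by auto
  qed (fact ring_axioms)
qed

lemma baer_graph:
  assumes "baer R I" "linear_graph R (ring_module R) I G"
  obtains z where "z \<in> carrier I" "\<And>r y. (r, y) \<in> G \<Longrightarrow> y = r \<odot>\<^bsub>I\<^esub> z"
proof -
  interpret I: module R I using assms(1) by (rule baer_module)
  have RM: "module R (ring_module R)" using module_cring[OF I.module_axioms] by (rule ring_module)
  note G = linear_graphD[OF assms(2), simplified]
  note un = linear_graph_unique[OF RM I.module_axioms assms(2)]
  define f where "f r = (THE y. (r, y) \<in> G)" for r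
  have f: "f r = y" if "(r, y) \<in> G" for r y
    unfolding f_def using that un by (intro the_equality) auto
  have "ideal (fst ` G) R"
  proof (rule idealI')
    show "a \<oplus>\<^bsub>R\<^esub> b \<in> fst ` G" if "a \<in> fst ` G" "b \<in> fst ` G" for a b
      using that G(4) by force
    show "r \<otimes>\<^bsub>R\<^esub> a \<in> fst ` G" if "r \<in> carrier R" "a \<in> fst ` G" for r a
      using that G(5) by force
    show "\<zero>\<^bsub>R\<^esub> \<in> fst ` G" using G(3) by force
  qed (use G(1) module_cring[OF I.module_axioms] in auto)
  from assms(1) this obtain y where "y \<in> carrier I" "\<And>a. a \<in> fst ` G \<Longrightarrow> f a = a \<odot>\<^bsub>I\<^esub> y"
  proof (rule baerD[where f = f])
    show "f a \<in> carrier I" if "a \<in> fst ` G" for a using that f G(2) by fastforce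
    show "f (a \<oplus>\<^bsub>R\<^esub> b) = f a \<oplus>\<^bsub>I\<^esub> f b" if "a \<in> fst ` G" "b \<in> fst ` G" for a b
      using that f G(4) by fastforce
    show "f (r \<otimes>\<^bsub>R\<^esub> a) = r \<odot>\<^bsub>I\<^esub> f a" if "r \<in> carrier R" "a \<in> fst ` G" for r a
      using that f G(5) by fastforce
  qed blast
  with that f show thesis by (metis fst_conv image_eqI)
qed

text \<open>
  Zorn's lemma, applied to linear graphs. A maximal graph \<open>H\<close> is defined everywhere: for \<open>b\<close> in \<open>B\<close>
  the pairs \<open>(r, y)\<close> with \<open>(r b, y)\<close> in \<open>H\<close> form a linear graph on an ideal, Baer's criterion gives an
  element \<open>z\<close> with \<open>y = r z\<close> for all of them, and so \<open>b \<mapsto> z\<close> is consistent with \<open>H\<close>.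
\<close>

theorem baer_extend:
  assumes "module R B" "baer R I" "linear_graph R B I G"
  obtains g where "g \<in> mod_hom R B I" "\<And>x y. (x, y) \<in> G \<Longrightarrow> g x = y"
proof -
  interpret B: module R B by fact
  interpret I: module R I using assms(2) by (rule baer_module)
  let ?S = "{H. linear_graph R B I H \<and> G \<subseteq> H}"
  have "\<exists>H\<in>?S. \<forall>X\<in>?S. H \<subseteq> X \<longrightarrow> X = H"
  proof (rule subset_Zorn_nonempty)
    show "?S \<noteq> {}" using assms(3) by auto
    fix C assume "C \<noteq> {}" and C: "subset.chain ?S C"
    have lg: "linear_graph R B I H" and GH: "G \<subseteq> H" if "H \<in> C" for H
      using C that by (auto simp: subset_chain_def)
    have "linear_graph R B I (\<Union>C)"
    proof (rule linear_graphI)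
      fix x y x' y' assume "(x, y) \<in> \<Union>C" "(x', y') \<in> \<Union>C"
      then obtain H1 H2 where "H1 \<in> C" "H2 \<in> C" "(x, y) \<in> H1" "(x', y') \<in> H2" by blast
      moreover have "H1 \<subseteq> H2 \<or> H2 \<subseteq> H1"
        using C \<open>H1 \<in> C\<close> \<open>H2 \<in> C\<close> by (auto simp: subset_chain_def)
      ultimately obtain H where "H \<in> C" "(x, y) \<in> H" "(x', y') \<in> H" by blast
      then show "(x \<oplus>\<^bsub>B\<^esub> x', y \<oplus>\<^bsub>I\<^esub> y') \<in> \<Union>C"
        using linear_graphD(4)[OF lg] by blast
    next
      show "(\<zero>\<^bsub>B\<^esub>, \<zero>\<^bsub>I\<^esub>) \<in> \<Union>C" using \<open>C \<noteq> {}\<close> linear_graphD(3)[OF lg] by blast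
    next
      fix r x y assume "r \<in> carrier R" "(x, y) \<in> \<Union>C"
      then show "(r \<odot>\<^bsub>B\<^esub> x, r \<odot>\<^bsub>I\<^esub> y) \<in> \<Union>C"
        using linear_graphD(5)[OF lg] by blast
    next
      show "x \<in> carrier B" "y \<in> carrier I" if xy: "(x, y) \<in> \<Union>C" for x y
      proof -
        from xy obtain H where H: "H \<in> C" "(x, y) \<in> H" by blast
        from linear_graphD(1,2)[OF lg[OF H(1)] H(2)]
        show "x \<in> carrier B" "y \<in> carrier I" .
      qed
      show "y = \<zero>\<^bsub>I\<^esub>" if "(\<zero>\<^bsub>B\<^esub>, y) \<in> \<Union>C" for y
      proof -
        from that obtain H where H: "H \<in> C" "(\<zero>\<^bsub>B\<^esub>, y) \<in> H" by blast
        from linear_graphD(6)[OF lg[OF H(1)] H(2)] show ?thesis .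
      qed
    qed
    with \<open>C \<noteq> {}\<close> GH show "\<Union>C \<in> ?S" by blast
  qed
  then obtain H where H: "linear_graph R B I H" "G \<subseteq> H"
    and max: "\<And>X. linear_graph R B I X \<Longrightarrow> H \<subseteq> X \<Longrightarrow> X = H" by auto
  note HD = linear_graphD[OF H(1)]
  have ex: "\<exists>y. (b, y) \<in> H" if b: "b \<in> carrier B" for b
  proof -
    let ?G = "{(r, y). r \<in> carrier R \<and> (r \<odot>\<^bsub>B\<^esub> b, y) \<in> H}"
    have "linear_graph R (ring_module R) I ?G"
    proof (rule linear_graphI)
      fix r y r' y' assume "(r, y) \<in> ?G" "(r', y') \<in> ?G"
      then show "(r \<oplus>\<^bsub>ring_module R\<^esub> r', y \<oplus>\<^bsub>I\<^esub> y') \<in> ?G"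
        using HD(4)[of "r \<odot>\<^bsub>B\<^esub> b" y "r' \<odot>\<^bsub>B\<^esub> b" y'] b by (simp add: B.smult_l_distr)
    next
      fix s r y assume "s \<in> carrier R" "(r, y) \<in> ?G"
      then show "(s \<odot>\<^bsub>ring_module R\<^esub> r, s \<odot>\<^bsub>I\<^esub> y) \<in> ?G"
        using HD(5)[of s "r \<odot>\<^bsub>B\<^esub> b" y] b by (simp add: B.smult_assoc1)
    next
      fix y assume "(\<zero>\<^bsub>ring_module R\<^esub>, y) \<in> ?G"
      then show "y = \<zero>\<^bsub>I\<^esub>" using HD(6) b by simp
    qed (use HD(2,3) b in auto)
    from baer_graph[OF assms(2) this]
    obtain z where z1: "z \<in> carrier I" "\<And>r y. (r, y) \<in> ?G \<Longrightarrow> y = r \<odot>\<^bsub>I\<^esub> z" by blast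
    then have z: "z \<in> carrier I" "\<And>r y. r \<in> carrier R \<Longrightarrow> (r \<odot>\<^bsub>B\<^esub> b, y) \<in> H \<Longrightarrow> y = r \<odot>\<^bsub>I\<^esub> z"
      by auto
    let ?X = "{(x \<oplus>\<^bsub>B\<^esub> r \<odot>\<^bsub>B\<^esub> b, y \<oplus>\<^bsub>I\<^esub> r \<odot>\<^bsub>I\<^esub> z) | x y r. (x, y) \<in> H \<and> r \<in> carrier R}"
    have mem: "(x \<oplus>\<^bsub>B\<^esub> r \<odot>\<^bsub>B\<^esub> b, y \<oplus>\<^bsub>I\<^esub> r \<odot>\<^bsub>I\<^esub> z) \<in> ?X" if "(x, y) \<in> H" "r \<in> carrier R" for x y r
      using that by blast
    have HX: "(x, y) \<in> ?X" if "(x, y) \<in> H" for x y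
      using mem[OF that, of "\<zero>\<^bsub>R\<^esub>"] that HD(1,2) b z by simp
    have "linear_graph R B I ?X"
    proof (rule linear_graphI)
      show "(\<zero>\<^bsub>B\<^esub>, \<zero>\<^bsub>I\<^esub>) \<in> ?X" using HX HD(3) by blast
    next
      fix u v u' v' assume "(u, v) \<in> ?X" "(u', v') \<in> ?X"
      then obtain x y r x' y' r' where e: "u = x \<oplus>\<^bsub>B\<^esub> r \<odot>\<^bsub>B\<^esub> b" "v = y \<oplus>\<^bsub>I\<^esub> r \<odot>\<^bsub>I\<^esub> z"
        "u' = x' \<oplus>\<^bsub>B\<^esub> r' \<odot>\<^bsub>B\<^esub> b" "v' = y' \<oplus>\<^bsub>I\<^esub> r' \<odot>\<^bsub>I\<^esub> z" and
        h: "(x, y) \<in> H" "(x', y') \<in> H" "r \<in> carrier R" "r' \<in> carrier R" by auto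
      have "u \<oplus>\<^bsub>B\<^esub> u' = (x \<oplus>\<^bsub>B\<^esub> x') \<oplus>\<^bsub>B\<^esub> (r \<oplus>\<^bsub>R\<^esub> r') \<odot>\<^bsub>B\<^esub> b"
        "v \<oplus>\<^bsub>I\<^esub> v' = (y \<oplus>\<^bsub>I\<^esub> y') \<oplus>\<^bsub>I\<^esub> (r \<oplus>\<^bsub>R\<^esub> r') \<odot>\<^bsub>I\<^esub> z"
        using HD(1,2) h b z unfolding e
        by (simp_all add: B.smult_l_distr I.smult_l_distr B.M.a_ac I.M.a_ac)
      then show "(u \<oplus>\<^bsub>B\<^esub> u', v \<oplus>\<^bsub>I\<^esub> v') \<in> ?X"
        using mem[OF HD(4)[OF h(1,2)], of "r \<oplus>\<^bsub>R\<^esub> r'"] h by simp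
    next
      fix s u v assume s: "s \<in> carrier R" and "(u, v) \<in> ?X"
      then obtain x y r where e: "u = x \<oplus>\<^bsub>B\<^esub> r \<odot>\<^bsub>B\<^esub> b" "v = y \<oplus>\<^bsub>I\<^esub> r \<odot>\<^bsub>I\<^esub> z" and
        h: "(x, y) \<in> H" "r \<in> carrier R" by auto
      have "s \<odot>\<^bsub>B\<^esub> u = s \<odot>\<^bsub>B\<^esub> x \<oplus>\<^bsub>B\<^esub> (s \<otimes>\<^bsub>R\<^esub> r) \<odot>\<^bsub>B\<^esub> b"
        "s \<odot>\<^bsub>I\<^esub> v = s \<odot>\<^bsub>I\<^esub> y \<oplus>\<^bsub>I\<^esub> (s \<otimes>\<^bsub>R\<^esub> r) \<odot>\<^bsub>I\<^esub> z"
        using HD(1,2) h b z s unfolding e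
        by (simp_all add: B.smult_r_distr I.smult_r_distr B.smult_assoc1 I.smult_assoc1)
      then show "(s \<odot>\<^bsub>B\<^esub> u, s \<odot>\<^bsub>I\<^esub> v) \<in> ?X"
        using mem[OF HD(5)[OF s h(1)], of "s \<otimes>\<^bsub>R\<^esub> r"] h s by simp
    next
      fix v assume "(\<zero>\<^bsub>B\<^esub>, v) \<in> ?X"
      then obtain x y r where e: "\<zero>\<^bsub>B\<^esub> = x \<oplus>\<^bsub>B\<^esub> r \<odot>\<^bsub>B\<^esub> b" "v = y \<oplus>\<^bsub>I\<^esub> r \<odot>\<^bsub>I\<^esub> z" and
        h: "(x, y) \<in> H" "r \<in> carrier R" by auto
      have c: "x \<in> carrier B" "y \<in> carrier I" using HD(1,2) h by auto
      have "((\<ominus>\<^bsub>R\<^esub> \<one>\<^bsub>R\<^esub>) \<odot>\<^bsub>B\<^esub> x, (\<ominus>\<^bsub>R\<^esub> \<one>\<^bsub>R\<^esub>) \<odot>\<^bsub>I\<^esub> y) \<in> H" using HD(5)[OF _ h(1)] by simp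
      then have "(\<ominus>\<^bsub>B\<^esub> x, \<ominus>\<^bsub>I\<^esub> y) \<in> H" using c by (simp add: B.smult_l_minus I.smult_l_minus)
      moreover have "\<ominus>\<^bsub>B\<^esub> x = r \<odot>\<^bsub>B\<^esub> b"
        by (rule B.M.minus_equality) (use e(1) c b h in \<open>simp_all add: B.M.a_comm\<close>)
      ultimately have *: "\<ominus>\<^bsub>I\<^esub> y = r \<odot>\<^bsub>I\<^esub> z" using z(2) h by simp
      show "v = \<zero>\<^bsub>I\<^esub>" unfolding e(2) *[symmetric] using c by (simp add: I.M.r_neg)
    next
      fix u v assume "(u, v) \<in> ?X"
      then show "u \<in> carrier B" "v \<in> carrier I" using HD(1,2) b z(1) by auto
    qed
    moreover have "H \<subseteq> ?X" by (rule subrelI) (rule HX)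
    ultimately have "?X = H" by (rule max)
    moreover have "(b, z) \<in> ?X"
      using mem[OF HD(3), of "\<one>\<^bsub>R\<^esub>"] b z by simp
    ultimately show ?thesis by auto
  qed
  define g where "g x = (THE y. (x, y) \<in> H)" for x
  have g: "g x = y" if "(x, y) \<in> H" for x y
    unfolding g_def using that linear_graph_unique[OF assms(1) I.module_axioms H(1)]
    by (intro the_equality) auto
  have "g \<in> mod_hom R B I"
  proof (rule mod_homI)
    show "g x \<in> carrier I" if "x \<in> carrier B" for x using ex[OF that] g HD(2) by auto
    show "g (x \<oplus>\<^bsub>B\<^esub> y) = g x \<oplus>\<^bsub>I\<^esub> g y" if "x \<in> carrier B" "y \<in> carrier B" for x y
      using ex[OF that(1)] ex[OF that(2)] g HD(4) by metis
    show "g (r \<odot>\<^bsub>B\<^esub> x) = r \<odot>\<^bsub>I\<^esub> g x" if "r \<in> carrier R" "x \<in> carrier B" for r x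
      using ex[OF that(2)] that(1) g HD(5) by metis
  qed
  with that g H(2) show thesis by blast
qed

lemma baer_extend_sub:
  assumes "module R B" "baer R I" "submodule X R B" "f \<in> mod_hom R (sub B X) I"
  obtains g where "g \<in> mod_hom R B I" "\<And>x. x \<in> X \<Longrightarrow> g x = f x"
proof -
  have sB: "module R (sub B X)" using submodule_module assms by blast
  have "linear_graph R B I {(x, f x) | x. x \<in> X}"
  proof (rule linear_graphI)
    show "(\<zero>\<^bsub>B\<^esub>, \<zero>\<^bsub>I\<^esub>) \<in> {(x, f x) | x. x \<in> X}"
      using hom_zero[OF sB baer_module[OF assms(2)] assms(4)] submodule_zero[OF assms(3)] by force
    show "y = \<zero>\<^bsub>I\<^esub>" if "(\<zero>\<^bsub>B\<^esub>, y) \<in> {(x, f x) | x. x \<in> X}" for y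
      using that hom_zero[OF sB baer_module[OF assms(2)] assms(4)] by simp
  qed (use hom_closed[OF assms(4)] hom_add[OF assms(4)] hom_smult[OF assms(4)] assms(3)
       in \<open>auto intro: submodule_intros\<close>)
  then show thesis by (rule baer_extend[OF assms(1,2)]) (erule that, auto)
qed

section \<open>Copies, quotients and products of modules\<close>

lemma module_of_surjection:
  assumes "module R M" "p ` carrier M = carrier Q" "p \<zero>\<^bsub>M\<^esub> = \<zero>\<^bsub>Q\<^esub>"
    and add: "\<And>x y. \<lbrakk>x \<in> carrier M; y \<in> carrier M\<rbrakk> \<Longrightarrow> p x \<oplus>\<^bsub>Q\<^esub> p y = p (x \<oplus>\<^bsub>M\<^esub> y)"
    and smult: "\<And>r x. \<lbrakk>r \<in> carrier R; x \<in> carrier M\<rbrakk> \<Longrightarrow> r \<odot>\<^bsub>Q\<^esub> p x = p (r \<odot>\<^bsub>M\<^esub> x)"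
  shows "module R Q" "p \<in> mod_hom R M Q"
proof -
  interpret module R M by fact
  have inv: "\<exists>y\<in>carrier M. p (y \<oplus>\<^bsub>M\<^esub> u) = p \<zero>\<^bsub>M\<^esub>" if "u \<in> carrier M" for u
    using that by (intro bexI[of _ "\<ominus>\<^bsub>M\<^esub> u"]) (simp_all add: M.l_neg)
  show "module R Q"
  proof (rule moduleI)
    have "carrier Q = p ` carrier M" using assms(2) by simp
    then show "abelian_group Q"
      by (intro abelian_groupI)
         (auto simp: add assms(3)[symmetric] M.a_assoc intro!: imageI inv arg_cong[of _ _ p] M.a_comm)
    show "cring R" by (rule module_cring[OF assms(1)])
  qed (auto simp: add smult smult_l_distr smult_r_distr smult_assoc1 simp flip: assms(2))
  show "p \<in> mod_hom R M Q" by (rule mod_homI) (use assms(2) in \<open>auto simp: add smult\<close>)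
qed

text \<open>
  Transport of structure along a map \<open>h\<close> that is injective on the carrier. It moves modules between
  types, in particular into the universe in which injective dimension is defined.
\<close>

definition copy_module :: "('a \<Rightarrow> 'b) \<Rightarrow> ('r, 'a) module \<Rightarrow> ('r, 'b) module" where
  "copy_module h M = (let k = inv_into (carrier M) h in
     \<lparr>carrier = h ` carrier M, monoid.mult = undefined, one = undefined, zero = h \<zero>\<^bsub>M\<^esub>,
      add = (\<lambda>x y. h (k x \<oplus>\<^bsub>M\<^esub> k y)), smult = (\<lambda>r x. h (r \<odot>\<^bsub>M\<^esub> k x))\<rparr>)"

lemma copy_module:
  assumes "module R M" "inj_on h (carrier M)"
  shows "module R (copy_module h M)" "h \<in> mod_hom R M (copy_module h M)"
    "inv_into (carrier M) h \<in> mod_hom R (copy_module h M) M"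
    "carrier (copy_module h M) = h ` carrier M" "zero (copy_module h M) = h \<zero>\<^bsub>M\<^esub>"
proof -
  interpret module R M by fact
  show "carrier (copy_module h M) = h ` carrier M" "zero (copy_module h M) = h \<zero>\<^bsub>M\<^esub>"
    by (simp_all add: copy_module_def Let_def)
  show "module R (copy_module h M)" "h \<in> mod_hom R M (copy_module h M)"
    by (rule module_of_surjection[OF assms(1), of h]; simp add: copy_module_def Let_def assms(2))+
  show "inv_into (carrier M) h \<in> mod_hom R (copy_module h M) M"
    by (rule mod_homI) (auto simp: copy_module_def Let_def assms(2))
qed

lemma quotient_module:
  assumes "module R M" "submodule N R M"
  defines "p \<equiv> (\<lambda>x. N +>\<^bsub>M\<^esub> x)"
  shows "module R (quotient_module M N)" "p \<in> mod_hom R M (quotient_module M N)"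
    "p ` carrier M = carrier (quotient_module M N)"
    "a_kernel M (quotient_module M N) p = N"
    "\<zero>\<^bsub>quotient_module M N\<^esub> = N"
proof -
  interpret module R M by fact
  interpret N: abelian_subgroup N M
    by (rule abelian_subgroupI3)
       (use submodule.axioms(1)[OF assms(2)] in \<open>auto intro: additive_subgroup.intro M.abelian_group_axioms\<close>)
  have pN: "p x = N \<longleftrightarrow> x \<in> N" if "x \<in> carrier M" for x
    unfolding p_def using that N.a_rcos_const N.a_rcos_self by blast
  have sm: "(\<Union>y\<in>p x. N +>\<^bsub>M\<^esub> (r \<odot>\<^bsub>M\<^esub> y)) = p (r \<odot>\<^bsub>M\<^esub> x)" if "r \<in> carrier R" "x \<in> carrier M" for r x
  proof -
    have "N +>\<^bsub>M\<^esub> (r \<odot>\<^bsub>M\<^esub> y) = p (r \<odot>\<^bsub>M\<^esub> x)" if y: "y \<in> p x" for y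
    proof -
      have yc: "y \<in> carrier M"
        using y \<open>x \<in> carrier M\<close> N.a_elemrcos_carrier unfolding p_def by blast
      have "y \<oplus>\<^bsub>M\<^esub> \<ominus>\<^bsub>M\<^esub> x \<in> N" using y \<open>x \<in> carrier M\<close> N.a_rcos_module_imp unfolding p_def by blast
      then have "r \<odot>\<^bsub>M\<^esub> (y \<oplus>\<^bsub>M\<^esub> \<ominus>\<^bsub>M\<^esub> x) \<in> N" using assms(2) \<open>r \<in> _\<close> by (simp add: submodule_smult)
      then have "r \<odot>\<^bsub>M\<^esub> y \<oplus>\<^bsub>M\<^esub> \<ominus>\<^bsub>M\<^esub> (r \<odot>\<^bsub>M\<^esub> x) \<in> N"
        using \<open>r \<in> _\<close> \<open>x \<in> _\<close> yc by (simp add: smult_r_distr smult_r_minus)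
      then have "r \<odot>\<^bsub>M\<^esub> y \<in> N +>\<^bsub>M\<^esub> (r \<odot>\<^bsub>M\<^esub> x)"
        using \<open>r \<in> _\<close> \<open>x \<in> _\<close> yc by (intro N.a_rcos_module_rev) auto
      then show ?thesis unfolding p_def
        using \<open>r \<in> _\<close> \<open>x \<in> _\<close> by (metis N.a_repr_independence' smult_closed)
    qed
    moreover have "p x \<noteq> {}" using \<open>x \<in> _\<close> N.a_rcos_self unfolding p_def by blast
    ultimately show ?thesis by simp
  qed
  show im: "p ` carrier M = carrier (quotient_module M N)"
    by (auto simp: quotient_module_def A_RCOSETS_def' p_def)
  have p0: "p \<zero>\<^bsub>M\<^esub> = N" using pN[of "\<zero>\<^bsub>M\<^esub>"] submodule_zero[OF assms(2)] by simp
  show "\<zero>\<^bsub>quotient_module M N\<^esub> = N" by (simp add: quotient_module_def)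
  show "module R (quotient_module M N)" "p \<in> mod_hom R M (quotient_module M N)"
    by (rule module_of_surjection[OF assms(1) im];
        use p0 sm N.a_rcos_sum in \<open>simp add: quotient_module_def p_def\<close>)+
  have "a_kernel M (quotient_module M N) p = {x \<in> carrier M. p x = N}"
    by (simp add: a_kernel_def' quotient_module_def)
  also have "\<dots> = N" using pN submodule_mem[OF assms(2)] by blast
  finally show "a_kernel M (quotient_module M N) p = N" .
qed

lemma hom_factor:
  assumes "module R M" "module R Q" "module R P" "p \<in> mod_hom R M Q" "p ` carrier M = carrier Q"
    and "g \<in> mod_hom R M P" "\<And>x. \<lbrakk>x \<in> carrier M; p x = \<zero>\<^bsub>Q\<^esub>\<rbrakk> \<Longrightarrow> g x = \<zero>\<^bsub>P\<^esub>"
  obtains \<phi> where "\<phi> \<in> mod_hom R Q P" "\<And>x. x \<in> carrier M \<Longrightarrow> \<phi> (p x) = g x"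
proof -
  interpret M: module R M by fact
  interpret Q: module R Q by fact
  interpret P: module R P by fact
  define \<phi> where "\<phi> q = g (SOME x. x \<in> carrier M \<and> p x = q)" for q
  have key: "\<phi> (p x) = g x" if "x \<in> carrier M" for x
  proof -
    define y where "y = (SOME y. y \<in> carrier M \<and> p y = p x)"
    have y: "y \<in> carrier M" "p y = p x"
      unfolding y_def using someI[of "\<lambda>y. y \<in> carrier M \<and> p y = p x" x] that by auto
    then have "p (y \<ominus>\<^bsub>M\<^esub> x) = \<zero>\<^bsub>Q\<^esub>"
      using that hom_closed[OF assms(4)] by (simp add: hom_diff[OF assms(1,2,4)])
    then have "g (y \<ominus>\<^bsub>M\<^esub> x) = \<zero>\<^bsub>P\<^esub>" using assms(7) y that by simp
    then show ?thesis unfolding \<phi>_def y_def[symmetric]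
      using that y hom_closed[OF assms(6)] by (simp add: hom_diff[OF assms(1,3,6)])
  qed
  have ex: "\<exists>x\<in>carrier M. q = p x" if "q \<in> carrier Q" for q using that assms(5) by blast
  have "\<phi> \<in> mod_hom R Q P"
  proof (rule mod_homI)
    fix q assume "q \<in> carrier Q"
    with ex key show "\<phi> q \<in> carrier P" using hom_closed[OF assms(6)] by metis
  next
    fix q q' assume "q \<in> carrier Q" "q' \<in> carrier Q"
    then obtain x x' where x: "x \<in> carrier M" "q = p x" "x' \<in> carrier M" "q' = p x'" using ex by metis
    then show "\<phi> (q \<oplus>\<^bsub>Q\<^esub> q') = \<phi> q \<oplus>\<^bsub>P\<^esub> \<phi> q'"
      using key[of "x \<oplus>\<^bsub>M\<^esub> x'"] by (simp add: key hom_add[OF assms(4)] hom_add[OF assms(6)])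
  next
    fix r q assume "r \<in> carrier R" "q \<in> carrier Q"
    then obtain x where x: "x \<in> carrier M" "q = p x" using ex by metis
    then show "\<phi> (r \<odot>\<^bsub>Q\<^esub> q) = r \<odot>\<^bsub>P\<^esub> \<phi> q"
      using key[of "r \<odot>\<^bsub>M\<^esub> x"] \<open>r \<in> _\<close> by (simp add: key hom_smult[OF assms(4)] hom_smult[OF assms(6)])
  qed
  with key that show thesis by blast
qed

definition prod_module :: "('r, 'a) module \<Rightarrow> ('r, 'b) module \<Rightarrow> ('r, 'a \<times> 'b) module" where
  "prod_module A B = \<lparr>carrier = carrier A \<times> carrier B, monoid.mult = undefined, one = undefined,
     zero = (\<zero>\<^bsub>A\<^esub>, \<zero>\<^bsub>B\<^esub>), add = (\<lambda>x y. (fst x \<oplus>\<^bsub>A\<^esub> fst y, snd x \<oplus>\<^bsub>B\<^esub> snd y)),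
     smult = (\<lambda>r x. (r \<odot>\<^bsub>A\<^esub> fst x, r \<odot>\<^bsub>B\<^esub> snd x))\<rparr>"

lemma prod_module_simps [simp]:
  "carrier (prod_module A B) = carrier A \<times> carrier B"
  "zero (prod_module A B) = (\<zero>\<^bsub>A\<^esub>, \<zero>\<^bsub>B\<^esub>)"
  "add (prod_module A B) x y = (fst x \<oplus>\<^bsub>A\<^esub> fst y, snd x \<oplus>\<^bsub>B\<^esub> snd y)"
  "smult (prod_module A B) r x = (r \<odot>\<^bsub>A\<^esub> fst x, r \<odot>\<^bsub>B\<^esub> snd x)"
  by (auto simp: prod_module_def)

lemma prod_module:
  assumes "module R A" "module R B" shows "module R (prod_module A B)"
proof -
  interpret A: module R A by fact
  interpret B: module R B by fact
  have inv: "\<exists>y\<in>carrier A \<times> carrier B. fst y \<oplus>\<^bsub>A\<^esub> a = \<zero>\<^bsub>A\<^esub> \<and> snd y \<oplus>\<^bsub>B\<^esub> b = \<zero>\<^bsub>B\<^esub>"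
    if "a \<in> carrier A" "b \<in> carrier B" for a b
    using that by (intro bexI[of _ "(\<ominus>\<^bsub>A\<^esub> a, \<ominus>\<^bsub>B\<^esub> b)"]) (auto simp: A.M.l_neg B.M.l_neg)
  show ?thesis
  proof (rule moduleI)
    show "abelian_group (prod_module A B)"
      by (rule abelian_groupI) (auto simp: A.M.a_ac B.M.a_ac inv)
  qed (auto simp: module_cring[OF assms(1)] A.smult_l_distr B.smult_l_distr
      A.smult_r_distr B.smult_r_distr A.smult_assoc1 B.smult_assoc1)
qed

lemma baer_prod:
  assumes "baer R A" "baer R B" shows "baer R (prod_module A B)"
proof (rule baerI)
  show "module R (prod_module A B)" using assms by (intro prod_module baer_module)
  fix J f assume J: "ideal J R" and f: "\<And>a. a \<in> J \<Longrightarrow> f a \<in> carrier (prod_module A B)"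
    "\<And>a b. a \<in> J \<Longrightarrow> b \<in> J \<Longrightarrow> f (a \<oplus>\<^bsub>R\<^esub> b) = f a \<oplus>\<^bsub>prod_module A B\<^esub> f b"
    "\<And>r a. r \<in> carrier R \<Longrightarrow> a \<in> J \<Longrightarrow> f (r \<otimes>\<^bsub>R\<^esub> a) = r \<odot>\<^bsub>prod_module A B\<^esub> f a"
  obtain y where y: "y \<in> carrier A" "\<And>a. a \<in> J \<Longrightarrow> fst (f a) = a \<odot>\<^bsub>A\<^esub> y"
    using assms(1) J by (rule baerD[where f = "\<lambda>a. fst (f a)"]) (use f in \<open>auto simp: mem_Times_iff\<close>)
  obtain z where z: "z \<in> carrier B" "\<And>a. a \<in> J \<Longrightarrow> snd (f a) = a \<odot>\<^bsub>B\<^esub> z"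
    using assms(2) J by (rule baerD[where f = "\<lambda>a. snd (f a)"]) (use f in \<open>auto simp: mem_Times_iff\<close>)
  show "\<exists>y\<in>carrier (prod_module A B). \<forall>a\<in>J. f a = a \<odot>\<^bsub>prod_module A B\<^esub> y"
    using y z by (intro bexI[of _ "(y, z)"]) (auto simp: prod_eq_iff)
qed

text \<open>
  A linear map from an ideal to a retract \<open>N\<close> of \<open>M\<close> is multiplication by some \<open>y\<close> when regarded as a
  map to \<open>M\<close>, and then it is multiplication by the image of \<open>y\<close> in \<open>N\<close>.
\<close>

lemma baer_retract:
  assumes "baer R M" "module R N" "f \<in> mod_hom R M N" "g \<in> mod_hom R N M"
    and "\<And>x. x \<in> carrier N \<Longrightarrow> f (g x) = x"
  shows "baer R N"
proof (rule baerI[OF assms(2)])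
  fix J \<phi> assume J: "ideal J R" and \<phi>: "\<And>a. a \<in> J \<Longrightarrow> \<phi> a \<in> carrier N"
    "\<And>a b. a \<in> J \<Longrightarrow> b \<in> J \<Longrightarrow> \<phi> (a \<oplus>\<^bsub>R\<^esub> b) = \<phi> a \<oplus>\<^bsub>N\<^esub> \<phi> b"
    "\<And>r a. r \<in> carrier R \<Longrightarrow> a \<in> J \<Longrightarrow> \<phi> (r \<otimes>\<^bsub>R\<^esub> a) = r \<odot>\<^bsub>N\<^esub> \<phi> a"
  obtain y where y: "y \<in> carrier M" "\<And>a. a \<in> J \<Longrightarrow> g (\<phi> a) = a \<odot>\<^bsub>M\<^esub> y"
    using assms(1) J
    by (rule baerD[where f = "\<lambda>a. g (\<phi> a)"])
       (use \<phi> in \<open>auto simp: hom_closed[OF assms(4)] hom_add[OF assms(4)] hom_smult[OF assms(4)]\<close>)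
  have "\<phi> a = a \<odot>\<^bsub>N\<^esub> f y" if "a \<in> J" for a
    using that y \<phi>(1) assms(5) hom_smult[OF assms(3), of a y] ideal.Icarr[OF J] by metis
  then show "\<exists>y\<in>carrier N. \<forall>a\<in>J. \<phi> a = a \<odot>\<^bsub>N\<^esub> y" using y hom_closed[OF assms(3)] by blast
qed

lemma baer_zero:
  assumes "module R M" "carrier M = {\<zero>\<^bsub>M\<^esub>}" shows "baer R M"
proof (rule baerI[OF assms(1)])
  interpret module R M by fact
  fix J f assume "ideal J R" "\<And>a. a \<in> J \<Longrightarrow> f a \<in> carrier M"
  then show "\<exists>y\<in>carrier M. \<forall>a\<in>J. f a = a \<odot>\<^bsub>M\<^esub> y"
    using assms(2) ideal.Icarr by (intro bexI[of _ "\<zero>\<^bsub>M\<^esub>"]) fastforce+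
qed

text \<open>
  Baer's criterion shows that the test modules in the universe decide injectivity. One direction
  extends along linear graphs. For the other one, \<open>R\<close> and its ideals have copies in the universe:
  an element \<open>r\<close> is sent to the indicator function of \<open>{r}\<close>.
\<close>

lemma injective_module_iff_baer:
  fixes R :: "('r, 'x) ring_scheme" and I :: "('r, 'a) module"
  shows "injective_module R I \<longleftrightarrow> baer R I"
proof
  assume inj: "injective_module R I"
  then interpret I: module R I by (simp add: injective_module_def)
  have RM: "module R (ring_module R)" by (rule ring_module[OF module_cring[OF I.module_axioms]])
  define h :: "'r \<Rightarrow> ('r, 'a) universe" where "h r = (\<lambda>s. (undefined, if s = r then 1 else 0))" for r
  have h: "inj h"
  proof (rule injI)
    fix r s assume "h r = h s"
    from fun_cong[OF this, of r] show "r = s" by (simp add: h_def split: if_splits)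
  qed
  let ?RU = "copy_module h (ring_module R)" and ?k = "inv_into (carrier R) h"
  note cp = copy_module[OF RM, of h, simplified, OF inj_on_subset[OF h subset_UNIV]]
  have k: "?k (h r) = r" if "r \<in> carrier R" for r
    using that inv_into_f_f[OF inj_on_subset[OF h subset_UNIV]] by metis
  show "baer R I"
  proof (rule baerI)
    fix J f assume J: "ideal J R" and f: "\<And>a. a \<in> J \<Longrightarrow> f a \<in> carrier I"
      "\<And>a b. a \<in> J \<Longrightarrow> b \<in> J \<Longrightarrow> f (a \<oplus>\<^bsub>R\<^esub> b) = f a \<oplus>\<^bsub>I\<^esub> f b"
      "\<And>r a. r \<in> carrier R \<Longrightarrow> a \<in> J \<Longrightarrow> f (r \<otimes>\<^bsub>R\<^esub> a) = r \<odot>\<^bsub>I\<^esub> f a"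
    interpret J: ideal J R by fact
    have sJ: "submodule J R (ring_module R)"
      by (rule submoduleI'[OF RM]) (auto intro: J.Icarr J.I_l_closed)
    have sJ': "submodule (h ` J) R ?RU" by (rule submodule_image[OF RM cp(1,2) sJ])
    have fk: "(\<lambda>x. f (?k x)) \<in> mod_hom R (sub ?RU (h ` J)) I"
      by (rule mod_homI)
         (use J.Icarr J.I_l_closed f k in \<open>auto simp: copy_module_def Let_def\<close>)
    have "\<exists>g\<in>mod_hom R ?RU I. \<forall>x\<in>carrier (sub ?RU (h ` J)). g (id x) = f (?k x)"
    proof (rule inj[unfolded injective_module_def, THEN conjunct2, rule_format])
      show "module R (sub ?RU (h ` J)) \<and> module R ?RU \<and>
        id \<in> mod_hom R (sub ?RU (h ` J)) ?RU \<and> inj_on id (carrier (sub ?RU (h ` J))) \<and>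
        (\<lambda>x. f (?k x)) \<in> mod_hom R (sub ?RU (h ` J)) I"
        using submodule_module[OF cp(1) sJ'] cp(1) fk submodule_mem[OF sJ']
        by (auto simp: mod_hom_def)
    qed
    then obtain g where g: "g \<in> mod_hom R ?RU I" "\<And>a. a \<in> J \<Longrightarrow> g (h a) = f a"
      using k J.Icarr by auto
    have "f a = a \<odot>\<^bsub>I\<^esub> g (h \<one>\<^bsub>R\<^esub>)" if "a \<in> J" for a
    proof -
      have "f a = g (h (a \<odot>\<^bsub>ring_module R\<^esub> \<one>\<^bsub>R\<^esub>))" using that g J.Icarr by simp
      also have "\<dots> = a \<odot>\<^bsub>I\<^esub> g (h \<one>\<^bsub>R\<^esub>)"
        using that J.Icarr cp(4) by (subst hom_smult[OF hom_comp[OF cp(2) g(1)]]) auto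
      finally show ?thesis .
    qed
    moreover have "g (h \<one>\<^bsub>R\<^esub>) \<in> carrier I" using hom_closed[OF hom_comp[OF cp(2) g(1)], of "\<one>\<^bsub>R\<^esub>"] by simp
    ultimately show "\<exists>y\<in>carrier I. \<forall>a\<in>J. f a = a \<odot>\<^bsub>I\<^esub> y" by blast
  qed (fact I.module_axioms)
next
  assume B: "baer R I"
  show "injective_module R I"
    unfolding injective_module_def
  proof (intro conjI allI impI baer_module[OF B])
    fix A B' :: "('r, ('r, 'a) universe) module" and j f
    assume "module R A \<and> module R B' \<and> j \<in> mod_hom R A B' \<and> inj_on j (carrier A) \<and> f \<in> mod_hom R A I"
    then have a: "module R A" "module R B'" "j \<in> mod_hom R A B'" "inj_on j (carrier A)" "f \<in> mod_hom R A I"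
      by auto
    interpret A: module R A by fact
    have j0: "j \<zero>\<^bsub>A\<^esub> = \<zero>\<^bsub>B'\<^esub>" and f0: "f \<zero>\<^bsub>A\<^esub> = \<zero>\<^bsub>I\<^esub>"
      using hom_zero a baer_module[OF B] by metis+
    let ?G = "{(j x, f x) | x. x \<in> carrier A}"
    have "linear_graph R B' I ?G"
    proof (rule linear_graphI)
      show "(\<zero>\<^bsub>B'\<^esub>, \<zero>\<^bsub>I\<^esub>) \<in> ?G" using j0 f0 A.M.zero_closed by force
      show "y = \<zero>\<^bsub>I\<^esub>" if "(\<zero>\<^bsub>B'\<^esub>, y) \<in> ?G" for y
      proof -
        from that obtain x where x: "x \<in> carrier A" "j x = j \<zero>\<^bsub>A\<^esub>" "y = f x" using j0 by auto
        then have "x = \<zero>\<^bsub>A\<^esub>" using inj_onD[OF a(4)] A.M.zero_closed by metis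
        with x f0 show ?thesis by simp
      qed
    next
      fix x y x' y' assume "(x, y) \<in> ?G" "(x', y') \<in> ?G"
      then obtain u u' where "u \<in> carrier A" "u' \<in> carrier A" "x = j u" "y = f u" "x' = j u'" "y' = f u'"
        by blast
      then show "(x \<oplus>\<^bsub>B'\<^esub> x', y \<oplus>\<^bsub>I\<^esub> y') \<in> ?G"
        by (intro CollectI exI[of _ "u \<oplus>\<^bsub>A\<^esub> u'"]) (simp add: hom_add[OF a(3)] hom_add[OF a(5)])
    next
      fix r x y assume "r \<in> carrier R" "(x, y) \<in> ?G"
      then obtain u where "u \<in> carrier A" "x = j u" "y = f u" by blast
      then show "(r \<odot>\<^bsub>B'\<^esub> x, r \<odot>\<^bsub>I\<^esub> y) \<in> ?G" using \<open>r \<in> _\<close>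
        by (intro CollectI exI[of _ "r \<odot>\<^bsub>A\<^esub> u"]) (simp add: hom_smult[OF a(3)] hom_smult[OF a(5)])
    next
      fix x y assume "(x, y) \<in> ?G"
      then show "x \<in> carrier B'" "y \<in> carrier I" using hom_closed[OF a(3)] hom_closed[OF a(5)] by auto
    qed
    from baer_extend[OF a(2) B this]
    obtain g where "g \<in> mod_hom R B' I" "\<And>x y. (x, y) \<in> ?G \<Longrightarrow> g x = y" by blast
    then show "\<exists>g\<in>mod_hom R B' I. \<forall>x\<in>carrier A. g (j x) = f x" by blast
  qed
qed

section \<open>Splitting and annihilators\<close>

lemma kernel_iff: "x \<in> a_kernel M N f \<longleftrightarrow> x \<in> carrier M \<and> f x = \<zero>\<^bsub>N\<^esub>"
  by (simp add: a_kernel_def')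

lemma hom_neg:
  assumes "module R N" "f \<in> mod_hom R M N"
  shows "(\<lambda>x. \<ominus>\<^bsub>N\<^esub> f x) \<in> mod_hom R M N"
proof -
  interpret N: module R N by fact
  show ?thesis
    by (rule mod_homI)
       (simp_all add: hom_closed[OF assms(2)] hom_add[OF assms(2)] hom_smult[OF assms(2)]
          N.M.minus_add N.smult_r_minus)
qed

lemma hom_sub_id: "X \<subseteq> carrier M \<Longrightarrow> (\<lambda>x. x) \<in> mod_hom R (sub M X) M"
  by (auto simp: mod_hom_def)

text \<open>
  An injective kernel has a retraction \<open>\<rho>\<close>. The map \<open>x \<mapsto> x - \<rho> x\<close> vanishes on the kernel, so it
  factors through the image, and the factor is the splitting.
\<close>

lemma split_surjection:
  assumes "module R E" "module R Y" "g \<in> mod_hom R E Y" "baer R (sub E (a_kernel E Y g))"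
  obtains s where "s \<in> mod_hom R (sub Y (g ` carrier E)) E"
    "\<And>y. y \<in> g ` carrier E \<Longrightarrow> g (s y) = y"
proof -
  interpret E: module R E by fact
  interpret Y: module R Y by fact
  let ?K = "a_kernel E Y g"
  have sK: "submodule ?K R E" by (rule submodule_kernel[OF assms(1-3)])
  have id: "(\<lambda>x. x) \<in> mod_hom R (sub E ?K) (sub E ?K)" by (auto simp: mod_hom_def)
  obtain \<rho> where \<rho>: "\<rho> \<in> mod_hom R E (sub E ?K)" "\<And>x. x \<in> ?K \<Longrightarrow> \<rho> x = x"
    using baer_extend_sub[OF assms(1,4) sK id] by blast
  have \<rho>': "\<rho> \<in> mod_hom R E E" using hom_enlarge[OF \<rho>(1)] submodule_mem[OF sK] by blast
  have \<rho>K: "\<rho> x \<in> ?K" if "x \<in> carrier E" for x using hom_closed[OF \<rho>(1) that] by simp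
  have \<tau>: "(\<lambda>x. x \<ominus>\<^bsub>E\<^esub> \<rho> x) \<in> mod_hom R E E"
    by (rule hom_id_minus[OF assms(1) \<rho>'])
  have sY: "submodule (g ` carrier E) R Y"
    by (rule submodule_image[OF assms(1-3) submodule_carrier[OF assms(1)]])
  have gY: "g \<in> mod_hom R E (sub Y (g ` carrier E))" using assms(3) by (auto intro: hom_corestrict)
  obtain s where s: "s \<in> mod_hom R (sub Y (g ` carrier E)) E"
    "\<And>x. x \<in> carrier E \<Longrightarrow> s (g x) = x \<ominus>\<^bsub>E\<^esub> \<rho> x"
    by (rule hom_factor[OF assms(1) submodule_module[OF assms(2) sY] assms(1) gY _ \<tau>])
       (auto simp: \<rho>(2) kernel_iff)
  have "g (s y) = y" if y: "y \<in> g ` carrier E" for y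
  proof -
    from y obtain x where x: "x \<in> carrier E" "y = g x" by blast
    have "g (\<rho> x) = \<zero>\<^bsub>Y\<^esub>" using \<rho>K[OF x(1)] by (simp add: kernel_iff)
    then show ?thesis unfolding x(2) s(2)[OF x(1)]
      using x hom_closed[OF \<rho>'] hom_closed[OF assms(3)] by (simp add: hom_diff[OF assms(1-3)])
  qed
  with s(1) that show thesis by blast
qed

text \<open>
  The splitting \<open>s\<close> is linear, so \<open>r y = 0\<close> implies \<open>r s(y) = 0\<close>. In other words, for the annihilator \<open>J\<close>
  of \<open>y\<close> the map \<open>Hom(R/J, E) \<rightarrow> Hom(R/J, g E)\<close> hits \<open>y\<close>.
\<close>

lemma annihilator_preserving_lift:
  assumes "module R E" "module R Y" "g \<in> mod_hom R E Y" "baer R (sub E (a_kernel E Y g))"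
    and "y \<in> g ` carrier E"
  obtains e where "e \<in> carrier E" "g e = y"
    "\<And>r. r \<in> carrier R \<Longrightarrow> r \<odot>\<^bsub>Y\<^esub> y = \<zero>\<^bsub>Y\<^esub> \<Longrightarrow> r \<odot>\<^bsub>E\<^esub> e = \<zero>\<^bsub>E\<^esub>"
proof -
  obtain s where s: "s \<in> mod_hom R (sub Y (g ` carrier E)) E"
    "\<And>y. y \<in> g ` carrier E \<Longrightarrow> g (s y) = y"
    using split_surjection[OF assms(1-4)] by blast
  have sY: "submodule (g ` carrier E) R Y"
    by (rule submodule_image[OF assms(1-3) submodule_carrier[OF assms(1)]])
  have s0: "s \<zero>\<^bsub>Y\<^esub> = \<zero>\<^bsub>E\<^esub>"
    using hom_zero[OF submodule_module[OF assms(2) sY] assms(1) s(1)] by simp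
  show thesis
  proof (rule that[of "s y"])
    show "s y \<in> carrier E" using hom_closed[OF s(1)] assms(5) by simp
    show "g (s y) = y" using s(2) assms(5) by blast
    show "r \<odot>\<^bsub>E\<^esub> s y = \<zero>\<^bsub>E\<^esub>" if "r \<in> carrier R" "r \<odot>\<^bsub>Y\<^esub> y = \<zero>\<^bsub>Y\<^esub>" for r
      using hom_smult[OF s(1) that(1), of y] assms(5) that(2) s0 by simp
  qed
qed

lemma baer_image:
  assumes "baer R E" "module R Y" "g \<in> mod_hom R E Y" "baer R (sub E (a_kernel E Y g))"
  shows "baer R (sub Y (g ` carrier E))"
proof -
  obtain s where s: "s \<in> mod_hom R (sub Y (g ` carrier E)) E"
    "\<And>y. y \<in> g ` carrier E \<Longrightarrow> g (s y) = y"
    using split_surjection[OF baer_module[OF assms(1)] assms(2-4)] by blast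
  have sY: "submodule (g ` carrier E) R Y"
    using submodule_image submodule_carrier assms baer_module by metis
  show ?thesis
    by (rule baer_retract[OF assms(1) submodule_module[OF assms(2) sY] hom_corestrict[OF assms(3)] s(1)])
       (use s(2) in auto)
qed

text \<open>
  The hypothesis says that \<open>Ext\<^sup>1(R/J, K) = 0\<close> for the kernel \<open>K\<close> and all ideals \<open>J\<close>. A map from \<open>J\<close> to
  \<open>K\<close> is multiplication by some \<open>y\<close> in \<open>E\<close>; then \<open>J\<close> kills \<open>g y\<close>, and correcting \<open>y\<close> by a lift of \<open>g y\<close>
  that is killed by \<open>J\<close> moves it into \<open>K\<close>.
\<close>

lemma baer_kernelI:
  assumes "baer R E" "module R Y" "g \<in> mod_hom R E Y"
    and "\<And>y J. \<lbrakk>ideal J R; y \<in> g ` carrier E; \<And>r. r \<in> J \<Longrightarrow> r \<odot>\<^bsub>Y\<^esub> y = \<zero>\<^bsub>Y\<^esub>\<rbrakk>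
      \<Longrightarrow> \<exists>e\<in>carrier E. g e = y \<and> (\<forall>r\<in>J. r \<odot>\<^bsub>E\<^esub> e = \<zero>\<^bsub>E\<^esub>)"
  shows "baer R (sub E (a_kernel E Y g))"
proof (rule baerI)
  have mE: "module R E" by (rule baer_module[OF assms(1)])
  interpret E: module R E by fact
  interpret Y: module R Y by fact
  have sK: "submodule (a_kernel E Y g) R E" by (rule submodule_kernel[OF mE assms(2,3)])
  then show "module R (sub E (a_kernel E Y g))" by (rule submodule_module[OF mE])
  fix J f assume J: "ideal J R" and f: "\<And>a. a \<in> J \<Longrightarrow> f a \<in> carrier (sub E (a_kernel E Y g))"
    "\<And>a b. a \<in> J \<Longrightarrow> b \<in> J \<Longrightarrow> f (a \<oplus>\<^bsub>R\<^esub> b) = f a \<oplus>\<^bsub>sub E (a_kernel E Y g)\<^esub> f b"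
    "\<And>r a. r \<in> carrier R \<Longrightarrow> a \<in> J \<Longrightarrow> f (r \<otimes>\<^bsub>R\<^esub> a) = r \<odot>\<^bsub>sub E (a_kernel E Y g)\<^esub> f a"
  have fc: "f a \<in> carrier E" "g (f a) = \<zero>\<^bsub>Y\<^esub>" if "a \<in> J" for a using f(1)[OF that] by (simp_all add: kernel_iff)
  have Jc: "a \<in> carrier R" if "a \<in> J" for a using ideal.Icarr[OF J that] .
  obtain y where y: "y \<in> carrier E" "\<And>a. a \<in> J \<Longrightarrow> f a = a \<odot>\<^bsub>E\<^esub> y"
    using assms(1) J by (rule baerD[where f = f]) (use f fc in auto)
  have "a \<odot>\<^bsub>Y\<^esub> g y = \<zero>\<^bsub>Y\<^esub>" if "a \<in> J" for a
    using fc(2)[OF that] y(2)[OF that] y(1) Jc[OF that] hom_smult[OF assms(3)] by metis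
  with assms(4)[OF J, of "g y"] y(1)
  obtain e where e: "e \<in> carrier E" "g e = g y" "\<And>r. r \<in> J \<Longrightarrow> r \<odot>\<^bsub>E\<^esub> e = \<zero>\<^bsub>E\<^esub>" by blast
  have "y \<ominus>\<^bsub>E\<^esub> e \<in> a_kernel E Y g"
    using y(1) e hom_closed[OF assms(3)] by (simp add: kernel_iff hom_diff[OF mE assms(2,3)])
  moreover have "f a = a \<odot>\<^bsub>E\<^esub> (y \<ominus>\<^bsub>E\<^esub> e)" if "a \<in> J" for a
    using that y e Jc by (simp add: E.smult_diff)
  ultimately show "\<exists>y\<in>carrier (sub E (a_kernel E Y g)). \<forall>a\<in>J. f a = a \<odot>\<^bsub>sub E (a_kernel E Y g)\<^esub> y"
    by auto
qed

text \<open>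
  The element \<open>y\<close> is a map \<open>R/(I : a) \<rightarrow> E\<close>. Multiplication by \<open>a\<close> embeds \<open>R/(I : a)\<close> into \<open>R/I\<close>, and
  \<open>w\<close> is an extension of \<open>y\<close> to \<open>R/I\<close>.
\<close>

lemma baer_solve:
  assumes "baer R E" "ideal I R" "a \<in> carrier R" "y \<in> carrier E"
    and ann: "\<And>r. \<lbrakk>r \<in> carrier R; r \<otimes>\<^bsub>R\<^esub> a \<in> I\<rbrakk> \<Longrightarrow> r \<odot>\<^bsub>E\<^esub> y = \<zero>\<^bsub>E\<^esub>"
  obtains w where "w \<in> carrier E" "a \<odot>\<^bsub>E\<^esub> w = y" "\<And>l. l \<in> I \<Longrightarrow> l \<odot>\<^bsub>E\<^esub> w = \<zero>\<^bsub>E\<^esub>"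
proof -
  interpret E: module R E by (rule baer_module[OF assms(1)])
  interpret I: ideal I R by fact
  let ?G = "{(r \<otimes>\<^bsub>R\<^esub> a \<oplus>\<^bsub>R\<^esub> l, r \<odot>\<^bsub>E\<^esub> y) | r l. r \<in> carrier R \<and> l \<in> I}"
  have mem: "(r \<otimes>\<^bsub>R\<^esub> a \<oplus>\<^bsub>R\<^esub> l, r \<odot>\<^bsub>E\<^esub> y) \<in> ?G" if "r \<in> carrier R" "l \<in> I" for r l using that by blast
  have "linear_graph R (ring_module R) E ?G"
  proof (rule linear_graphI)
    show "(\<zero>\<^bsub>ring_module R\<^esub>, \<zero>\<^bsub>E\<^esub>) \<in> ?G" using mem[of "\<zero>\<^bsub>R\<^esub>" "\<zero>\<^bsub>R\<^esub>"] assms(3,4) by simp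
  next
    fix x z x' z' assume "(x, z) \<in> ?G" "(x', z') \<in> ?G"
    then obtain r l r' l' where h: "r \<in> carrier R" "l \<in> I" "r' \<in> carrier R" "l' \<in> I"
      "x = r \<otimes>\<^bsub>R\<^esub> a \<oplus>\<^bsub>R\<^esub> l" "z = r \<odot>\<^bsub>E\<^esub> y" "x' = r' \<otimes>\<^bsub>R\<^esub> a \<oplus>\<^bsub>R\<^esub> l'" "z' = r' \<odot>\<^bsub>E\<^esub> y" by blast
    have "x \<oplus>\<^bsub>R\<^esub> x' = (r \<oplus>\<^bsub>R\<^esub> r') \<otimes>\<^bsub>R\<^esub> a \<oplus>\<^bsub>R\<^esub> (l \<oplus>\<^bsub>R\<^esub> l')"
      using h I.Icarr assms(3) by (simp add: E.R.l_distr E.R.a_ac)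
    moreover have "z \<oplus>\<^bsub>E\<^esub> z' = (r \<oplus>\<^bsub>R\<^esub> r') \<odot>\<^bsub>E\<^esub> y" using h assms(4) by (simp add: E.smult_l_distr)
    ultimately show "(x \<oplus>\<^bsub>ring_module R\<^esub> x', z \<oplus>\<^bsub>E\<^esub> z') \<in> ?G"
      using mem[of "r \<oplus>\<^bsub>R\<^esub> r'" "l \<oplus>\<^bsub>R\<^esub> l'"] h by simp
  next
    fix s x z assume s: "s \<in> carrier R" and "(x, z) \<in> ?G"
    then obtain r l where h: "r \<in> carrier R" "l \<in> I" "x = r \<otimes>\<^bsub>R\<^esub> a \<oplus>\<^bsub>R\<^esub> l" "z = r \<odot>\<^bsub>E\<^esub> y" by blast
    have "s \<otimes>\<^bsub>R\<^esub> x = (s \<otimes>\<^bsub>R\<^esub> r) \<otimes>\<^bsub>R\<^esub> a \<oplus>\<^bsub>R\<^esub> s \<otimes>\<^bsub>R\<^esub> l"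
      using h s I.Icarr assms(3) by (simp add: E.R.r_distr E.R.m_assoc)
    moreover have "s \<odot>\<^bsub>E\<^esub> z = (s \<otimes>\<^bsub>R\<^esub> r) \<odot>\<^bsub>E\<^esub> y" using h s assms(4) by (simp add: E.smult_assoc1)
    ultimately show "(s \<odot>\<^bsub>ring_module R\<^esub> x, s \<odot>\<^bsub>E\<^esub> z) \<in> ?G"
      using mem[of "s \<otimes>\<^bsub>R\<^esub> r" "s \<otimes>\<^bsub>R\<^esub> l"] h s I.I_l_closed by simp
  next
    fix z assume "(\<zero>\<^bsub>ring_module R\<^esub>, z) \<in> ?G"
    then obtain r l where h: "r \<in> carrier R" "l \<in> I" "\<zero>\<^bsub>R\<^esub> = r \<otimes>\<^bsub>R\<^esub> a \<oplus>\<^bsub>R\<^esub> l" "z = r \<odot>\<^bsub>E\<^esub> y" by auto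
    have "\<ominus>\<^bsub>R\<^esub> l = r \<otimes>\<^bsub>R\<^esub> a" by (rule E.R.minus_equality) (use h I.Icarr assms(3) in simp_all)
    then have "r \<otimes>\<^bsub>R\<^esub> a \<in> I" using h I.a_inv_closed by metis
    then show "z = \<zero>\<^bsub>E\<^esub>" using ann h by simp
  qed (use assms(3,4) I.Icarr in auto)
  from baer_graph[OF assms(1) this] obtain w where
    w: "w \<in> carrier E" "\<And>r z. (r, z) \<in> ?G \<Longrightarrow> z = r \<odot>\<^bsub>E\<^esub> w" by blast
  show thesis
  proof (rule that[OF w(1)])
    show "a \<odot>\<^bsub>E\<^esub> w = y" using w(2)[OF mem[of "\<one>\<^bsub>R\<^esub>" "\<zero>\<^bsub>R\<^esub>"]] assms(3,4) by simp
    show "l \<odot>\<^bsub>E\<^esub> w = \<zero>\<^bsub>E\<^esub>" if "l \<in> I" for l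
      using w(2)[OF mem[of "\<zero>\<^bsub>R\<^esub>" l]] that I.Icarr assms(3,4) by simp
  qed
qed

section \<open>Comparison of injective resolutions\<close>

text \<open>
  Such a complex is an injective resolution of its module of cocycles in degree \<open>0\<close>. Its cocycles in
  degree \<open>i\<close> are the \<open>i\<close>-th cosyzygy of that module.
\<close>

definition exact_baer ::
  "('r, 'x) ring_scheme \<Rightarrow> (nat \<Rightarrow> ('r, 'e) module) \<Rightarrow> (nat \<Rightarrow> 'e \<Rightarrow> 'e) \<Rightarrow> bool" where
  "exact_baer R E \<delta> \<longleftrightarrow> (\<forall>i. baer R (E i)) \<and> (\<forall>i. \<delta> i \<in> mod_hom R (E i) (E (Suc i))) \<and>
     (\<forall>i. \<delta> i ` carrier (E i) = cocycles E \<delta> (Suc i))"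

lemma exact_baerD:
  assumes "exact_baer R E \<delta>"
  shows "baer R (E i)" "module R (E i)" "\<delta> i \<in> mod_hom R (E i) (E (Suc i))"
    "\<delta> i ` carrier (E i) = cocycles E \<delta> (Suc i)"
  using assms baer_module by (auto simp: exact_baer_def)

lemma cocycles_iff: "x \<in> cocycles E \<delta> i \<longleftrightarrow> x \<in> carrier (E i) \<and> \<delta> i x = \<zero>\<^bsub>E (Suc i)\<^esub>"
  by (simp add: cocycles_def kernel_iff)

lemma submodule_cocycles: "exact_baer R E \<delta> \<Longrightarrow> submodule (cocycles E \<delta> i) R (E i)"
  unfolding cocycles_def by (intro submodule_kernel exact_baerD)

lemma injective_resolution_iff:
  "injective_resolution R M \<epsilon> E \<delta> \<longleftrightarrow> exact_baer R E \<delta> \<and> \<epsilon> \<in> mod_hom R M (E 0) \<and>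
     inj_on \<epsilon> (carrier M) \<and> \<epsilon> ` carrier M = cocycles E \<delta> 0"
  by (auto simp: injective_resolution_def exact_baer_def cocycles_def injective_module_iff_baer)

lemma baer_cocycles_Suc:
  assumes "exact_baer R E \<delta>" "baer R (sub (E i) (cocycles E \<delta> i))"
  shows "baer R (sub (E (Suc i)) (cocycles E \<delta> (Suc i)))"
  using baer_image[OF exact_baerD(1,2,3)[OF assms(1)], of i] assms(2) exact_baerD(4)[OF assms(1), of i]
  by (simp add: cocycles_def)

lemma baer_cocycles_mono:
  assumes "exact_baer R E \<delta>" "baer R (sub (E i) (cocycles E \<delta> i))" "i \<le> j"
  shows "baer R (sub (E j) (cocycles E \<delta> j))"
  using assms(3,2) by (induction rule: dec_induct) (auto intro: baer_cocycles_Suc[OF assms(1)])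

lemma cocycle_lift:
  assumes "exact_baer R E \<delta>" "baer R (sub (E i) (cocycles E \<delta> i))" "y \<in> cocycles E \<delta> (Suc i)"
  obtains e where "e \<in> carrier (E i)" "\<delta> i e = y"
    "\<And>r. r \<in> carrier R \<Longrightarrow> r \<odot>\<^bsub>E (Suc i)\<^esub> y = \<zero>\<^bsub>E (Suc i)\<^esub> \<Longrightarrow> r \<odot>\<^bsub>E i\<^esub> e = \<zero>\<^bsub>E i\<^esub>"
  using annihilator_preserving_lift[OF exact_baerD(2,2,3)[OF assms(1)], of i y] assms(2,3)
    exact_baerD(4)[OF assms(1), of i] unfolding cocycles_def by blast

text \<open>
  The usual lifting of a map of modules to injective resolutions, degree by degree. The squares
  anticommute because the differential of the mapping cone then needs no further signs.
\<close>

lemma anti_chain_map: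
  assumes E: "exact_baer R E \<delta>" and G: "exact_baer R G \<gamma>"
    and \<theta>: "\<theta> \<in> mod_hom R (sub (E 0) (cocycles E \<delta> 0)) (G 0)" "\<theta> ` cocycles E \<delta> 0 \<subseteq> cocycles G \<gamma> 0"
  obtains f where "\<And>i. f i \<in> mod_hom R (E i) (G i)" "\<And>x. x \<in> cocycles E \<delta> 0 \<Longrightarrow> f 0 x = \<theta> x"
    "\<And>i x. x \<in> carrier (E i) \<Longrightarrow> f (Suc i) (\<delta> i x) = \<ominus>\<^bsub>G (Suc i)\<^esub> \<gamma> i (f i x)"
proof -
  note e = exact_baerD[OF E] and g = exact_baerD[OF G]
  let ?P = "\<lambda>i f. f \<in> mod_hom R (E i) (G i) \<and> f ` cocycles E \<delta> i \<subseteq> cocycles G \<gamma> i \<and>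
     (i = 0 \<longrightarrow> (\<forall>x\<in>cocycles E \<delta> 0. f x = \<theta> x))"
  let ?Q = "\<lambda>i f f'. \<forall>x\<in>carrier (E i). f' (\<delta> i x) = \<ominus>\<^bsub>G (Suc i)\<^esub> \<gamma> i (f x)"
  have "\<exists>f. \<forall>n. ?P n (f n) \<and> ?Q n (f n) (f (Suc n))"
  proof (rule dependent_nat_choice)
    obtain f where "f \<in> mod_hom R (E 0) (G 0)" "\<And>x. x \<in> cocycles E \<delta> 0 \<Longrightarrow> f x = \<theta> x"
      using baer_extend_sub[OF e(2) g(1) submodule_cocycles[OF E] \<theta>(1)] by blast
    with \<theta>(2) show "\<exists>f. ?P 0 f" by (intro exI[of _ f]) auto
  next
    fix f n assume P: "?P n f"
    then have f: "f \<in> mod_hom R (E n) (G n)" "\<And>x. x \<in> cocycles E \<delta> n \<Longrightarrow> f x \<in> cocycles G \<gamma> n" by auto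
    interpret G1: module R "G (Suc n)" by (rule g(2))
    let ?Y = "sub (E (Suc n)) (\<delta> n ` carrier (E n))"
    have sY: "submodule (\<delta> n ` carrier (E n)) R (E (Suc n))" using submodule_cocycles[OF E] e(4) by simp
    have h: "(\<lambda>x. \<ominus>\<^bsub>G (Suc n)\<^esub> \<gamma> n (f x)) \<in> mod_hom R (E n) (G (Suc n))"
      by (intro hom_neg hom_comp[OF f(1)] g)
    have "\<gamma> n (f x) = \<zero>\<^bsub>G (Suc n)\<^esub>" if "x \<in> carrier (E n)" "\<delta> n x = \<zero>\<^bsub>E (Suc n)\<^esub>" for x
      using f(2)[of x] that by (simp add: cocycles_iff)
    then obtain \<phi> where \<phi>: "\<phi> \<in> mod_hom R ?Y (G (Suc n))"
      "\<And>x. x \<in> carrier (E n) \<Longrightarrow> \<phi> (\<delta> n x) = \<ominus>\<^bsub>G (Suc n)\<^esub> \<gamma> n (f x)"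
      using hom_factor[OF e(2) submodule_module[OF e(2) sY] g(2) hom_corestrict[OF e(3)] _ h] by auto
    obtain f' where f': "f' \<in> mod_hom R (E (Suc n)) (G (Suc n))"
      "\<And>x. x \<in> \<delta> n ` carrier (E n) \<Longrightarrow> f' x = \<phi> x"
      using baer_extend_sub[OF e(2) g(1) sY \<phi>(1)] by blast
    have Q: "?Q n f f'" using f'(2) \<phi>(2) by simp
    have "f' (\<delta> n x) \<in> cocycles G \<gamma> (Suc n)" if "x \<in> carrier (E n)" for x
    proof -
      have "\<gamma> n (f x) \<in> cocycles G \<gamma> (Suc n)" using hom_closed[OF f(1) that] g(4)[of n] by blast
      then show ?thesis
        using Q that G1.submoduleE(3)[OF submodule_cocycles[OF G]] by simp
    qed
    then have "f' ` cocycles E \<delta> (Suc n) \<subseteq> cocycles G \<gamma> (Suc n)" using e(4)[of n] by force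
    with f'(1) Q show "\<exists>f'. ?P (Suc n) f' \<and> ?Q n f f'" by blast
  qed
  then obtain f where f: "\<forall>n. ?P n (f n) \<and> ?Q n (f n) (f (Suc n))" by blast
  show thesis by (rule that[of f]) (use f in auto)
qed

text \<open>
  The mapping cone of a map of complexes from \<open>E\<close> to \<open>G\<close>, with \<open>G (i - 1) \<oplus> E i\<close> in degree \<open>i\<close>. In degree
  \<open>0\<close> the first summand is the zero submodule of \<open>G 0\<close>, so that all degrees have the same type.
\<close>

definition cone_module :: "(nat \<Rightarrow> ('r, 'g) module) \<Rightarrow> (nat \<Rightarrow> ('r, 'e) module) \<Rightarrow> nat \<Rightarrow> ('r, 'g \<times> 'e) module" where
  "cone_module G E i = (case i of 0 \<Rightarrow> prod_module (sub (G 0) {\<zero>\<^bsub>G 0\<^esub>}) (E 0)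
     | Suc j \<Rightarrow> prod_module (G j) (E (Suc j)))"

definition cone_map ::
  "(nat \<Rightarrow> ('r, 'g) module) \<Rightarrow> (nat \<Rightarrow> 'g \<Rightarrow> 'g) \<Rightarrow> (nat \<Rightarrow> 'e \<Rightarrow> 'e) \<Rightarrow> (nat \<Rightarrow> 'e \<Rightarrow> 'g) \<Rightarrow>
     nat \<Rightarrow> 'g \<times> 'e \<Rightarrow> 'g \<times> 'e" where
  "cone_map G \<gamma> \<delta> f i x = ((case i of 0 \<Rightarrow> f 0 (snd x)
     | Suc j \<Rightarrow> \<gamma> j (fst x) \<oplus>\<^bsub>G (Suc j)\<^esub> f (Suc j) (snd x)), \<delta> i (snd x))"

text \<open>
  The map is an isomorphism on the resolved modules, that is, on cocycles of degree \<open>0\<close>. Therefore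
  its cone is exact in all degrees, including degree \<open>0\<close>, where it starts.
\<close>

lemma cone_exact:
  assumes E: "exact_baer R E \<delta>" and G: "exact_baer R G \<gamma>"
    and f: "\<And>i. f i \<in> mod_hom R (E i) (G i)"
    and anti: "\<And>i x. x \<in> carrier (E i) \<Longrightarrow> f (Suc i) (\<delta> i x) = \<ominus>\<^bsub>G (Suc i)\<^esub> \<gamma> i (f i x)"
    and inj: "inj_on (f 0) (cocycles E \<delta> 0)" and surj: "f 0 ` cocycles E \<delta> 0 = cocycles G \<gamma> 0"
  shows "exact_baer R (cone_module G E) (cone_map G \<gamma> \<delta> f)"
    "cocycles (cone_module G E) (cone_map G \<gamma> \<delta> f) 0 = {\<zero>\<^bsub>cone_module G E 0\<^esub>}"
proof -
  note e = exact_baerD[OF E] and g = exact_baerD[OF G]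
  let ?K = "cone_module G E" and ?d = "cone_map G \<gamma> \<delta> f"
  have K0: "?K 0 = prod_module (sub (G 0) {\<zero>\<^bsub>G 0\<^esub>}) (E 0)"
    and KS: "?K (Suc j) = prod_module (G j) (E (Suc j))" for j
    by (simp_all add: cone_module_def)
  have d0: "?d 0 x = (f 0 (snd x), \<delta> 0 (snd x))"
    and dS: "?d (Suc j) x = (\<gamma> j (fst x) \<oplus>\<^bsub>G (Suc j)\<^esub> f (Suc j) (snd x), \<delta> (Suc j) (snd x))" for j x
    by (simp_all add: cone_map_def)
  have mG0: "module R (sub (G 0) {\<zero>\<^bsub>G 0\<^esub>})"
    by (rule submodule_module[OF g(2) submodule_singleton_zero[OF g(2)]])
  have f0: "f i \<zero>\<^bsub>E i\<^esub> = \<zero>\<^bsub>G i\<^esub>" for i by (rule hom_zero[OF e(2) g(2) f])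
  have \<delta>0: "\<delta> i \<zero>\<^bsub>E i\<^esub> = \<zero>\<^bsub>E (Suc i)\<^esub>" for i by (rule hom_zero[OF e(2) e(2) e(3)])
  have \<gamma>0: "\<gamma> i \<zero>\<^bsub>G i\<^esub> = \<zero>\<^bsub>G (Suc i)\<^esub>" for i by (rule hom_zero[OF g(2) g(2) g(3)])
  have \<delta>\<delta>: "\<delta> (Suc i) (\<delta> i x) = \<zero>\<^bsub>E (Suc (Suc i))\<^esub>" if "x \<in> carrier (E i)" for i x
    using e(4)[of i] that by (auto simp: cocycles_iff)
  have \<gamma>\<gamma>: "\<gamma> (Suc i) (\<gamma> i x) = \<zero>\<^bsub>G (Suc (Suc i))\<^esub>" if "x \<in> carrier (G i)" for i x
    using g(4)[of i] that by (auto simp: cocycles_iff)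
  note fc = hom_closed[OF f] and \<delta>c = hom_closed[OF e(3)] and \<gamma>c = hom_closed[OF g(3)]
  have baer: "baer R (?K i)" for i
    by (cases i) (simp_all add: K0 KS baer_prod e(1) g(1) baer_zero[OF mG0])
  have hom: "?d i \<in> mod_hom R (?K i) (?K (Suc i))" for i
  proof (cases i)
    case 0
    show ?thesis unfolding 0 K0 KS
      by (rule mod_homI)
         (auto simp: d0 fc \<delta>c hom_add[OF f] hom_add[OF e(3)] hom_smult[OF f] hom_smult[OF e(3)])
  next
    case (Suc j)
    interpret GS: module R "G (Suc j)" by (rule g(2))
    show ?thesis unfolding Suc KS
      by (rule mod_homI)
         (auto simp: dS fc \<delta>c \<gamma>c hom_add[OF f] hom_add[OF e(3)] hom_add[OF g(3)] hom_smult[OF f]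
           hom_smult[OF e(3)] hom_smult[OF g(3)] GS.M.a_ac GS.smult_r_distr)
  qed
  show "cocycles ?K ?d 0 = {\<zero>\<^bsub>?K 0\<^esub>}"
  proof -
    have "x = \<zero>\<^bsub>E 0\<^esub>" if "x \<in> carrier (E 0)" "f 0 x = \<zero>\<^bsub>G 0\<^esub>" "\<delta> 0 x = \<zero>\<^bsub>E (Suc 0)\<^esub>" for x
      using inj_onD[OF inj, of x "\<zero>\<^bsub>E 0\<^esub>"] that f0 submodule_zero[OF submodule_cocycles[OF E]]
      by (simp add: cocycles_iff)
    moreover interpret E0: module R "E 0" by (rule e(2))
    show ?thesis using calculation by (auto simp: cocycles_iff K0 KS d0 f0 \<delta>0)
  qed
  have ex: "?d i ` carrier (?K i) = cocycles ?K ?d (Suc i)" for i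
  proof
    interpret G1: module R "G (Suc i)" by (rule g(2))
    show "?d i ` carrier (?K i) \<subseteq> cocycles ?K ?d (Suc i)"
    proof
      fix y assume "y \<in> ?d i ` carrier (?K i)"
      then obtain x where x: "x \<in> carrier (?K i)" "y = ?d i x" by blast
      have "?d (Suc i) (?d i x) = \<zero>\<^bsub>?K (Suc (Suc i))\<^esub>"
      proof (cases i)
        case 0
        interpret G1': module R "G (Suc 0)" by (rule g(2))
        show ?thesis using x(1) by (auto simp: 0 K0 KS d0 dS anti \<delta>\<delta> \<gamma>c fc G1'.M.r_neg)
      next
        case (Suc j)
        interpret G2: module R "G (Suc (Suc j))" by (rule g(2))
        have "snd x \<in> carrier (E (Suc j))" "fst x \<in> carrier (G j)" using x(1) by (auto simp: Suc KS)
        then show ?thesis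
          by (simp add: Suc KS dS anti \<delta>\<delta> hom_add[OF g(3)] \<gamma>\<gamma> \<gamma>c fc G2.M.r_neg)
      qed
      with x hom_closed[OF hom] show "y \<in> cocycles ?K ?d (Suc i)" by (simp add: cocycles_iff)
    qed
    show "cocycles ?K ?d (Suc i) \<subseteq> ?d i ` carrier (?K i)"
    proof
      fix y assume "y \<in> cocycles ?K ?d (Suc i)"
      then obtain v u where y: "y = (v, u)" "v \<in> carrier (G i)" "u \<in> carrier (E (Suc i))"
        "\<gamma> i v \<oplus>\<^bsub>G (Suc i)\<^esub> f (Suc i) u = \<zero>\<^bsub>G (Suc i)\<^esub>" "\<delta> (Suc i) u = \<zero>\<^bsub>E (Suc (Suc i))\<^esub>"
        by (auto simp: cocycles_iff KS dS)
      interpret Gi: module R "G i" by (rule g(2))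
      interpret Ei: module R "E i" by (rule e(2))
      have "u \<in> cocycles E \<delta> (Suc i)" using y by (simp add: cocycles_iff)
      then obtain w where w: "w \<in> carrier (E i)" "u = \<delta> i w" using e(4)[of i] by blast
      have "\<gamma> i (v \<ominus>\<^bsub>G i\<^esub> f i w) = \<zero>\<^bsub>G (Suc i)\<^esub>"
        using y(2,4) w by (simp add: hom_diff[OF g(2) g(2) g(3)] fc anti G1.M.minus_eq)
      then have vw: "v \<ominus>\<^bsub>G i\<^esub> f i w \<in> cocycles G \<gamma> i" using y(2) w fc by (simp add: cocycles_iff)
      show "y \<in> ?d i ` carrier (?K i)"
      proof (cases i)
        case 0
        with vw surj obtain z where z: "z \<in> cocycles E \<delta> 0" "v \<ominus>\<^bsub>G 0\<^esub> f 0 w = f 0 z" by auto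
        have zc: "z \<in> carrier (E 0)" "\<delta> 0 z = \<zero>\<^bsub>E (Suc 0)\<^esub>" using z(1) by (auto simp: cocycles_iff)
        interpret G0: module R "G 0" by (rule g(2))
        interpret E0: module R "E 0" by (rule e(2))
        interpret E1: module R "E (Suc 0)" by (rule e(2))
        have "f 0 (w \<oplus>\<^bsub>E 0\<^esub> z) = v" using w(1) zc y(2) fc 0 by (simp add: hom_add[OF f] flip: z(2))
        moreover have "\<delta> 0 (w \<oplus>\<^bsub>E 0\<^esub> z) = u" using w zc 0 \<delta>c by (simp add: hom_add[OF e(3)])
        ultimately have "y = ?d 0 (\<zero>\<^bsub>G 0\<^esub>, w \<oplus>\<^bsub>E 0\<^esub> z)" by (simp add: y(1) d0)
        then show ?thesis unfolding 0 using w(1) zc 0 by (intro image_eqI) (auto simp: K0)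
      next
        case (Suc j)
        have "v \<ominus>\<^bsub>G i\<^esub> f i w \<in> \<gamma> j ` carrier (G j)" using vw g(4)[of j] Suc by simp
        then obtain v' where v': "v' \<in> carrier (G j)" "\<gamma> j v' = v \<ominus>\<^bsub>G i\<^esub> f i w" by (metis imageE)
        have "\<gamma> j v' \<oplus>\<^bsub>G i\<^esub> f i w = v" unfolding v'(2) using y(2) w(1) fc[of w i]
          by (subst Gi.M.a_comm) auto
        then have "y = ?d (Suc j) (v', w)" using w Suc by (simp add: y(1) dS)
        then show ?thesis using w v' by (simp add: Suc KS)
      qed
    qed
  qed
  show "exact_baer R ?K ?d" unfolding exact_baer_def using baer hom ex by blast
qed

text \<open>
  The cone is an exact complex of injective modules that starts in degree \<open>0\<close>, so all its cocycle
  modules are injective and its cocycles can be lifted without enlarging their annihilators. A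
  cocycle \<open>y\<close> of \<open>E\<close> in degree \<open>d + 1\<close> gives the cocycle \<open>(0, y)\<close> of the cone, because \<open>G\<close> vanishes there.
  A lift of \<open>(0, y)\<close> contains a lift of \<open>y\<close>, and \<open>baer_kernelI\<close> applies.
\<close>

theorem baer_cocycles_compare:
  assumes E: "exact_baer R E \<delta>" and G: "exact_baer R G \<gamma>"
    and \<theta>: "\<theta> \<in> mod_hom R (sub (E 0) (cocycles E \<delta> 0)) (G 0)"
    "inj_on \<theta> (cocycles E \<delta> 0)" "\<theta> ` cocycles E \<delta> 0 = cocycles G \<gamma> 0"
    and zero: "\<And>i. i > d \<Longrightarrow> carrier (G i) = {\<zero>\<^bsub>G i\<^esub>}"
  shows "baer R (sub (E d) (cocycles E \<delta> d))"
proof -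
  note e = exact_baerD[OF E] and g = exact_baerD[OF G]
  obtain f where f: "\<And>i. f i \<in> mod_hom R (E i) (G i)" "\<And>x. x \<in> cocycles E \<delta> 0 \<Longrightarrow> f 0 x = \<theta> x"
    "\<And>i x. x \<in> carrier (E i) \<Longrightarrow> f (Suc i) (\<delta> i x) = \<ominus>\<^bsub>G (Suc i)\<^esub> \<gamma> i (f i x)"
    using anti_chain_map[OF E G \<theta>(1)] \<theta>(3) by blast
  have "inj_on (f 0) (cocycles E \<delta> 0)" using \<theta>(2) f(2) inj_on_cong by blast
  moreover have "f 0 ` cocycles E \<delta> 0 = cocycles G \<gamma> 0" using f(2) \<theta>(3) by (metis image_cong)
  ultimately have K: "exact_baer R (cone_module G E) (cone_map G \<gamma> \<delta> f)"
    "cocycles (cone_module G E) (cone_map G \<gamma> \<delta> f) 0 = {\<zero>\<^bsub>cone_module G E 0\<^esub>}"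
    using cone_exact[OF E G, of f] f(1,3) by blast+
  let ?K = "cone_module G E" and ?d = "cone_map G \<gamma> \<delta> f"
  have "baer R (sub (?K 0) (cocycles ?K ?d 0))"
    by (rule baer_zero[OF submodule_module[OF exact_baerD(2)[OF K(1)] submodule_cocycles[OF K(1)]]])
       (simp add: K(2))
  from baer_cocycles_mono[OF K(1) this] have bK: "baer R (sub (?K d) (cocycles ?K ?d d))" by simp
  show ?thesis unfolding cocycles_def
  proof (rule baer_kernelI[OF e(1,2,3)])
    fix y J assume J: "ideal J R" and y: "y \<in> \<delta> d ` carrier (E d)"
      and ann: "\<And>r. r \<in> J \<Longrightarrow> r \<odot>\<^bsub>E (Suc d)\<^esub> y = \<zero>\<^bsub>E (Suc d)\<^esub>"
    interpret Gd: module R "G d" by (rule g(2))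
    have yc: "y \<in> carrier (E (Suc d))" "\<delta> (Suc d) y = \<zero>\<^bsub>E (Suc (Suc d))\<^esub>"
      using y e(4)[of d] by (auto simp: cocycles_iff)
    have "f (Suc d) y = \<zero>\<^bsub>G (Suc d)\<^esub>" using hom_closed[OF f(1) yc(1)] zero[of "Suc d"] by auto
    moreover interpret G1: module R "G (Suc d)" by (rule g(2))
    have "\<gamma> d \<zero>\<^bsub>G d\<^esub> = \<zero>\<^bsub>G (Suc d)\<^esub>" by (rule hom_zero[OF g(2) g(2) g(3)])
    ultimately have c: "(\<zero>\<^bsub>G d\<^esub>, y) \<in> cocycles ?K ?d (Suc d)"
      using yc by (simp add: cocycles_iff cone_module_def cone_map_def)
    obtain x where x: "x \<in> carrier (?K d)" "?d d x = (\<zero>\<^bsub>G d\<^esub>, y)"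
      "\<And>r. r \<in> carrier R \<Longrightarrow> r \<odot>\<^bsub>?K (Suc d)\<^esub> (\<zero>\<^bsub>G d\<^esub>, y) = \<zero>\<^bsub>?K (Suc d)\<^esub> \<Longrightarrow> r \<odot>\<^bsub>?K d\<^esub> x = \<zero>\<^bsub>?K d\<^esub>"
      using cocycle_lift[OF K(1) bK c] by blast
    have "snd x \<in> carrier (E d)" using x(1) by (cases d) (auto simp: cone_module_def)
    moreover have "\<delta> d (snd x) = y" using x(2) by (simp add: cone_map_def)
    moreover have "r \<odot>\<^bsub>E d\<^esub> snd x = \<zero>\<^bsub>E d\<^esub>" if "r \<in> J" for r
      using x(3)[of r] ann[OF that] ideal.Icarr[OF J that] Gd.smult_r_null[of r] by (cases d) (auto simp: cone_module_def)
    ultimately show "\<exists>e\<in>carrier (E d). \<delta> d e = y \<and> (\<forall>r\<in>J. r \<odot>\<^bsub>E d\<^esub> e = \<zero>\<^bsub>E d\<^esub>)" by blast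
  qed
qed

section \<open>Injective dimension and cosyzygies\<close>

lemma hom_inv_into:
  assumes "module R X" "\<epsilon> \<in> mod_hom R X N" "inj_on \<epsilon> (carrier X)"
  shows "inv_into (carrier X) \<epsilon> \<in> mod_hom R (sub N (\<epsilon> ` carrier X)) X"
proof (rule mod_homI)
  interpret X: module R X by fact
  let ?k = "inv_into (carrier X) \<epsilon>"
  have k: "?k (\<epsilon> x) = x" if "x \<in> carrier X" for x using assms(3) that by simp
  show "?k x \<in> carrier X" if "x \<in> carrier (sub N (\<epsilon> ` carrier X))" for x
    using that k by auto
  show "?k (x \<oplus>\<^bsub>sub N (\<epsilon> ` carrier X)\<^esub> y) = ?k x \<oplus>\<^bsub>X\<^esub> ?k y"
    if "x \<in> carrier (sub N (\<epsilon> ` carrier X))" "y \<in> carrier (sub N (\<epsilon> ` carrier X))" for x y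
  proof -
    from that obtain a b where "a \<in> carrier X" "x = \<epsilon> a" "b \<in> carrier X" "y = \<epsilon> b" by auto
    then show ?thesis using k[of "a \<oplus>\<^bsub>X\<^esub> b"] by (simp add: k hom_add[OF assms(2)])
  qed
  show "?k (r \<odot>\<^bsub>sub N (\<epsilon> ` carrier X)\<^esub> x) = r \<odot>\<^bsub>X\<^esub> ?k x"
    if "r \<in> carrier R" "x \<in> carrier (sub N (\<epsilon> ` carrier X))" for r x
  proof -
    from that obtain a where "a \<in> carrier X" "x = \<epsilon> a" by auto
    then show ?thesis using k[of "r \<odot>\<^bsub>X\<^esub> a"] that(1) by (simp add: k hom_smult[OF assms(2)])
  qed
qed

lemma exact_baer_copy:
  assumes "exact_baer R E \<delta>" "inj h"
  defines "E' \<equiv> \<lambda>i. copy_module h (E i)"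
    and "\<delta>' \<equiv> \<lambda>i x. h (\<delta> i (inv_into (carrier (E i)) h x))"
  shows "exact_baer R E' \<delta>'" "cocycles E' \<delta>' i = h ` cocycles E \<delta> i"
proof -
  note e = exact_baerD[OF assms(1)]
  have hi: "inj_on h A" for A using assms(2) inj_on_subset by blast
  note c = copy_module[OF e(2) hi]
  have k: "inv_into (carrier (E i)) h (h x) = x" if "x \<in> carrier (E i)" for i x
    using inv_into_f_f[OF hi that] .
  have \<delta>': "\<delta>' i (h x) = h (\<delta> i x)" if "x \<in> carrier (E i)" for i x using k[OF that] by (simp add: \<delta>'_def)
  have heq: "h x = h y \<longleftrightarrow> x = y" for x y using assms(2) by (simp add: inj_eq)
  show coc: "cocycles E' \<delta>' i = h ` cocycles E \<delta> i" for i
    by (auto simp: cocycles_iff E'_def c(4,5) heq \<delta>'[unfolded E'_def] intro!: imageI)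
  have "\<delta>' i ` carrier (E' i) = cocycles E' \<delta>' (Suc i)" for i
  proof -
    have "\<delta>' i ` carrier (E' i) = (\<lambda>x. \<delta>' i (h x)) ` carrier (E i)"
      by (simp add: E'_def c(4) image_image)
    also have "\<dots> = (\<lambda>x. h (\<delta> i x)) ` carrier (E i)" using \<delta>' by (rule image_cong[OF refl])
    also have "\<dots> = h ` \<delta> i ` carrier (E i)" by (simp add: image_image)
    also have "\<dots> = cocycles E' \<delta>' (Suc i)" by (simp only: coc e(4))
    finally show ?thesis .
  qed
  moreover have "\<delta>' i \<in> mod_hom R (E' i) (E' (Suc i))" for i
    unfolding \<delta>'_def E'_def by (intro hom_comp[OF hom_comp[OF c(3) e(3)] c(2)])
  moreover have "baer R (E' i)" for i
    unfolding E'_def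
    by (rule baer_retract[OF e(1) c(1) c(2) c(3)]) (auto simp: c(4) k)
  ultimately show "exact_baer R E' \<delta>'" unfolding exact_baer_def by blast
qed

lemma exact_baer_truncate:
  assumes "exact_baer R E \<delta>" "baer R (sub (E d) (cocycles E \<delta> d))"
  defines "E' \<equiv> \<lambda>i. sub (E i) (if i < d then carrier (E i) else if i = d then cocycles E \<delta> d else {\<zero>\<^bsub>E i\<^esub>})"
  shows "exact_baer R E' \<delta>" "cocycles E' \<delta> 0 = cocycles E \<delta> 0"
proof -
  note e = exact_baerD[OF assms(1)]
  have \<delta>0: "\<delta> i \<zero>\<^bsub>E i\<^esub> = \<zero>\<^bsub>E (Suc i)\<^esub>" for i by (rule hom_zero[OF e(2) e(2) e(3)])
  have zc: "\<zero>\<^bsub>E i\<^esub> \<in> cocycles E \<delta> i" for i by (rule submodule_zero[OF submodule_cocycles[OF assms(1)]])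
  have c: "cocycles E' \<delta> i = (if i \<le> d then cocycles E \<delta> i else {\<zero>\<^bsub>E i\<^esub>})" for i
    using zc[of i] by (auto simp: cocycles_iff E'_def \<delta>0 split: if_splits)
  then show "cocycles E' \<delta> 0 = cocycles E \<delta> 0" by simp
  have im: "\<delta> i ` carrier (E' i) = cocycles E' \<delta> (Suc i)" for i
  proof (cases "i < d")
    case True
    then show ?thesis unfolding c by (simp add: E'_def e(4))
  next
    case False
    have "carrier (E' i) \<subseteq> cocycles E \<delta> i" "\<zero>\<^bsub>E i\<^esub> \<in> carrier (E' i)"
      using False zc[of i] by (auto simp: E'_def)
    then have "\<delta> i ` carrier (E' i) = {\<zero>\<^bsub>E (Suc i)\<^esub>}"
      using \<delta>0[of i] by (force simp: cocycles_iff)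
    with False show ?thesis unfolding c by simp
  qed
  have sm: "submodule (carrier (E' i)) R (E i)" for i
    unfolding E'_def
    using submodule_carrier[OF e(2)] submodule_singleton_zero[OF e(2)] submodule_cocycles[OF assms(1)]
    by simp
  have "\<delta> i \<in> mod_hom R (E' i) (E' (Suc i))" for i
  proof -
    have "\<delta> i ` carrier (E' i) \<subseteq> carrier (E' (Suc i))" unfolding im by (auto simp: cocycles_iff)
    moreover have "\<delta> i \<in> mod_hom R (sub (E i) (carrier (E' i))) (E (Suc i))"
      using hom_restrict[OF e(3)] submodule_mem[OF sm] by blast
    ultimately have "\<delta> i \<in> mod_hom R (sub (E i) (carrier (E' i))) (sub (E (Suc i)) (carrier (E' (Suc i))))"
      by (intro hom_corestrict) auto
    then show ?thesis by (simp add: E'_def)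
  qed
  moreover have "baer R (E' i)" for i
  proof -
    have "baer R (sub (E i) {\<zero>\<^bsub>E i\<^esub>})"
      by (rule baer_zero[OF submodule_module[OF e(2) submodule_singleton_zero[OF e(2)]]]) simp
    then show ?thesis using e(1)[of i] assms(2) by (auto simp: E'_def)
  qed
  ultimately show "exact_baer R E' \<delta>" unfolding exact_baer_def using im by blast
qed

text \<open>
  If the \<open>d\<close>-th cosyzygy is injective, the resolution may be cut off there. The injection \<open>h\<close> carries
  the result into the universe that the definition of injective dimension asks for.
\<close>

lemma injdim_leI:
  fixes X :: "('r, 'a) module" and E :: "nat \<Rightarrow> ('r, 'e) module" and h :: "'e \<Rightarrow> ('r, 'a) universe"
  assumes "exact_baer R E \<delta>" "\<epsilon> \<in> mod_hom R X (E 0)" "inj_on \<epsilon> (carrier X)"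
    "\<epsilon> ` carrier X = cocycles E \<delta> 0" "inj h" "baer R (sub (E d) (cocycles E \<delta> d))"
  shows "injdim R X \<le> ereal (real d)"
proof (cases "zero_module X")
  case True
  then show ?thesis by (simp add: injdim_def)
next
  case False
  define E1 where "E1 = (\<lambda>i. sub (E i) (if i < d then carrier (E i) else if i = d then cocycles E \<delta> d else {\<zero>\<^bsub>E i\<^esub>}))"
  have E1: "exact_baer R E1 \<delta>" "cocycles E1 \<delta> 0 = cocycles E \<delta> 0"
    unfolding E1_def by (rule exact_baer_truncate[OF assms(1,6)])+
  let ?E2 = "\<lambda>i. copy_module h (E1 i)" and ?\<delta>2 = "\<lambda>i x. h (\<delta> i (inv_into (carrier (E1 i)) h x))"
  note E2 = exact_baer_copy[OF E1(1) assms(5)]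
  have hi: "inj_on h A" for A using assms(5) inj_on_subset by blast
  note c = copy_module[OF exact_baerD(2)[OF E1(1)] hi]
  have "\<epsilon> ` carrier X \<subseteq> carrier (E1 0)" using E1(2) assms(4) by (auto simp: cocycles_iff)
  then have "\<epsilon> \<in> mod_hom R X (E1 0)" using hom_corestrict[OF assms(2)] by (simp add: E1_def)
  then have "(\<lambda>x. h (\<epsilon> x)) \<in> mod_hom R X (?E2 0)" by (rule hom_comp[OF _ c(2)])
  moreover have "inj_on (\<lambda>x. h (\<epsilon> x)) (carrier X)"
    using comp_inj_on[OF assms(3) hi] by (simp add: o_def)
  moreover have "(\<lambda>x. h (\<epsilon> x)) ` carrier X = cocycles ?E2 ?\<delta>2 0"
    by (simp only: E2(2) E1(2) assms(4)[symmetric] image_image)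
  ultimately have "injective_resolution R X (\<lambda>x. h (\<epsilon> x)) ?E2 ?\<delta>2"
    unfolding injective_resolution_iff using E2(1) by blast
  moreover have "\<forall>i>d. zero_module (?E2 i)" unfolding c(4,5) by (simp add: E1_def)
  ultimately have "Inf {ereal (real d) | d. \<exists>\<epsilon> (E :: nat \<Rightarrow> ('r, ('r, 'a) universe) module) \<delta>.
      injective_resolution R X \<epsilon> E \<delta> \<and> (\<forall>i>d. zero_module (E i))} \<le> ereal (real d)"
    by (intro Inf_lower) blast
  then show ?thesis using False by (simp only: injdim_def if_False)
qed

text \<open>
  The resolution of length at most \<open>d\<close> lives in the universe, whereas \<open>E\<close> may be any resolution in any
  type: the comparison theorem transfers the bound to the cosyzygies of \<open>E\<close>.
\<close>

lemma injdim_leD: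
  fixes X :: "('r, 'a) module" and E :: "nat \<Rightarrow> ('r, 'e) module"
  assumes "module R X" "exact_baer R E \<delta>" "\<epsilon> \<in> mod_hom R X (E 0)" "inj_on \<epsilon> (carrier X)"
    "\<epsilon> ` carrier X = cocycles E \<delta> 0" and le: "injdim R X \<le> ereal (real d)"
  shows "baer R (sub (E d) (cocycles E \<delta> d))"
proof (cases "zero_module X")
  case True
  note e = exact_baerD[OF assms(2)]
  have "cocycles E \<delta> 0 = {\<zero>\<^bsub>E 0\<^esub>}"
    using assms(5) True hom_zero[OF assms(1) e(2) assms(3)] by simp
  then have "baer R (sub (E 0) (cocycles E \<delta> 0))"
    by (intro baer_zero submodule_module[OF e(2)] submodule_cocycles[OF assms(2)]) simp
  from baer_cocycles_mono[OF assms(2) this] show ?thesis by simp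
next
  case False
  let ?P = "\<lambda>d'. \<exists>\<epsilon> (G :: nat \<Rightarrow> ('r, ('r, 'a) universe) module) \<gamma>.
               injective_resolution R X \<epsilon> G \<gamma> \<and> (\<forall>i>d'. zero_module (G i))"
  have "\<exists>d'\<le>d. ?P d'"
  proof (rule ccontr)
    assume neg: "\<not> (\<exists>d'\<le>d. ?P d')"
    have "ereal (real (Suc d)) \<le> Inf {ereal (real d') | d'. ?P d'}"
    proof (rule Inf_greatest)
      fix x assume "x \<in> {ereal (real d') | d'. ?P d'}"
      then obtain d' where "x = ereal (real d')" "?P d'" by blast
      moreover from this neg have "Suc d \<le> d'" by (metis not_less_eq_eq)
      ultimately show "ereal (real (Suc d)) \<le> x" by simp
    qed
    also have "\<dots> = injdim R X" using False by (simp add: injdim_def)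
    also note le
    finally show False by simp
  qed
  then obtain d' \<eta> and G :: "nat \<Rightarrow> ('r, ('r, 'a) universe) module" and \<gamma> where d': "d' \<le> d"
    "injective_resolution R X \<eta> G \<gamma>" "\<forall>i>d'. zero_module (G i)" by blast
  then have G: "exact_baer R G \<gamma>" "\<eta> \<in> mod_hom R X (G 0)" "inj_on \<eta> (carrier X)"
    "\<eta> ` carrier X = cocycles G \<gamma> 0" by (auto simp: injective_resolution_iff)
  let ?k = "inv_into (carrier X) \<epsilon>"
  have k: "?k ` cocycles E \<delta> 0 = carrier X"
    unfolding assms(5)[symmetric] using assms(4) by force
  have ki: "inj_on ?k (cocycles E \<delta> 0)" unfolding assms(5)[symmetric] by (rule inj_on_inv_into) simp
  have "baer R (sub (E d') (cocycles E \<delta> d'))"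
  proof (rule baer_cocycles_compare[OF assms(2) G(1)])
    show "(\<lambda>x. \<eta> (?k x)) \<in> mod_hom R (sub (E 0) (cocycles E \<delta> 0)) (G 0)"
      using hom_comp[OF hom_inv_into[OF assms(1,3,4)] G(2)] by (simp add: assms(5))
    show "inj_on (\<lambda>x. \<eta> (?k x)) (cocycles E \<delta> 0)"
      using comp_inj_on[OF ki] G(3) k by (simp add: o_def)
    show "(\<lambda>x. \<eta> (?k x)) ` cocycles E \<delta> 0 = cocycles G \<gamma> 0"
      using k G(4) by (metis image_image)
  qed (use d'(3) in blast)
  then show ?thesis by (rule baer_cocycles_mono[OF assms(2) _ d'(1)])
qed

section \<open>Characters of abelian groups\<close>

lemma ideal_int_multiples:
  assumes "ideal J \<Z>"
  obtains g where "g \<ge> 0" "J = {k. g dvd k}"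
proof -
  interpret J: ideal J \<Z> by fact
  have add: "a + b \<in> J" if "a \<in> J" "b \<in> J" for a b using J.a_closed[OF that] by simp
  have mult: "k * a \<in> J" if "a \<in> J" for a k using J.I_l_closed[of a k] that by simp
  have zero: "0 \<in> J" using J.zero_closed by simp
  show thesis
  proof (cases "\<exists>k\<in>J. k > 0")
    case False
    have "k = 0" if "k \<in> J" for k using False that mult[of k "-1"] by (cases k "0::int" rule: linorder_cases) auto
    with zero show ?thesis by (intro that[of 0]) auto
  next
    case True
    define n where "n = (LEAST n::nat. n > 0 \<and> int n \<in> J)"
    from True obtain k where "k \<in> J" "k > 0" by blast
    then have "nat k > 0 \<and> int (nat k) \<in> J" by simp
    from LeastI[of "\<lambda>n. n > 0 \<and> int n \<in> J", OF this] have n: "n > 0" "int n \<in> J" by (auto simp: n_def)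
    have "int n dvd k" if "k \<in> J" for k
    proof (rule ccontr)
      assume nd: "\<not> int n dvd k"
      have "k mod int n = k + (- (k div int n)) * int n" by (simp add: minus_div_mult_eq_mod [symmetric])
      then have "k mod int n \<in> J" using add[OF that mult[OF n(2), of "- (k div int n)"]] by simp
      moreover have "k mod int n > 0" "k mod int n < int n"
        using nd n(1) pos_mod_sign[of "int n" k] by (simp_all add: dvd_eq_mod_eq_0 order.not_eq_order_implies_strict)
      ultimately have "nat (k mod int n) > 0 \<and> int (nat (k mod int n)) \<in> J" by simp
      from Least_le[of "\<lambda>n. n > 0 \<and> int n \<in> J", OF this, folded n_def] \<open>k mod int n < int n\<close>
        \<open>k mod int n > 0\<close>
      show False by linarith
    qed
    moreover have "k \<in> J" if "int n dvd k" for k using that mult[OF n(2)] by (metis dvdE mult.commute)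
    ultimately show ?thesis by (intro that[of "int n"]) auto
  qed
qed

text \<open>
  The unit circle in the complex plane, written multiplicatively, as a module over the integers. It
  is divisible, hence injective, and it contains elements of every finite order.
\<close>

definition circle_module :: "(int, complex) module" where
  "circle_module = \<lparr>carrier = {z. cmod z = 1}, monoid.mult = undefined, one = undefined,
     zero = 1, add = (*), smult = (\<lambda>k z. z powi k)\<rparr>"

lemma circle_module_simps [simp]:
  "carrier circle_module = {z. cmod z = 1}" "zero circle_module = 1"
  "add circle_module = (*)" "smult circle_module k z = z powi k"
  by (auto simp: circle_module_def)

lemma circle_module: "module \<Z> circle_module"
proof (rule moduleI)
  have "\<exists>y. cmod y = 1 \<and> y * x = 1" if "cmod x = 1" for x
    using that by (intro exI[of _ "inverse x"]) (cases "x = 0"; simp add: norm_inverse)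
  then show "abelian_group circle_module" by (intro abelian_groupI) (auto simp: norm_mult)
  fix a b :: int and x assume "x \<in> carrier circle_module"
  then have "x \<noteq> 0" by auto
  then show "(a \<oplus>\<^bsub>\<Z>\<^esub> b) \<odot>\<^bsub>circle_module\<^esub> x = a \<odot>\<^bsub>circle_module\<^esub> x \<oplus>\<^bsub>circle_module\<^esub> b \<odot>\<^bsub>circle_module\<^esub> x"
    by (simp add: power_int_add)
  show "(a \<otimes>\<^bsub>\<Z>\<^esub> b) \<odot>\<^bsub>circle_module\<^esub> x = a \<odot>\<^bsub>circle_module\<^esub> (b \<odot>\<^bsub>circle_module\<^esub> x)"
    using power_int_mult[of x b a] by (simp add: mult.commute)
qed (auto simp: int_is_cring norm_power_int power_int_mult_distrib)

lemma circle_root: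
  assumes "cmod t = 1" "n > 0"
  obtains z where "cmod z = 1" "z powi int n = t"
proof (rule that[of "cis (Arg t / real n)"])
  have "cis (Arg t / real n) ^ n = cis (Arg t)" using assms(2) by (simp add: DeMoivre)
  also have "\<dots> = t" using assms(1) rcis_cmod_Arg[of t] by (simp add: rcis_def)
  finally show "cis (Arg t / real n) powi int n = t" by simp
qed simp

text \<open>
  An ideal of the integers consists of the multiples of some \<open>g\<close>, so a map to the circle is determined
  by its value at \<open>g\<close>, of which a \<open>g\<close>-th root is taken.
\<close>

lemma baer_circle: "baer \<Z> circle_module"
proof (rule baerI[OF circle_module])
  fix J f assume J: "ideal J \<Z>" and f: "\<And>a. a \<in> J \<Longrightarrow> f a \<in> carrier circle_module"
    "\<And>a b. a \<in> J \<Longrightarrow> b \<in> J \<Longrightarrow> f (a \<oplus>\<^bsub>\<Z>\<^esub> b) = f a \<oplus>\<^bsub>circle_module\<^esub> f b"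
    "\<And>r a. r \<in> carrier \<Z> \<Longrightarrow> a \<in> J \<Longrightarrow> f (r \<otimes>\<^bsub>\<Z>\<^esub> a) = r \<odot>\<^bsub>circle_module\<^esub> f a"
  obtain g where g: "g \<ge> 0" "J = {k. g dvd k}" using ideal_int_multiples[OF J] .
  have fm: "f (k * g) = f g powi k" for k using f(3)[of k g] g(2) by simp
  obtain z where z: "cmod z = 1" "z powi g = f g"
  proof (cases "g = 0")
    case True
    then show thesis using that[of 1] fm[of 0] by simp
  next
    case False
    then show thesis using circle_root[of "f g" "nat g"] f(1)[of g] g that by auto
  qed
  have "f a = z powi a" if "a \<in> J" for a
  proof -
    from that g(2) obtain k where "a = g * k" by auto
    then show ?thesis using fm[of k] z(2) by (simp add: power_int_mult mult.commute)
  qed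
  then show "\<exists>y\<in>carrier circle_module. \<forall>a\<in>J. f a = a \<odot>\<^bsub>circle_module\<^esub> y" using z(1) by auto
qed

definition int_module :: "('a, 'm) ring_scheme \<Rightarrow> (int, 'a) module" where
  "int_module N = \<lparr>carrier = carrier N, monoid.mult = undefined, one = undefined,
     zero = zero N, add = add N, smult = (\<lambda>k x. [k] \<cdot>\<^bsub>N\<^esub> x)\<rparr>"

lemma int_module_simps [simp]:
  "carrier (int_module N) = carrier N" "zero (int_module N) = zero N"
  "add (int_module N) = add N" "smult (int_module N) k x = [k] \<cdot>\<^bsub>N\<^esub> x"
  by (auto simp: int_module_def)

lemma int_module:
  fixes N :: "('a, 'm) ring_scheme"
  assumes "abelian_group N" shows "module \<Z> (int_module N)"
proof -
  interpret abelian_group N by fact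
  show ?thesis
  proof (rule moduleI)
    show "abelian_group (int_module N)"
      by (rule abelian_groupI) (auto simp: a_ac intro: bexI[of _ "\<ominus>\<^bsub>N\<^esub> _"] l_neg)
    fix a b :: int and x y assume x: "x \<in> carrier (int_module N)" "y \<in> carrier (int_module N)"
    show "(a \<oplus>\<^bsub>\<Z>\<^esub> b) \<odot>\<^bsub>int_module N\<^esub> x = a \<odot>\<^bsub>int_module N\<^esub> x \<oplus>\<^bsub>int_module N\<^esub> b \<odot>\<^bsub>int_module N\<^esub> x"
      using x add.int_pow_mult[of x a b] by simp
    show "a \<odot>\<^bsub>int_module N\<^esub> (x \<oplus>\<^bsub>int_module N\<^esub> y) = a \<odot>\<^bsub>int_module N\<^esub> x \<oplus>\<^bsub>int_module N\<^esub> a \<odot>\<^bsub>int_module N\<^esub> y"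
      using x add.int_pow_distrib[of x y a] by simp
    show "(a \<otimes>\<^bsub>\<Z>\<^esub> b) \<odot>\<^bsub>int_module N\<^esub> x = a \<odot>\<^bsub>int_module N\<^esub> (b \<odot>\<^bsub>int_module N\<^esub> x)"
      using x add.int_pow_pow[of x a b] by (simp add: mult.commute)
  qed (auto simp: int_is_cring)
qed

text \<open>
  A subgroup is closed under integer multiples.
\<close>

lemma linear_graph_intI:
  assumes N: "abelian_group N"
    and c: "\<And>x y. (x, y) \<in> G \<Longrightarrow> x \<in> carrier N" "\<And>x y. (x, y) \<in> G \<Longrightarrow> cmod y = 1"
    and z: "(\<zero>\<^bsub>N\<^esub>, 1) \<in> G"
    and a: "\<And>x y x' y'. (x, y) \<in> G \<Longrightarrow> (x', y') \<in> G \<Longrightarrow> (x \<oplus>\<^bsub>N\<^esub> x', y * y') \<in> G"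
    and n: "\<And>x y. (x, y) \<in> G \<Longrightarrow> (\<ominus>\<^bsub>N\<^esub> x, inverse y) \<in> G"
    and u: "\<And>y. (\<zero>\<^bsub>N\<^esub>, y) \<in> G \<Longrightarrow> y = 1"
  shows "linear_graph \<Z> (int_module N) circle_module G"
proof (rule linear_graphI)
  interpret abelian_group N by fact
  fix k :: int and x y assume xy: "(x, y) \<in> G"
  have nat: "([m] \<cdot>\<^bsub>N\<^esub> x, y ^ m) \<in> G" for m :: nat
  proof (induction m)
    case 0 then show ?case using z by simp
  next
    case (Suc m)
    have "[Suc m] \<cdot>\<^bsub>N\<^esub> x = [m] \<cdot>\<^bsub>N\<^esub> x \<oplus>\<^bsub>N\<^esub> x" using c(1)[OF xy] by simp
    then show ?case using a[OF Suc xy] by (simp add: mult.commute)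
  qed
  show "(k \<odot>\<^bsub>int_module N\<^esub> x, k \<odot>\<^bsub>circle_module\<^esub> y) \<in> G"
  proof (cases "k \<ge> 0")
    case True
    then show ?thesis using nat[of "nat k"] by (simp add: add_pow_int_ge power_int_def)
  next
    case False
    then show ?thesis using n[OF nat[of "nat (-k)"]] by (simp add: add_pow_int_lt power_int_def power_inverse)
  qed
qed (use assms in auto)

text \<open>
  Characters are normalised to be \<open>1\<close> outside the carrier, so that equal characters are equal functions.
\<close>

definition characters :: "('a, 'm) ring_scheme \<Rightarrow> ('a \<Rightarrow> complex) set" where
  "characters N = {\<chi>. (\<forall>s\<in>carrier N. cmod (\<chi> s) = 1) \<and> (\<forall>s. s \<notin> carrier N \<longrightarrow> \<chi> s = 1) \<and>
     (\<forall>s\<in>carrier N. \<forall>t\<in>carrier N. \<chi> (s \<oplus>\<^bsub>N\<^esub> t) = \<chi> s * \<chi> t)}"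

lemma charactersD:
  assumes "\<chi> \<in> characters N"
  shows "\<And>s. s \<in> carrier N \<Longrightarrow> cmod (\<chi> s) = 1" "\<And>s. s \<notin> carrier N \<Longrightarrow> \<chi> s = 1"
    "\<And>s t. \<lbrakk>s \<in> carrier N; t \<in> carrier N\<rbrakk> \<Longrightarrow> \<chi> (s \<oplus>\<^bsub>N\<^esub> t) = \<chi> s * \<chi> t"
  using assms by (auto simp: characters_def)

lemma character_extend:
  assumes "abelian_group N" "linear_graph \<Z> (int_module N) circle_module G"
  obtains \<chi> where "\<chi> \<in> characters N" "\<And>x y. (x, y) \<in> G \<Longrightarrow> \<chi> x = y"
proof -
  obtain g where g: "g \<in> mod_hom \<Z> (int_module N) circle_module" "\<And>x y. (x, y) \<in> G \<Longrightarrow> g x = y"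
    using baer_extend[OF int_module[OF assms(1)] baer_circle assms(2)] by blast
  interpret abelian_group N by fact
  have "(\<lambda>x. if x \<in> carrier N then g x else 1) \<in> characters N"
    using hom_closed[OF g(1)] hom_add[OF g(1)] by (auto simp: characters_def)
  moreover have "x \<in> carrier N" if "(x, y) \<in> G" for x y using linear_graphD(1)[OF assms(2) that] by simp
  ultimately show thesis using g(2) that[of "\<lambda>x. if x \<in> carrier N then g x else 1"] by auto
qed

lemma characters_zero:
  assumes "abelian_group N" "\<chi> \<in> characters N" shows "\<chi> \<zero>\<^bsub>N\<^esub> = 1"
proof -
  interpret abelian_group N by fact
  have "\<chi> \<zero>\<^bsub>N\<^esub> = \<chi> \<zero>\<^bsub>N\<^esub> * \<chi> \<zero>\<^bsub>N\<^esub>"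
    using charactersD(3)[OF assms(2), of "\<zero>\<^bsub>N\<^esub>" "\<zero>\<^bsub>N\<^esub>"] by simp
  moreover have "\<chi> \<zero>\<^bsub>N\<^esub> \<noteq> 0" using charactersD(1)[OF assms(2), of "\<zero>\<^bsub>N\<^esub>"] by auto
  ultimately show ?thesis by simp
qed

text \<open>
  On the cyclic group generated by \<open>x\<close> there is a character that does not kill \<open>x\<close>: send \<open>x\<close> to \<open>-1\<close> if
  its order is infinite, and to a primitive \<open>g\<close>-th root of unity if the order is \<open>g\<close>. Injectivity of
  the circle extends it to the whole group.
\<close>

lemma characters_separate:
  assumes "abelian_group N" "x \<in> carrier N" "x \<noteq> \<zero>\<^bsub>N\<^esub>"
  obtains \<chi> where "\<chi> \<in> characters N" "\<chi> x \<noteq> 1"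
proof -
  interpret abelian_group N by fact
  interpret ZN: module \<Z> "int_module N" by (rule int_module[OF assms(1)])
  have "ideal {k. [k] \<cdot>\<^bsub>N\<^esub> x = \<zero>\<^bsub>N\<^esub>} \<Z>"
    using ZN.smult_l_distr[of _ _ x] ZN.smult_assoc1[of _ _ x] ZN.smult_r_null ZN.smult_l_null[of x] assms(2)
    by (intro idealI'[OF int_is_cring]) auto
  from ideal_int_multiples[OF this] obtain g :: int where
    g0: "g \<ge> 0" "{k. [k] \<cdot>\<^bsub>N\<^esub> x = \<zero>\<^bsub>N\<^esub>} = {k. g dvd k}" by metis
  then have g: "g \<ge> 0" "\<And>k. ([k] \<cdot>\<^bsub>N\<^esub> x = \<zero>\<^bsub>N\<^esub>) = (g dvd k)" by auto
  have g1: "g \<noteq> 1" using g(2)[of 1] assms(2,3) ZN.smult_one[of x] by auto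
  obtain w where w: "cmod w = 1" "w \<noteq> 1" "w powi g = 1"
  proof (cases "g = 0")
    case True
    then show thesis using that[of "-1"] by simp
  next
    case False
    with g g1 have g2: "g \<ge> 2" by simp
    let ?w = "cis (2 * pi / real (nat g))"
    have "?w ^ nat g = cis (2 * pi)" using g2 by (simp add: DeMoivre)
    then have "?w powi g = 1" using g2 by (simp add: power_int_def)
    moreover have "?w \<noteq> 1"
    proof
      assume "?w = 1"
      then have "cos (2 * pi / real (nat g)) = 1" by (simp add: complex_eq_iff)
      moreover have "2 * pi / real (nat g) \<le> pi" using g2 by (simp add: field_simps)
      ultimately show False using cos_monotone_0_pi[of 0 "2 * pi / real (nat g)"] g2 by simp
    qed
    ultimately show thesis using that[of ?w] by simp
  qed
  let ?G = "{([k] \<cdot>\<^bsub>N\<^esub> x, w powi k) | k. True}"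
  have w0: "w \<noteq> 0" using w(1) by auto
  have "linear_graph \<Z> (int_module N) circle_module ?G"
  proof (rule linear_graph_intI[OF assms(1)])
    show "(\<zero>\<^bsub>N\<^esub>, 1) \<in> ?G" by (intro CollectI exI[of _ "0::int"]) (use ZN.smult_l_null[of x] assms(2) in simp)
    show "(a \<oplus>\<^bsub>N\<^esub> a', y * y') \<in> ?G" if "(a, y) \<in> ?G" "(a', y') \<in> ?G" for a y a' y'
    proof -
      from that obtain k k' where "a = [k] \<cdot>\<^bsub>N\<^esub> x" "y = w powi k" "a' = [k'] \<cdot>\<^bsub>N\<^esub> x" "y' = w powi k'" by blast
      then show ?thesis using ZN.smult_l_distr[of k k' x] assms(2) w0
        by (intro CollectI exI[of _ "k + k'"]) (simp add: power_int_add)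
    qed
    show "(\<ominus>\<^bsub>N\<^esub> a, inverse y) \<in> ?G" if "(a, y) \<in> ?G" for a y
    proof -
      from that obtain k where "a = [k] \<cdot>\<^bsub>N\<^esub> x" "y = w powi k" by blast
      then show ?thesis using add.int_pow_neg[OF assms(2), of k]
        by (intro CollectI exI[of _ "- k"]) (simp add: power_int_minus)
    qed
    show "y = 1" if "(\<zero>\<^bsub>N\<^esub>, y) \<in> ?G" for y
    proof -
      from that obtain k where k: "[k] \<cdot>\<^bsub>N\<^esub> x = \<zero>\<^bsub>N\<^esub>" "y = w powi k" by force
      with g(2) obtain q where "k = g * q" by auto
      with k w(3) show ?thesis by (simp add: power_int_mult)
    qed
  qed (use assms(2) w(1) in \<open>auto simp: norm_power_int\<close>)
  then obtain \<chi> where \<chi>: "\<chi> \<in> characters N" "\<And>x y. (x, y) \<in> ?G \<Longrightarrow> \<chi> x = y"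
    using character_extend[OF assms(1)] by blast
  have "(x, w) \<in> ?G" by (intro CollectI exI[of _ "1::int"]) (use ZN.smult_one[of x] assms(2) in simp)
  with \<chi> w(2) that show thesis by blast
qed

section \<open>Existence of injective resolutions\<close>

text \<open>
  The product, over the index type \<open>'i\<close>, of copies of the character module \<open>Hom\<^sub>\<int>(R, circle)\<close> with
  \<open>(r \<chi>)(s) = \<chi>(s r)\<close>. The group operation is pointwise multiplication of complex numbers.
\<close>

definition cofree :: "('r, 'x) ring_scheme \<Rightarrow> ('r, 'i \<Rightarrow> 'r \<Rightarrow> complex) module" where
  "cofree R = \<lparr>carrier = {F. \<forall>i. F i \<in> characters R}, monoid.mult = undefined, one = undefined,
     zero = (\<lambda>_ _. 1), add = (\<lambda>F G i s. F i s * G i s),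
     smult = (\<lambda>r F i s. if s \<in> carrier R then F i (s \<otimes>\<^bsub>R\<^esub> r) else 1)\<rparr>"

lemma cofree_simps [simp]:
  "F \<in> carrier (cofree R) \<longleftrightarrow> (\<forall>i. F i \<in> characters R)"
  "zero (cofree R) = (\<lambda>_ _. 1)" "add (cofree R) F G = (\<lambda>i s. F i s * G i s)"
  "smult (cofree R) r F = (\<lambda>i s. if s \<in> carrier R then F i (s \<otimes>\<^bsub>R\<^esub> r) else 1)"
  by (auto simp: cofree_def)

lemma cofree_module:
  assumes "cring R" shows "module R (cofree R)"
proof -
  interpret cring R by fact
  show ?thesis
  proof (rule moduleI[OF assms])
    have inv: "(\<lambda>i s. inverse (F i s)) \<in> carrier (cofree R) \<and>
       (\<lambda>i s. inverse (F i s)) \<oplus>\<^bsub>cofree R\<^esub> F = \<zero>\<^bsub>cofree R\<^esub>" if "F \<in> carrier (cofree R)" for F :: "'c \<Rightarrow> _"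
    proof
      have F: "F i \<in> characters R" for i using that by simp
      show "(\<lambda>i s. inverse (F i s)) \<in> carrier (cofree R)"
        using charactersD[OF F] by (auto simp: characters_def norm_inverse)
      have "F i s \<noteq> 0" for i s using charactersD(1,2)[OF F[of i], of s] by (cases "s \<in> carrier R") auto
      then show "(\<lambda>i s. inverse (F i s)) \<oplus>\<^bsub>cofree R\<^esub> F = \<zero>\<^bsub>cofree R\<^esub>" by simp
    qed
    show "abelian_group (cofree R :: ('a, 'c \<Rightarrow> 'a \<Rightarrow> complex) module)"
    proof (rule abelian_groupI)
      fix F G H :: "'c \<Rightarrow> 'a \<Rightarrow> complex"
      assume FGH: "F \<in> carrier (cofree R)" "G \<in> carrier (cofree R)" "H \<in> carrier (cofree R)"
      show "F \<oplus>\<^bsub>cofree R\<^esub> G \<in> carrier (cofree R)"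
        using FGH(1,2) by (auto simp: characters_def norm_mult mult_ac)
      show "F \<oplus>\<^bsub>cofree R\<^esub> G \<oplus>\<^bsub>cofree R\<^esub> H = F \<oplus>\<^bsub>cofree R\<^esub> (G \<oplus>\<^bsub>cofree R\<^esub> H)"
        by (simp add: mult.assoc)
      show "F \<oplus>\<^bsub>cofree R\<^esub> G = G \<oplus>\<^bsub>cofree R\<^esub> F" by (simp add: mult.commute)
      show "\<zero>\<^bsub>cofree R\<^esub> \<oplus>\<^bsub>cofree R\<^esub> F = F" by simp
      show "\<exists>G\<in>carrier (cofree R). G \<oplus>\<^bsub>cofree R\<^esub> F = \<zero>\<^bsub>cofree R\<^esub>" using inv[OF FGH(1)] by blast
    qed (simp add: characters_def)
    show "\<one>\<^bsub>R\<^esub> \<odot>\<^bsub>cofree R\<^esub> F = F" if "F \<in> carrier (cofree R)" for F :: "'c \<Rightarrow> 'a \<Rightarrow> complex"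
      using that charactersD(2)[of _ R] by (auto simp: fun_eq_iff)
    fix a b and F G :: "'c \<Rightarrow> 'a \<Rightarrow> complex"
    assume ab: "a \<in> carrier R" "b \<in> carrier R" and FG: "F \<in> carrier (cofree R)" "G \<in> carrier (cofree R)"
    then have F: "F i \<in> characters R" and G: "G i \<in> characters R" for i by auto
    show "a \<odot>\<^bsub>cofree R\<^esub> F \<in> carrier (cofree R)"
      using ab charactersD[OF F] by (auto simp: characters_def l_distr)
    show "(a \<oplus>\<^bsub>R\<^esub> b) \<odot>\<^bsub>cofree R\<^esub> F = a \<odot>\<^bsub>cofree R\<^esub> F \<oplus>\<^bsub>cofree R\<^esub> b \<odot>\<^bsub>cofree R\<^esub> F"
      using ab charactersD(3)[OF F] by (auto simp: r_distr fun_eq_iff)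
    show "a \<odot>\<^bsub>cofree R\<^esub> (F \<oplus>\<^bsub>cofree R\<^esub> G) = a \<odot>\<^bsub>cofree R\<^esub> F \<oplus>\<^bsub>cofree R\<^esub> a \<odot>\<^bsub>cofree R\<^esub> G"
      by (auto simp: fun_eq_iff)
    show "(a \<otimes>\<^bsub>R\<^esub> b) \<odot>\<^bsub>cofree R\<^esub> F = a \<odot>\<^bsub>cofree R\<^esub> (b \<odot>\<^bsub>cofree R\<^esub> F)"
      using ab by (auto simp: fun_eq_iff m_assoc)
  qed
qed

text \<open>
  A linear map \<open>f\<close> from an ideal \<open>J\<close> to \<open>Hom\<^sub>\<int>(R, circle)\<close> amounts to the character \<open>a \<mapsto> f(a)(1)\<close> of \<open>J\<close>,
  and any extension of this character to \<open>R\<close> is an element that represents \<open>f\<close>.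
\<close>

lemma baer_cofree:
  assumes "cring R" shows "baer R (cofree R)"
proof (rule baerI[OF cofree_module[OF assms]])
  interpret cring R by fact
  fix J and f :: "_ \<Rightarrow> 'c \<Rightarrow> _"
  assume J: "ideal J R" and f: "\<And>a. a \<in> J \<Longrightarrow> f a \<in> carrier (cofree R)"
    "\<And>a b. a \<in> J \<Longrightarrow> b \<in> J \<Longrightarrow> f (a \<oplus>\<^bsub>R\<^esub> b) = f a \<oplus>\<^bsub>cofree R\<^esub> f b"
    "\<And>r a. r \<in> carrier R \<Longrightarrow> a \<in> J \<Longrightarrow> f (r \<otimes>\<^bsub>R\<^esub> a) = r \<odot>\<^bsub>cofree R\<^esub> f a"
  interpret J: ideal J R by fact
  have fa: "f a i \<in> characters R" if "a \<in> J" for a i using f(1)[OF that] by simp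
  have ag: "abelian_group R" by (rule abelian_group_axioms)
  have f0: "f \<zero>\<^bsub>R\<^esub> i \<one>\<^bsub>R\<^esub> = 1" for i
  proof -
    have "f (\<zero>\<^bsub>R\<^esub> \<otimes>\<^bsub>R\<^esub> \<zero>\<^bsub>R\<^esub>) = \<zero>\<^bsub>R\<^esub> \<odot>\<^bsub>cofree R\<^esub> f \<zero>\<^bsub>R\<^esub>" by (rule f(3)) simp_all
    then have "f \<zero>\<^bsub>R\<^esub> i \<one>\<^bsub>R\<^esub> = (\<zero>\<^bsub>R\<^esub> \<odot>\<^bsub>cofree R\<^esub> f \<zero>\<^bsub>R\<^esub>) i \<one>\<^bsub>R\<^esub>" by (metis l_null zero_closed)
    also have "\<dots> = f \<zero>\<^bsub>R\<^esub> i \<zero>\<^bsub>R\<^esub>" by simp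
    also have "\<dots> = 1" by (rule characters_zero[OF ag fa[OF J.zero_closed]])
    finally show ?thesis .
  qed
  have ex: "\<exists>\<chi>. \<chi> \<in> characters R \<and> (\<forall>a\<in>J. \<chi> a = f a i \<one>\<^bsub>R\<^esub>)" for i
  proof -
    let ?G = "{(a, f a i \<one>\<^bsub>R\<^esub>) | a. a \<in> J}"
    have "linear_graph \<Z> (int_module R) circle_module ?G"
    proof (rule linear_graph_intI[OF ag])
      show "(\<ominus>\<^bsub>R\<^esub> x, inverse y) \<in> ?G" if "(x, y) \<in> ?G" for x y
      proof -
        from that have x: "x \<in> J" "y = f x i \<one>\<^bsub>R\<^esub>" by auto
        have "f (x \<oplus>\<^bsub>R\<^esub> \<ominus>\<^bsub>R\<^esub> x) i \<one>\<^bsub>R\<^esub> = y * f (\<ominus>\<^bsub>R\<^esub> x) i \<one>\<^bsub>R\<^esub>" using f(2)[of x "\<ominus>\<^bsub>R\<^esub> x"] x by simp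
        then have "y * f (\<ominus>\<^bsub>R\<^esub> x) i \<one>\<^bsub>R\<^esub> = 1" using x J.Icarr f0 by (simp add: r_neg)
        then have "inverse y = f (\<ominus>\<^bsub>R\<^esub> x) i \<one>\<^bsub>R\<^esub>" by (simp add: inverse_unique)
        then show ?thesis using x by auto
      qed
      show "(\<zero>\<^bsub>R\<^esub>, 1) \<in> ?G" using f0[of i] J.zero_closed by force
      show "(x \<oplus>\<^bsub>R\<^esub> x', y * y') \<in> ?G" if "(x, y) \<in> ?G" "(x', y') \<in> ?G" for x y x' y'
        using that f(2)[of x x'] by auto
    qed (use J.Icarr f0 charactersD(1)[OF fa] in auto)
    from character_extend[OF ag this] obtain \<chi> where
      "\<chi> \<in> characters R" "\<And>x y. (x, y) \<in> ?G \<Longrightarrow> \<chi> x = y" by blast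
    then show ?thesis by blast
  qed
  then obtain F where F: "\<And>i. F i \<in> characters R" "\<And>i a. a \<in> J \<Longrightarrow> F i a = f a i \<one>\<^bsub>R\<^esub>" by metis
  have "f a = a \<odot>\<^bsub>cofree R\<^esub> F" if "a \<in> J" for a
  proof (intro ext)
    fix i s
    have "f a i s = f (s \<otimes>\<^bsub>R\<^esub> a) i \<one>\<^bsub>R\<^esub>" if "s \<in> carrier R"
      using f(3)[OF that \<open>a \<in> J\<close>] that by simp
    then show "f a i s = (a \<odot>\<^bsub>cofree R\<^esub> F) i s"
      using charactersD(2)[OF fa[OF that], of s] F(2) that J.I_l_closed by simp
  qed
  with F(1) show "\<exists>y\<in>carrier (cofree R). \<forall>a\<in>J. f a = a \<odot>\<^bsub>cofree R\<^esub> y" by (intro bexI[of _ F]) simp_all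
qed

text \<open>
  The index set consists of all functions on \<open>N\<close>. An element \<open>x\<close> has the component \<open>s \<mapsto> \<chi>(s x)\<close> at a
  character \<open>\<chi>\<close>, and the trivial component at a function that is not a character.
\<close>

lemma embed_in_cofree:
  fixes N :: "('r, 'b) module"
  assumes "module R N"
  obtains e where "e \<in> mod_hom R N (cofree R :: ('r, ('b \<Rightarrow> complex) \<Rightarrow> 'r \<Rightarrow> complex) module)"
    "inj_on e (carrier N)"
proof -
  interpret N: module R N by fact
  have ag: "abelian_group N" by (rule N.M.abelian_group_axioms)
  let ?Q = "cofree R :: ('r, ('b \<Rightarrow> complex) \<Rightarrow> 'r \<Rightarrow> complex) module"
  define e where "e x = (\<lambda>\<chi> s. if s \<in> carrier R \<and> \<chi> \<in> characters N then \<chi> (s \<odot>\<^bsub>N\<^esub> x) else 1)" for x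
  have "e \<in> mod_hom R N ?Q"
  proof (rule mod_homI)
    show "e x \<in> carrier ?Q" if "x \<in> carrier N" for x
      using that charactersD(1,3)[of _ N] by (auto simp: e_def characters_def N.smult_l_distr)
    show "e (x \<oplus>\<^bsub>N\<^esub> y) = e x \<oplus>\<^bsub>?Q\<^esub> e y" if "x \<in> carrier N" "y \<in> carrier N" for x y
      using that charactersD(3)[of _ N] by (auto simp: e_def fun_eq_iff N.smult_r_distr)
    show "e (r \<odot>\<^bsub>N\<^esub> x) = r \<odot>\<^bsub>?Q\<^esub> e x" if "r \<in> carrier R" "x \<in> carrier N" for r x
      using that by (auto simp: e_def fun_eq_iff N.smult_assoc1)
  qed
  moreover have "inj_on e (carrier N)"
  proof (rule hom_inj_onI[OF assms cofree_module[OF module_cring[OF assms]] calculation])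
    fix x assume x: "x \<in> carrier N" "e x = \<zero>\<^bsub>?Q\<^esub>"
    show "x = \<zero>\<^bsub>N\<^esub>"
    proof (rule ccontr)
      assume "x \<noteq> \<zero>\<^bsub>N\<^esub>"
      then obtain \<chi> where \<chi>: "\<chi> \<in> characters N" "\<chi> x \<noteq> 1" using characters_separate[OF ag x(1)] by blast
      have "e x \<chi> \<one>\<^bsub>R\<^esub> = 1" using x(2) by simp
      with \<chi> x(1) show False by (simp add: e_def)
    qed
  qed
  ultimately show thesis using that by blast
qed

lemma lepoll_square:
  assumes "infinite (UNIV :: 'u set)" shows "(UNIV :: ('u \<times> 'u) set) \<lesssim> (UNIV :: 'u set)"
proof -
  have "(card_of (UNIV \<times> UNIV :: ('u \<times> 'u) set), card_of (UNIV :: 'u set)) \<in> ordLeq"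
    using card_of_Times_same_infinite[OF assms] ordIso_iff_ordLeq by blast
  then show ?thesis by (simp add: lepoll_def flip: card_of_ordLeq)
qed

lemma lepoll_Times_UNIV:
  assumes "infinite (UNIV :: 'u set)" "A \<lesssim> (UNIV :: 'u set)" "B \<lesssim> (UNIV :: 'u set)"
  shows "A \<times> B \<lesssim> (UNIV :: 'u set)"
proof -
  have "A \<times> B \<lesssim> (UNIV :: 'u set) \<times> (UNIV :: 'u set)"
    using assms(2,3) unfolding lepoll_def
  proof (elim exE conjE)
    fix f g assume "inj_on (f :: _ \<Rightarrow> 'u) A" "inj_on (g :: _ \<Rightarrow> 'u) B"
    then show "\<exists>h. inj_on h (A \<times> B) \<and> h ` (A \<times> B) \<subseteq> (UNIV :: 'u set) \<times> (UNIV :: 'u set)"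
      by - (intro exI[of _ "map_prod f g"], simp add: map_prod_inj_on)
  qed
  then show ?thesis using lepoll_trans[OF _ lepoll_square[OF assms(1)]] by simp
qed

text \<open>
  A list is encoded by its length and an iterated pairing of its entries.
\<close>

lemma lepoll_lists_UNIV:
  assumes inf: "infinite (UNIV :: 'u set)" and A: "A \<lesssim> (UNIV :: 'u set)"
  shows "lists A \<lesssim> (UNIV :: 'u set)"
proof -
  obtain p :: "'u \<times> 'u \<Rightarrow> 'u" where p: "inj p" using lepoll_square[OF inf] by (auto simp: lepoll_def)
  obtain c :: "nat \<Rightarrow> 'u" where c: "inj c" using inf infinite_le_lepoll[of "UNIV :: 'u set"] by (auto simp: lepoll_def)
  obtain a where a: "inj_on (a :: _ \<Rightarrow> 'u) A" using A by (auto simp: lepoll_def)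
  define enc where "enc = rec_list (c 0) (\<lambda>x _ u. p (a x, u))"
  have enc: "enc (x # xs) = p (a x, enc xs)" for x xs by (simp add: enc_def)
  have eq: "xs = ys" if "length xs = length ys" "xs \<in> lists A" "ys \<in> lists A" "enc xs = enc ys" for xs ys
    using that
  proof (induction xs ys rule: list_induct2)
    case (Cons x xs y ys)
    then have "a x = a y" "enc xs = enc ys" by (simp_all add: enc inj_eq[OF p])
    with Cons a show ?case by (auto dest: inj_onD)
  qed simp
  have "inj_on (\<lambda>xs. p (c (length xs), enc xs)) (lists A)"
  proof (rule inj_onI)
    fix xs ys assume h: "xs \<in> lists A" "ys \<in> lists A" "p (c (length xs), enc xs) = p (c (length ys), enc ys)"
    then have "c (length xs) = c (length ys)" "enc xs = enc ys" by (simp_all add: inj_eq[OF p])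
    then show "xs = ys" using eq h(1,2) by (simp add: inj_eq[OF c])
  qed
  then show ?thesis unfolding lepoll_def by blast
qed

lemma lepoll_UN_nat_UNIV:
  assumes inf: "infinite (UNIV :: 'u set)" and W: "\<And>k :: nat. W k \<lesssim> (UNIV :: 'u set)"
  shows "(\<Union>k. W k) \<lesssim> (UNIV :: 'u set)"
proof -
  from W obtain f where f: "\<And>k. inj_on (f k :: _ \<Rightarrow> 'u) (W k)" unfolding lepoll_def by metis
  have "\<forall>x\<in>\<Union>k. W k. \<exists>k. x \<in> W k" by blast
  then obtain \<kappa> where k: "x \<in> W (\<kappa> x)" if "x \<in> (\<Union>k. W k)" for x by (metis bchoice)
  have "inj_on (\<lambda>x. (\<kappa> x, f (\<kappa> x) x)) (\<Union>k. W k)"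
  proof (rule inj_onI)
    fix x y assume h: "x \<in> (\<Union>k. W k)" "y \<in> (\<Union>k. W k)" "(\<kappa> x, f (\<kappa> x) x) = (\<kappa> y, f (\<kappa> y) y)"
    then have "\<kappa> x = \<kappa> y" "f (\<kappa> x) x = f (\<kappa> y) y" unfolding prod.inject by blast+
    then have "x \<in> W (\<kappa> x)" "y \<in> W (\<kappa> x)" "f (\<kappa> x) x = f (\<kappa> x) y"
      using k[OF h(1)] k[OF h(2)] by simp_all
    then show "x = y" by (meson f inj_onD)
  qed
  then have "(\<Union>k. W k) \<lesssim> (UNIV :: nat set) \<times> (UNIV :: 'u set)" unfolding lepoll_def by blast
  also have "\<dots> \<lesssim> (UNIV :: 'u set)"
    using lepoll_Times_UNIV[OF inf _ lepoll_refl] inf infinite_le_lepoll by blast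
  finally show ?thesis .
qed

lemma lepoll_Un_UNIV:
  assumes inf: "infinite (UNIV :: 'u set)" and "A \<lesssim> (UNIV :: 'u set)" "B \<lesssim> (UNIV :: 'u set)"
  shows "A \<union> B \<lesssim> (UNIV :: 'u set)"
proof -
  have "(\<Union>k :: nat. if k = 0 then A else B) \<lesssim> (UNIV :: 'u set)"
    by (rule lepoll_UN_nat_UNIV[OF inf]) (use assms in auto)
  moreover have "A \<union> B \<subseteq> (\<Union>k :: nat. if k = 0 then A else B)"
  proof
    fix x assume "x \<in> A \<union> B"
    then show "x \<in> (\<Union>k :: nat. if k = 0 then A else B)"
      by (intro UN_I[of "if x \<in> A then 0 else 1"]) auto
  qed
  ultimately show ?thesis using lepoll_trans subset_imp_lepoll by blast
qed

definition lin_comb :: "('r, 'a) module \<Rightarrow> ('r \<times> 'a) list \<Rightarrow> 'a" where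
  "lin_comb M l = foldr (\<lambda>p s. fst p \<odot>\<^bsub>M\<^esub> snd p \<oplus>\<^bsub>M\<^esub> s) l \<zero>\<^bsub>M\<^esub>"

text \<open>
  A list of pairs \<open>(a, y)\<close> is read as the system of equations \<open>a z = y\<close> in one unknown \<open>z\<close>.
\<close>

definition lin_solution :: "('r, 'a) module \<Rightarrow> ('r \<times> 'a) list \<Rightarrow> 'a" where
  "lin_solution M l = (if \<exists>z\<in>carrier M. \<forall>p\<in>set l. fst p \<odot>\<^bsub>M\<^esub> z = snd p
     then SOME z. z \<in> carrier M \<and> (\<forall>p\<in>set l. fst p \<odot>\<^bsub>M\<^esub> z = snd p) else \<zero>\<^bsub>M\<^esub>)"

primrec solution_hull ::
  "('r, 'x) ring_scheme \<Rightarrow> ('r, 'a) module \<Rightarrow> 'a set \<Rightarrow> nat \<Rightarrow> 'a set" where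
  "solution_hull R M X 0 = X"
| "solution_hull R M X (Suc k) = solution_hull R M X k \<union>
     (lin_comb M ` lists (carrier R \<times> solution_hull R M X k) \<union>
      lin_solution M ` lists (carrier R \<times> solution_hull R M X k))"

text \<open>
  Close \<open>X\<close> under linear combinations and under chosen solutions of those finite systems \<open>a z = y\<close> that
  have a solution in \<open>Q\<close>. All operations are finitary, so the closure \<open>W\<close> is no larger than \<open>X\<close>, \<open>R\<close> and
  the natural numbers together. It is injective because ideals are finitely generated: a map
  \<open>f: J \<rightarrow> W\<close> is multiplication by an element of \<open>Q\<close>, so the finite system \<open>a z = f a\<close>, for \<open>a\<close> in a set of
  generators of \<open>J\<close>, is solvable in \<open>Q\<close>, and \<open>W\<close> contains a solution.
\<close>

lemma baer_submodule_of_size: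
  fixes Q :: "('r, 'q) module" and R :: "('r, 'x) ring_scheme"
  assumes "noetherian_ring R" "baer R Q" "X \<subseteq> carrier Q" "infinite (UNIV :: 'u set)"
    "X \<lesssim> (UNIV :: 'u set)" "carrier R \<lesssim> (UNIV :: 'u set)"
  obtains W where "submodule W R Q" "X \<subseteq> W" "baer R (sub Q W)" "W \<lesssim> (UNIV :: 'u set)"
proof -
  interpret Q: module R Q by (rule baer_module[OF assms(2)])
  let ?S = "solution_hull R Q X"
  have comb: "lin_comb Q l \<in> carrier Q" if "l \<in> lists (carrier R \<times> carrier Q)" for l
    using that by (induction l) (auto simp: lin_comb_def)
  have sol: "lin_solution Q l \<in> carrier Q" for l
    unfolding lin_solution_def
    using someI_ex[of "\<lambda>z. z \<in> carrier Q \<and> (\<forall>p\<in>set l. fst p \<odot>\<^bsub>Q\<^esub> z = snd p)"] by auto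
  have Sc: "?S k \<subseteq> carrier Q" for k
  proof (induction k)
    case (Suc k)
    then have "lists (carrier R \<times> ?S k) \<subseteq> lists (carrier R \<times> carrier Q)" by (intro lists_mono) auto
    then have "lin_comb Q ` lists (carrier R \<times> ?S k) \<subseteq> carrier Q" using comb by blast
    moreover have "lin_solution Q ` lists (carrier R \<times> ?S k) \<subseteq> carrier Q" using sol by blast
    ultimately show ?case using Suc by simp
  qed (use assms(3) in simp)
  have mono: "?S k \<subseteq> ?S l" if "k \<le> l" for k l by (rule lift_Suc_mono_le[OF _ that]) simp
  define W where "W = (\<Union>k. ?S k)"
  have up: "\<exists>k. F \<subseteq> ?S k" if "finite F" "F \<subseteq> W" for F
    using that
  proof (induction F)
    case (insert x F)
    then obtain k l where "F \<subseteq> ?S k" "x \<in> ?S l" by (auto simp: W_def)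
    then have "insert x F \<subseteq> ?S (max k l)" using mono[of k "max k l"] mono[of l "max k l"] by auto
    then show ?case by blast
  qed auto
  have combW: "lin_comb Q l \<in> W" and solW: "lin_solution Q l \<in> W"
    if l: "l \<in> lists (carrier R \<times> W)" for l
  proof -
    have "finite (snd ` set l)" "snd ` set l \<subseteq> W" using l by auto
    then obtain k where k: "snd ` set l \<subseteq> ?S k" using up by blast
    have "l \<in> lists (carrier R \<times> ?S k)"
    proof (unfold lists_eq_set, rule CollectI, rule subsetI)
      fix p assume p: "p \<in> set l"
      then have "p \<in> carrier R \<times> W" "snd p \<in> ?S k" using l k by auto
      then show "p \<in> carrier R \<times> ?S k" by (auto simp: mem_Times_iff)
    qed
    then have "lin_comb Q l \<in> ?S (Suc k)" "lin_solution Q l \<in> ?S (Suc k)" by auto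
    then show "lin_comb Q l \<in> W" "lin_solution Q l \<in> W" unfolding W_def by blast+
  qed
  have Wc: "W \<subseteq> carrier Q" using Sc by (auto simp: W_def)
  have sW: "submodule W R Q"
  proof (rule submoduleI'[OF Q.module_axioms Wc])
    show "\<zero>\<^bsub>Q\<^esub> \<in> W" using combW[of "[]"] by (simp add: lin_comb_def)
    show "a \<oplus>\<^bsub>Q\<^esub> b \<in> W" if "a \<in> W" "b \<in> W" for a b
      using combW[of "[(\<one>\<^bsub>R\<^esub>, a), (\<one>\<^bsub>R\<^esub>, b)]"] that Wc by (auto simp: lin_comb_def subset_iff)
    show "r \<odot>\<^bsub>Q\<^esub> a \<in> W" if "r \<in> carrier R" "a \<in> W" for r a
      using combW[of "[(r, a)]"] that Wc by (auto simp: lin_comb_def subset_iff)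
  qed
  have XW: "X \<subseteq> W" unfolding W_def using UN_upper[of 0 UNIV ?S] by simp
  have bW: "baer R (sub Q W)"
  proof (rule baerI[OF submodule_module[OF Q.module_axioms sW]])
    fix J f assume J: "ideal J R" and f: "\<And>a. a \<in> J \<Longrightarrow> f a \<in> carrier (sub Q W)"
      "\<And>a b. a \<in> J \<Longrightarrow> b \<in> J \<Longrightarrow> f (a \<oplus>\<^bsub>R\<^esub> b) = f a \<oplus>\<^bsub>sub Q W\<^esub> f b"
      "\<And>r a. r \<in> carrier R \<Longrightarrow> a \<in> J \<Longrightarrow> f (r \<otimes>\<^bsub>R\<^esub> a) = r \<odot>\<^bsub>sub Q W\<^esub> f a"
    have Jc: "a \<in> carrier R" if "a \<in> J" for a using ideal.Icarr[OF J that] .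
    obtain y where y: "y \<in> carrier Q" "\<And>a. a \<in> J \<Longrightarrow> f a = a \<odot>\<^bsub>Q\<^esub> y"
      using assms(2) J by (rule baerD[where f = f]) (use f Wc in auto)
    obtain A where A: "A \<subseteq> carrier R" "finite A" "J = Idl\<^bsub>R\<^esub> A" using noetherian_ring.finetely_gen[OF assms(1) J] by blast
    then obtain as where as: "set as = A" using finite_list by blast
    have AJ: "A \<subseteq> J" using A Q.R.genideal_self by blast
    let ?l = "map (\<lambda>a. (a, f a)) as"
    have fW: "f a \<in> W" if "a \<in> A" for a using f(1)[of a] AJ that by auto
    have "?l \<in> lists (carrier R \<times> W)" using as A(1) fW by auto
    then have zW: "lin_solution Q ?l \<in> W" by (rule solW)
    define z where "z = lin_solution Q ?l"
    have "\<exists>z\<in>carrier Q. \<forall>p\<in>set ?l. fst p \<odot>\<^bsub>Q\<^esub> z = snd p" using y AJ as by (intro bexI[of _ y]) auto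
    then have "z \<in> carrier Q \<and> (\<forall>p\<in>set ?l. fst p \<odot>\<^bsub>Q\<^esub> z = snd p)"
      unfolding z_def lin_solution_def
      using someI_ex[of "\<lambda>z. z \<in> carrier Q \<and> (\<forall>p\<in>set ?l. fst p \<odot>\<^bsub>Q\<^esub> z = snd p)"] by auto
    then have z: "z \<in> carrier Q" "\<And>a. a \<in> A \<Longrightarrow> a \<odot>\<^bsub>Q\<^esub> z = f a" using as by auto
    let ?I = "{a \<in> carrier R. a \<odot>\<^bsub>Q\<^esub> (z \<ominus>\<^bsub>Q\<^esub> y) = \<zero>\<^bsub>Q\<^esub>}"
    have "ideal ?I R"
      by (rule idealI'[OF module_cring[OF Q.module_axioms]])
         (use z y in \<open>auto simp: Q.smult_l_distr Q.smult_assoc1\<close>)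
    moreover have "A \<subseteq> ?I"
    proof
      fix a assume a: "a \<in> A"
      then have "a \<in> carrier R" "a \<in> J" using A(1) AJ by auto
      then show "a \<in> ?I" using z(1) z(2)[OF a] y(1) y(2)[OF \<open>a \<in> J\<close>] by (simp add: Q.smult_diff)
    qed
    ultimately have JI: "J \<subseteq> ?I" unfolding A(3) by (rule Q.R.genideal_minimal)
    have "f a = a \<odot>\<^bsub>Q\<^esub> z" if "a \<in> J" for a
      using subsetD[OF JI that] z(1) y(1) y(2)[OF that] by (auto simp: Q.smult_diff)
    with zW show "\<exists>y\<in>carrier (sub Q W). \<forall>a\<in>J. f a = a \<odot>\<^bsub>sub Q W\<^esub> y" unfolding z_def by auto
  qed
  have "?S k \<lesssim> (UNIV :: 'u set)" for k
  proof (induction k)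
    case (Suc k)
    have "lists (carrier R \<times> ?S k) \<lesssim> (UNIV :: 'u set)"
      by (rule lepoll_lists_UNIV[OF assms(4) lepoll_Times_UNIV[OF assms(4,6) Suc]])
    then have "g ` lists (carrier R \<times> ?S k) \<lesssim> (UNIV :: 'u set)" for g :: "_ \<Rightarrow> 'q"
      using image_lepoll lepoll_trans by blast
    then show ?case using Suc by (simp add: lepoll_Un_UNIV[OF assms(4)])
  qed (use assms(5) in simp)
  then have "W \<lesssim> (UNIV :: 'u set)" unfolding W_def by (rule lepoll_UN_nat_UNIV[OF assms(4)])
  with sW XW bW that show thesis by blast
qed

lemma embed_in_baer_of_size:
  fixes N :: "('r, 'b) module" and R :: "('r, 'x) ring_scheme"
  assumes "noetherian_ring R" "module R N" "infinite (UNIV :: 'u set)"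
    "carrier N \<lesssim> (UNIV :: 'u set)" "carrier R \<lesssim> (UNIV :: 'u set)"
  obtains I :: "('r, 'u) module" and e where "baer R I" "e \<in> mod_hom R N I" "inj_on e (carrier N)"
proof -
  obtain e where e: "e \<in> mod_hom R N (cofree R :: ('r, ('b \<Rightarrow> complex) \<Rightarrow> 'r \<Rightarrow> complex) module)"
    "inj_on e (carrier N)" using embed_in_cofree[OF assms(2)] by blast
  let ?Q = "cofree R :: ('r, ('b \<Rightarrow> complex) \<Rightarrow> 'r \<Rightarrow> complex) module"
  have bQ: "baer R ?Q" by (rule baer_cofree[OF module_cring[OF assms(2)]])
  have "e ` carrier N \<subseteq> carrier ?Q" using hom_closed[OF e(1)] by blast
  moreover have "e ` carrier N \<lesssim> (UNIV :: 'u set)" using assms(4) image_lepoll lepoll_trans by blast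
  ultimately obtain W where W: "submodule W R ?Q" "e ` carrier N \<subseteq> W" "baer R (sub ?Q W)" "W \<lesssim> (UNIV :: 'u set)"
    using baer_submodule_of_size[OF assms(1) bQ _ assms(3) _ assms(5)] by metis
  then obtain h where h: "inj_on (h :: _ \<Rightarrow> 'u) W" by (auto simp: lepoll_def)
  have mW: "module R (sub ?Q W)" by (rule baer_module[OF W(3)])
  have hW: "inj_on h (carrier (sub ?Q W))" using h by simp
  note c = copy_module[OF mW hW]
  show thesis
  proof (rule that)
    show "baer R (copy_module h (sub ?Q W))"
      by (rule baer_retract[OF W(3) c(1) c(2) c(3)]) (unfold c(4), auto simp: f_inv_into_f)
    show "(\<lambda>x. h (e x)) \<in> mod_hom R N (copy_module h (sub ?Q W))"
      by (rule hom_comp[OF hom_corestrict[OF e(1) W(2)] c(2)])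
    show "inj_on (\<lambda>x. h (e x)) (carrier N)"
      using comp_inj_on[OF e(2) inj_on_subset[OF h W(2)]] by (simp add: o_def)
  qed
qed

lemma extend_resolution:
  fixes E :: "('r, 'u) module" and R :: "('r, 'x) ring_scheme"
  assumes "noetherian_ring R" "module R E" "submodule B R E" "infinite (UNIV :: 'u set)"
    "carrier R \<lesssim> (UNIV :: 'u set)"
  obtains E' :: "('r, 'u) module" and \<delta> where "baer R E'" "\<delta> \<in> mod_hom R E E'" "a_kernel E E' \<delta> = B"
proof -
  let ?Q = "quotient_module E B" and ?p = "\<lambda>x. B +>\<^bsub>E\<^esub> x"
  note q = quotient_module[OF assms(2,3)]
  have "carrier ?Q \<lesssim> carrier E" unfolding q(3)[symmetric] by (rule image_lepoll)
  then have "carrier ?Q \<lesssim> (UNIV :: 'u set)" using lepoll_trans subset_imp_lepoll by blast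
  then obtain I :: "('r, 'u) module" and e where I: "baer R I" "e \<in> mod_hom R ?Q I" "inj_on e (carrier ?Q)"
    using embed_in_baer_of_size[OF assms(1) q(1) assms(4) _ assms(5)] by blast
  interpret Q: module R ?Q by (rule q(1))
  have e0: "e \<zero>\<^bsub>?Q\<^esub> = \<zero>\<^bsub>I\<^esub>" by (rule hom_zero[OF q(1) baer_module[OF I(1)] I(2)])
  have "e (?p x) = \<zero>\<^bsub>I\<^esub> \<longleftrightarrow> ?p x = \<zero>\<^bsub>?Q\<^esub>" if "x \<in> carrier E" for x
    using inj_on_eq_iff[OF I(3) hom_closed[OF q(2) that] Q.M.zero_closed] e0 by simp
  then have "a_kernel E I (\<lambda>x. e (?p x)) = a_kernel E ?Q ?p" by (auto simp: kernel_iff e0)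
  with q(4) have "a_kernel E I (\<lambda>x. e (?p x)) = B" by simp
  with I(1) hom_comp[OF q(2) I(2)] that show thesis by blast
qed

lemma injective_resolution_exists:
  fixes M :: "('r, 'a) module" and R :: "('r, 'x) ring_scheme"
  assumes "noetherian_ring R" "module R M"
  shows "\<exists>\<epsilon> (E :: nat \<Rightarrow> ('r, ('r, 'a) universe) module) \<delta>. injective_resolution R M \<epsilon> E \<delta>"
proof -
  let ?U = "UNIV :: ('r, 'a) universe set"
  have "inj (\<lambda>n :: nat. (\<lambda>_. (undefined, n)) :: ('r, 'a) universe)" by (auto intro!: injI dest: fun_cong)
  then have inf: "infinite ?U" using infinite_le_lepoll unfolding lepoll_def by blast
  have "inj (\<lambda>x. (\<lambda>_. (x, 0)) :: ('r, 'a) universe)" by (auto intro!: injI dest: fun_cong)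
  then have M: "carrier M \<lesssim> ?U" unfolding lepoll_def using inj_on_subset by blast
  have "inj (\<lambda>r. (\<lambda>s. (undefined, if s = r then 1 else 0)) :: ('r, 'a) universe)"
  proof (rule injI)
    fix r s :: 'r
    assume "(\<lambda>t. (undefined, if t = r then 1 else 0)) = ((\<lambda>t. (undefined, if t = s then 1 else 0)) :: ('r, 'a) universe)"
    from fun_cong[OF this, of r] show "r = s" by (simp split: if_splits)
  qed
  then have R: "carrier R \<lesssim> ?U" unfolding lepoll_def using inj_on_subset by blast
  obtain E0 :: "('r, ('r, 'a) universe) module" and \<epsilon> where
    E0: "baer R E0" "\<epsilon> \<in> mod_hom R M E0" "inj_on \<epsilon> (carrier M)"
    using embed_in_baer_of_size[OF assms inf M R] by blast
  let ?P = "\<lambda>(n :: nat) (E, B). baer R E \<and> submodule B R E \<and> (n = 0 \<longrightarrow> E = E0 \<and> B = \<epsilon> ` carrier M)"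
  let ?T = "\<lambda>(E, B) (E', B'). \<exists>\<delta>. \<delta> \<in> mod_hom R E E' \<and> a_kernel E E' \<delta> = B \<and> B' = \<delta> ` carrier E"
  have "\<exists>F. \<forall>n :: nat. ?P n (F n) \<and> ?T (F n) (F (Suc n))"
  proof (rule dependent_nat_choice)
    show "\<exists>x. ?P 0 x"
      using E0 submodule_image[OF assms(2) baer_module[OF E0(1)] E0(2) submodule_carrier[OF assms(2)]]
      by (intro exI[of _ "(E0, \<epsilon> ` carrier M)"]) simp
  next
    fix x n assume "?P n x"
    then obtain E B where x: "x = (E, B)" "baer R E" "submodule B R E" by (cases x) auto
    obtain E' :: "('r, ('r, 'a) universe) module" and \<delta> where
      E': "baer R E'" "\<delta> \<in> mod_hom R E E'" "a_kernel E E' \<delta> = B"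
      using extend_resolution[OF assms(1) baer_module[OF x(2)] x(3) inf R] by blast
    have "submodule (\<delta> ` carrier E) R E'"
      using submodule_image[OF baer_module[OF x(2)] baer_module[OF E'(1)] E'(2)]
        submodule_carrier[OF baer_module[OF x(2)]] by blast
    with x E' show "\<exists>y. ?P (Suc n) y \<and> ?T x y"
      by (intro exI[of _ "(E', \<delta> ` carrier E)"]) auto
  qed
  then obtain F where F': "\<forall>n. ?P n (F n) \<and> ?T (F n) (F (Suc n))" by (elim exE)
  note F = F'[THEN spec, THEN conjunct1] F'[THEN spec, THEN conjunct2]
  define E where "E n = fst (F n)" for n
  define B where "B n = snd (F n)" for n
  have E: "baer R (E n)" for n using F(1)[of n] by (simp add: E_def case_prod_unfold)
  have E00: "E 0 = E0" "B 0 = \<epsilon> ` carrier M" using F(1)[of 0] by (simp_all add: E_def B_def case_prod_unfold)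
  have "\<forall>n. \<exists>\<delta>. \<delta> \<in> mod_hom R (E n) (E (Suc n)) \<and> a_kernel (E n) (E (Suc n)) \<delta> = B n \<and>
     B (Suc n) = \<delta> ` carrier (E n)"
    using F(2) by (simp add: E_def B_def case_prod_unfold)
  then obtain \<delta> where \<delta>: "\<And>n. \<delta> n \<in> mod_hom R (E n) (E (Suc n))"
    "\<And>n. a_kernel (E n) (E (Suc n)) (\<delta> n) = B n" "\<And>n. B (Suc n) = \<delta> n ` carrier (E n)" by metis
  have "exact_baer R E \<delta>" unfolding exact_baer_def cocycles_def using E \<delta> by simp
  moreover have "\<epsilon> ` carrier M = cocycles E \<delta> 0" by (simp only: cocycles_def \<delta>(2) E00(2))
  ultimately have "injective_resolution R M \<epsilon> E \<delta>"
    unfolding injective_resolution_iff using E0 E00 by simp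
  then show ?thesis by blast
qed

section \<open>Noetherian induction\<close>

lemma noetherian_maximal:
  assumes "noetherian_ring R" "ideal I\<^sub>0 R" "P I\<^sub>0"
  shows "\<exists>L. ideal L R \<and> P L \<and> (\<forall>I. ideal I R \<and> P I \<and> L \<subseteq> I \<longrightarrow> I = L)"
proof -
  let ?F = "{I. ideal I R \<and> P I}"
  have "?F \<noteq> {}" using assms(2,3) by blast
  then have "\<exists>L\<in>?F. \<forall>I\<in>?F. L \<subseteq> I \<longrightarrow> I = L"
  proof (rule subset_Zorn_nonempty)
    fix C assume C: "C \<noteq> {}" "subset.chain ?F C"
    then have "subset.chain {I. ideal I R} C" by (auto simp: subset_chain_def)
    from noetherian_ring.ideal_chain_is_trivial[OF assms(1) C(1) this]
    show "\<Union>C \<in> ?F" using C(2) by (auto simp: subset_chain_def)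
  qed
  then show ?thesis by auto
qed

lemma noetherian_induct:
  assumes "noetherian_ring R" "ideal I R"
    and step: "\<And>I. ideal I R \<Longrightarrow> (\<And>J. ideal J R \<Longrightarrow> I \<subset> J \<Longrightarrow> P J) \<Longrightarrow> P I"
  shows "P I"
proof (rule ccontr)
  assume "\<not> P I"
  from noetherian_maximal[OF assms(1,2), of "\<lambda>I. \<not> P I", OF this] obtain L where
    L: "ideal L R" "\<not> P L" "\<forall>I. ideal I R \<and> \<not> P I \<and> L \<subseteq> I \<longrightarrow> I = L" by auto
  have "P L" by (rule step) (use L in auto)
  with L(2) show False by simp
qed

definition ideal_adjoin :: "('r, 'x) ring_scheme \<Rightarrow> 'r set \<Rightarrow> 'r \<Rightarrow> 'r set" where
  "ideal_adjoin R I a = {l \<oplus>\<^bsub>R\<^esub> r \<otimes>\<^bsub>R\<^esub> a | l r. l \<in> I \<and> r \<in> carrier R}"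

lemma ideal_adjoin:
  assumes "cring R" "ideal I R" "a \<in> carrier R"
  shows "ideal (ideal_adjoin R I a) R" "I \<subseteq> ideal_adjoin R I a" "a \<in> ideal_adjoin R I a"
proof -
  interpret cring R by fact
  interpret I: ideal I R by fact
  have mem: "l \<oplus>\<^bsub>R\<^esub> r \<otimes>\<^bsub>R\<^esub> a \<in> ideal_adjoin R I a" if "l \<in> I" "r \<in> carrier R" for l r
    using that by (auto simp: ideal_adjoin_def)
  show IL: "I \<subseteq> ideal_adjoin R I a"
  proof
    fix l assume "l \<in> I"
    with mem[of l "\<zero>\<^bsub>R\<^esub>"] assms(3) show "l \<in> ideal_adjoin R I a" by simp
  qed
  show "a \<in> ideal_adjoin R I a" using mem[of "\<zero>\<^bsub>R\<^esub>" "\<one>\<^bsub>R\<^esub>"] assms(3) by simp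
  show "ideal (ideal_adjoin R I a) R"
  proof (rule idealI'[OF assms(1)])
    show "ideal_adjoin R I a \<subseteq> carrier R" using assms(3) I.Icarr by (auto simp: ideal_adjoin_def)
    show "\<zero>\<^bsub>R\<^esub> \<in> ideal_adjoin R I a" using IL by auto
    show "u \<oplus>\<^bsub>R\<^esub> v \<in> ideal_adjoin R I a" if uv: "u \<in> ideal_adjoin R I a" "v \<in> ideal_adjoin R I a" for u v
    proof -
      from uv obtain l r l' r' where h: "l \<in> I" "r \<in> carrier R" "l' \<in> I" "r' \<in> carrier R"
        "u = l \<oplus>\<^bsub>R\<^esub> r \<otimes>\<^bsub>R\<^esub> a" "v = l' \<oplus>\<^bsub>R\<^esub> r' \<otimes>\<^bsub>R\<^esub> a" by (auto simp: ideal_adjoin_def)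
      then have "u \<oplus>\<^bsub>R\<^esub> v = (l \<oplus>\<^bsub>R\<^esub> l') \<oplus>\<^bsub>R\<^esub> (r \<oplus>\<^bsub>R\<^esub> r') \<otimes>\<^bsub>R\<^esub> a"
        using assms(3) I.Icarr by (simp add: l_distr a_ac)
      then show ?thesis using mem[of "l \<oplus>\<^bsub>R\<^esub> l'" "r \<oplus>\<^bsub>R\<^esub> r'"] h by simp
    qed
    show "s \<otimes>\<^bsub>R\<^esub> u \<in> ideal_adjoin R I a" if s: "s \<in> carrier R" and u: "u \<in> ideal_adjoin R I a" for s u
    proof -
      from u obtain l r where h: "l \<in> I" "r \<in> carrier R" "u = l \<oplus>\<^bsub>R\<^esub> r \<otimes>\<^bsub>R\<^esub> a" by (auto simp: ideal_adjoin_def)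
      then have "s \<otimes>\<^bsub>R\<^esub> u = s \<otimes>\<^bsub>R\<^esub> l \<oplus>\<^bsub>R\<^esub> (s \<otimes>\<^bsub>R\<^esub> r) \<otimes>\<^bsub>R\<^esub> a"
        using assms(3) I.Icarr s by (simp add: r_distr m_assoc)
      then show ?thesis using mem[of "s \<otimes>\<^bsub>R\<^esub> l" "s \<otimes>\<^bsub>R\<^esub> r"] h s I.I_l_closed by simp
    qed
  qed
qed

lemma colon_ideal:
  assumes "cring R" "ideal I R" "a \<in> carrier R"
  shows "ideal {r \<in> carrier R. r \<otimes>\<^bsub>R\<^esub> a \<in> I} R"
proof -
  interpret cring R by fact
  interpret I: ideal I R by fact
  show ?thesis
    by (rule idealI'[OF assms(1)]) (use assms(3) I.I_l_closed in \<open>auto simp: l_distr m_assoc\<close>)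
qed

lemma annihilator_ideal:
  assumes "module R M" "x \<in> carrier M"
  shows "ideal {r \<in> carrier R. r \<odot>\<^bsub>M\<^esub> x = \<zero>\<^bsub>M\<^esub>} R"
proof -
  interpret module R M by fact
  show ?thesis
    by (rule idealI'[OF module_cring[OF assms(1)]])
       (use assms(2) in \<open>auto simp: smult_l_distr smult_assoc1\<close>)
qed

text \<open>
  An ideal maximal among those contained in \<open>I\<close> with the property \<open>P\<close> is equal to \<open>I\<close>, as otherwise an
  element of \<open>I\<close> could be adjoined.
\<close>

lemma noetherian_adjoin_induct:
  assumes "noetherian_ring R" "cring R" "ideal I R" "P {\<zero>\<^bsub>R\<^esub>}"
    and step: "\<And>I a. ideal I R \<Longrightarrow> a \<in> carrier R \<Longrightarrow> P I \<Longrightarrow> P (ideal_adjoin R I a)"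
  shows "P I"
proof -
  interpret cring R by fact
  interpret I: ideal I R by fact
  have "{\<zero>\<^bsub>R\<^esub>} \<subseteq> I \<and> P {\<zero>\<^bsub>R\<^esub>}" using assms(4) by auto
  from noetherian_maximal[OF assms(1) zeroideal, of "\<lambda>L. L \<subseteq> I \<and> P L", OF this]
  obtain L where L: "ideal L R" "L \<subseteq> I" "P L"
    and max: "\<forall>L'. ideal L' R \<and> (L' \<subseteq> I \<and> P L') \<and> L \<subseteq> L' \<longrightarrow> L' = L" by auto
  have "L = I"
  proof (rule ccontr)
    assume "L \<noteq> I"
    then obtain a where a: "a \<in> I" "a \<notin> L" using L(2) by blast
    then have aR: "a \<in> carrier R" using I.Icarr by blast
    note A = ideal_adjoin[OF assms(2) L(1) aR]
    have "ideal_adjoin R L a \<subseteq> I" using L(2) a(1) I.I_l_closed by (auto simp: ideal_adjoin_def)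
    with max A(1,2) step[OF L(1) aR L(3)] have "ideal_adjoin R L a = L" by blast
    with A(3) a(2) show False by simp
  qed
  with L(3) show ?thesis by simp
qed

section \<open>Torsion\<close>

lemma ideal_power_ideal:
  assumes "cring R" "ideal \<aa> R" shows "ideal (ideal_power R \<aa> k) R"
proof (induction k)
  interpret cring R by fact
  case 0 show ?case by (simp add: oneideal)
next
  interpret cring R by fact
  case (Suc k) then show ?case by (simp add: ideal_prod_is_ideal assms(2))
qed

lemma ideal_power_annihilates_Suc:
  assumes "module R M" "ideal \<aa> R" "x \<in> carrier M"
  shows "(\<forall>r\<in>ideal_power R \<aa> (Suc k). r \<odot>\<^bsub>M\<^esub> x = \<zero>\<^bsub>M\<^esub>) \<longleftrightarrow>
    (\<forall>s\<in>\<aa>. \<forall>r\<in>ideal_power R \<aa> k. r \<odot>\<^bsub>M\<^esub> (s \<odot>\<^bsub>M\<^esub> x) = \<zero>\<^bsub>M\<^esub>)"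
proof -
  interpret module R M by fact
  have P: "ideal (ideal_power R \<aa> k) R" for k by (rule ideal_power_ideal[OF module_cring[OF assms(1)] assms(2)])
  have c: "s \<in> \<aa> \<Longrightarrow> s \<in> carrier R" "r \<in> ideal_power R \<aa> k \<Longrightarrow> r \<in> carrier R" for s r k
    using ideal.Icarr[OF assms(2)] ideal.Icarr[OF P] by blast+
  have sw: "(s \<otimes>\<^bsub>R\<^esub> r) \<odot>\<^bsub>M\<^esub> x = r \<odot>\<^bsub>M\<^esub> (s \<odot>\<^bsub>M\<^esub> x)" if "s \<in> carrier R" "r \<in> carrier R" for s r
    using that assms(3) by (metis R.m_comm smult_assoc1)
  show ?thesis
  proof
    assume L: "\<forall>r\<in>ideal_power R \<aa> (Suc k). r \<odot>\<^bsub>M\<^esub> x = \<zero>\<^bsub>M\<^esub>"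
    show "\<forall>s\<in>\<aa>. \<forall>r\<in>ideal_power R \<aa> k. r \<odot>\<^bsub>M\<^esub> (s \<odot>\<^bsub>M\<^esub> x) = \<zero>\<^bsub>M\<^esub>"
    proof (intro ballI)
      fix s r assume sr: "s \<in> \<aa>" "r \<in> ideal_power R \<aa> k"
      then have "s \<otimes>\<^bsub>R\<^esub> r \<in> ideal_power R \<aa> (Suc k)" by (simp add: ideal_prod.prod)
      with L sw[OF c(1)[OF sr(1)] c(2)[OF sr(2)]] show "r \<odot>\<^bsub>M\<^esub> (s \<odot>\<^bsub>M\<^esub> x) = \<zero>\<^bsub>M\<^esub>" by simp
    qed
  next
    assume L: "\<forall>s\<in>\<aa>. \<forall>r\<in>ideal_power R \<aa> k. r \<odot>\<^bsub>M\<^esub> (s \<odot>\<^bsub>M\<^esub> x) = \<zero>\<^bsub>M\<^esub>"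
    show "\<forall>r\<in>ideal_power R \<aa> (Suc k). r \<odot>\<^bsub>M\<^esub> x = \<zero>\<^bsub>M\<^esub>"
    proof
      fix r assume "r \<in> ideal_power R \<aa> (Suc k)"
      then have "r \<in> ideal_prod R \<aa> (ideal_power R \<aa> k)" by simp
      then have "r \<in> carrier R \<and> r \<odot>\<^bsub>M\<^esub> x = \<zero>\<^bsub>M\<^esub>"
      proof (induction r rule: ideal_prod.induct)
        case (prod i j)
        then show ?case using L c by (simp add: sw)
      next
        case (sum s1 s2)
        then show ?case using assms(3) by (simp add: smult_l_distr)
      qed
      then show "r \<odot>\<^bsub>M\<^esub> x = \<zero>\<^bsub>M\<^esub>" by simp
    qed
  qed
qed

lemma ideal_power_mono:
  assumes "cring R" "ideal \<aa> R" "k \<le> l"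
  shows "ideal_power R \<aa> l \<subseteq> ideal_power R \<aa> k"
proof -
  interpret cring R by fact
  have "ideal_power R \<aa> (Suc k) \<subseteq> ideal_power R \<aa> k" for k
    using ideal_prod_inter[OF assms(2) ideal_power_ideal[OF assms(1,2), of k]] by simp
  then show ?thesis using lift_Suc_antimono_le[of "ideal_power R \<aa>"] assms(3) by blast
qed

lemma nat_pow_in_ideal_power:
  assumes "cring R" "ideal \<aa> R" "s \<in> \<aa>" shows "s [^]\<^bsub>R\<^esub> (k :: nat) \<in> ideal_power R \<aa> k"
proof (induction k)
  interpret cring R by fact
  case 0 show ?case by simp
next
  interpret cring R by fact
  case (Suc k)
  have "s [^]\<^bsub>R\<^esub> Suc k = s \<otimes>\<^bsub>R\<^esub> s [^]\<^bsub>R\<^esub> k"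
    using ideal.Icarr[OF assms(2,3)] by (simp add: m_comm)
  then show ?case using Suc assms(3) by (simp only: ideal_power.simps) (rule ideal_prod.prod)
qed

text \<open>
  Finite generation of \<open>\<aa>\<close> turns elementwise nilpotency on \<open>x\<close> into nilpotency of the ideal. The proof
  is by Noetherian induction on the annihilator of \<open>x\<close>. For \<open>s\<close> in \<open>\<aa>\<close> either \<open>s x = 0\<close>, or the last
  nonvanishing power of \<open>s\<close> on \<open>x\<close> annihilates \<open>s x\<close> but not \<open>x\<close>. In both cases a power of \<open>\<aa>\<close> kills \<open>s x\<close>;
  one exponent serves for all generators \<open>s\<close>, and the next power of \<open>\<aa>\<close> kills \<open>x\<close>.
\<close>

lemma torsion_iff:
  assumes "noetherian_ring R" "module R M" "ideal \<aa> R"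
  shows "x \<in> carrier (torsion_part R \<aa> M) \<longleftrightarrow>
    x \<in> carrier M \<and> (\<forall>s\<in>\<aa>. \<exists>i :: nat. s [^]\<^bsub>R\<^esub> i \<odot>\<^bsub>M\<^esub> x = \<zero>\<^bsub>M\<^esub>)"
proof
  interpret module R M by fact
  assume "x \<in> carrier (torsion_part R \<aa> M)"
  then show "x \<in> carrier M \<and> (\<forall>s\<in>\<aa>. \<exists>i :: nat. s [^]\<^bsub>R\<^esub> i \<odot>\<^bsub>M\<^esub> x = \<zero>\<^bsub>M\<^esub>)"
    using nat_pow_in_ideal_power[OF module_cring[OF assms(2)] assms(3)]
    by (auto simp: torsion_part_def)
next
  interpret module R M by fact
  have cr: "cring R" by (rule module_cring[OF assms(2)])
  have ac: "s \<in> carrier R" if "s \<in> \<aa>" for s using ideal.Icarr[OF assms(3) that] .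
  let ?nil = "\<lambda>x. \<forall>s\<in>\<aa>. \<exists>i :: nat. s [^]\<^bsub>R\<^esub> i \<odot>\<^bsub>M\<^esub> x = \<zero>\<^bsub>M\<^esub>"
  let ?ann = "\<lambda>x. {r \<in> carrier R. r \<odot>\<^bsub>M\<^esub> x = \<zero>\<^bsub>M\<^esub>}"
  assume "x \<in> carrier M \<and> ?nil x"
  then have "x \<in> carrier M" "?nil x" by auto
  moreover have "\<forall>x. ?ann x = I \<longrightarrow> x \<in> carrier M \<longrightarrow> ?nil x \<longrightarrow> (\<exists>k. \<forall>r\<in>ideal_power R \<aa> k. r \<odot>\<^bsub>M\<^esub> x = \<zero>\<^bsub>M\<^esub>)"
    if "ideal I R" for I
    using assms(1) that
  proof (rule noetherian_induct)
    fix I assume IH: "\<And>J. ideal J R \<Longrightarrow> I \<subset> J \<Longrightarrow> \<forall>x. ?ann x = J \<longrightarrow> x \<in> carrier M \<longrightarrow> ?nil x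
      \<longrightarrow> (\<exists>k. \<forall>r\<in>ideal_power R \<aa> k. r \<odot>\<^bsub>M\<^esub> x = \<zero>\<^bsub>M\<^esub>)"
    show "\<forall>x. ?ann x = I \<longrightarrow> x \<in> carrier M \<longrightarrow> ?nil x \<longrightarrow> (\<exists>k. \<forall>r\<in>ideal_power R \<aa> k. r \<odot>\<^bsub>M\<^esub> x = \<zero>\<^bsub>M\<^esub>)"
    proof (intro allI impI)
      fix x assume I: "?ann x = I" and x: "x \<in> carrier M" and nil: "?nil x"
      have comm: "t \<odot>\<^bsub>M\<^esub> (s \<odot>\<^bsub>M\<^esub> x) = s \<odot>\<^bsub>M\<^esub> (t \<odot>\<^bsub>M\<^esub> x)" if "s \<in> carrier R" "t \<in> carrier R" for s t
        using that x by (metis R.m_comm smult_assoc1)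
      have ex: "\<exists>k. \<forall>r\<in>ideal_power R \<aa> k. r \<odot>\<^bsub>M\<^esub> (s \<odot>\<^bsub>M\<^esub> x) = \<zero>\<^bsub>M\<^esub>" if s: "s \<in> \<aa>" for s
      proof (cases "s \<odot>\<^bsub>M\<^esub> x = \<zero>\<^bsub>M\<^esub>")
        case True
        then show ?thesis by (intro exI[of _ 0]) simp
      next
        case False
        have sR: "s \<in> carrier R" using ac s by blast
        define i where "i = (LEAST i :: nat. s [^]\<^bsub>R\<^esub> i \<odot>\<^bsub>M\<^esub> x = \<zero>\<^bsub>M\<^esub>)"
        have i: "s [^]\<^bsub>R\<^esub> i \<odot>\<^bsub>M\<^esub> x = \<zero>\<^bsub>M\<^esub>" unfolding i_def using nil s by (metis (mono_tags) LeastI)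
        have "i \<noteq> 0" using i False x sR by (cases i) auto
        then obtain j where j: "i = Suc j" using not0_implies_Suc by blast
        have nj: "s [^]\<^bsub>R\<^esub> j \<odot>\<^bsub>M\<^esub> x \<noteq> \<zero>\<^bsub>M\<^esub>"
          using not_less_Least[of j "\<lambda>i :: nat. s [^]\<^bsub>R\<^esub> i \<odot>\<^bsub>M\<^esub> x = \<zero>\<^bsub>M\<^esub>"] j unfolding i_def by auto
        have "s [^]\<^bsub>R\<^esub> j \<odot>\<^bsub>M\<^esub> (s \<odot>\<^bsub>M\<^esub> x) = \<zero>\<^bsub>M\<^esub>" using i j sR x by (simp add: smult_assoc1)
        then have "s [^]\<^bsub>R\<^esub> j \<in> ?ann (s \<odot>\<^bsub>M\<^esub> x)" "s [^]\<^bsub>R\<^esub> j \<notin> I" using nj sR I by auto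
        moreover have "I \<subseteq> ?ann (s \<odot>\<^bsub>M\<^esub> x)" using I comm[OF sR] sR by auto
        ultimately have "I \<subset> ?ann (s \<odot>\<^bsub>M\<^esub> x)" by blast
        moreover have "?nil (s \<odot>\<^bsub>M\<^esub> x)"
        proof
          fix t assume t: "t \<in> \<aa>"
          then obtain i :: nat where "t [^]\<^bsub>R\<^esub> i \<odot>\<^bsub>M\<^esub> x = \<zero>\<^bsub>M\<^esub>" using nil by blast
          then show "\<exists>i :: nat. t [^]\<^bsub>R\<^esub> i \<odot>\<^bsub>M\<^esub> (s \<odot>\<^bsub>M\<^esub> x) = \<zero>\<^bsub>M\<^esub>"
            using comm[OF sR, of "t [^]\<^bsub>R\<^esub> i"] ac[OF t] sR by (intro exI[of _ i]) simp
        qed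
        ultimately show ?thesis
          using IH[OF annihilator_ideal[OF assms(2), of "s \<odot>\<^bsub>M\<^esub> x"]] sR x by simp
      qed
      then obtain \<kappa> where \<kappa>: "\<And>s r. s \<in> \<aa> \<Longrightarrow> r \<in> ideal_power R \<aa> (\<kappa> s) \<Longrightarrow> r \<odot>\<^bsub>M\<^esub> (s \<odot>\<^bsub>M\<^esub> x) = \<zero>\<^bsub>M\<^esub>"
        by metis
      obtain S where S: "S \<subseteq> carrier R" "finite S" "\<aa> = Idl\<^bsub>R\<^esub> S"
        using noetherian_ring.finetely_gen[OF assms(1,3)] by blast
      \<comment> \<open>The zero covers the case of an empty set of generators.\<close>
      define K where "K = Max (insert 0 (\<kappa> ` S))"
      let ?I = "{s \<in> carrier R. \<forall>r\<in>ideal_power R \<aa> K. r \<odot>\<^bsub>M\<^esub> (s \<odot>\<^bsub>M\<^esub> x) = \<zero>\<^bsub>M\<^esub>}"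
      have pc: "r \<in> carrier R" if "r \<in> ideal_power R \<aa> K" for r
        using ideal.Icarr[OF ideal_power_ideal[OF cr assms(3)] that] .
      have "ideal ?I R"
      proof (rule idealI'[OF cr])
        show "a \<otimes>\<^bsub>R\<^esub> b \<in> ?I" if ab: "a \<in> carrier R" "b \<in> ?I" for a b
        proof -
          have "r \<odot>\<^bsub>M\<^esub> ((a \<otimes>\<^bsub>R\<^esub> b) \<odot>\<^bsub>M\<^esub> x) = a \<odot>\<^bsub>M\<^esub> (r \<odot>\<^bsub>M\<^esub> (b \<odot>\<^bsub>M\<^esub> x))" if "r \<in> carrier R" for r
            using ab that x by (simp add: smult_assoc1[symmetric] R.m_ac)
          then show ?thesis using ab pc by auto
        qed
      qed (use x pc in \<open>auto simp: smult_l_distr smult_r_distr\<close>)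
      moreover have "S \<subseteq> ?I"
      proof
        fix s assume s: "s \<in> S"
        then have "s \<in> \<aa>" using S R.genideal_self by blast
        moreover have "\<kappa> s \<le> K" unfolding K_def using S(2) s by (intro Max_ge) auto
        ultimately show "s \<in> ?I" using \<kappa> ideal_power_mono[OF cr assms(3)] S(1) s by blast
      qed
      ultimately have "\<aa> \<subseteq> ?I" unfolding S(3) by (rule R.genideal_minimal)
      then have "\<forall>r\<in>ideal_power R \<aa> (Suc K). r \<odot>\<^bsub>M\<^esub> x = \<zero>\<^bsub>M\<^esub>"
        unfolding ideal_power_annihilates_Suc[OF assms(2,3) x] by blast
      then show "\<exists>k. \<forall>r\<in>ideal_power R \<aa> k. r \<odot>\<^bsub>M\<^esub> x = \<zero>\<^bsub>M\<^esub>" by blast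
    qed
  qed
  ultimately show "x \<in> carrier (torsion_part R \<aa> M)"
    using annihilator_ideal[OF assms(2)] by (auto simp: torsion_part_def)
qed

lemma torsion_eq_sub: "torsion_part R \<aa> M = sub M (carrier (torsion_part R \<aa> M))"
  by (simp add: torsion_part_def)

lemma nat_pow_annihilates_add:
  assumes "module R M" "x \<in> carrier M" "s \<in> carrier R" "s [^]\<^bsub>R\<^esub> (i :: nat) \<odot>\<^bsub>M\<^esub> x = \<zero>\<^bsub>M\<^esub>"
  shows "s [^]\<^bsub>R\<^esub> (i + j) \<odot>\<^bsub>M\<^esub> x = \<zero>\<^bsub>M\<^esub>" "s [^]\<^bsub>R\<^esub> (j + i) \<odot>\<^bsub>M\<^esub> x = \<zero>\<^bsub>M\<^esub>"
proof -
  interpret module R M by fact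
  have "s [^]\<^bsub>R\<^esub> (j + i) \<odot>\<^bsub>M\<^esub> x = s [^]\<^bsub>R\<^esub> j \<odot>\<^bsub>M\<^esub> (s [^]\<^bsub>R\<^esub> i \<odot>\<^bsub>M\<^esub> x)"
    using assms(2,3) by (simp add: R.nat_pow_mult[symmetric] smult_assoc1)
  then show "s [^]\<^bsub>R\<^esub> (j + i) \<odot>\<^bsub>M\<^esub> x = \<zero>\<^bsub>M\<^esub>" using assms(3,4) by simp
  then show "s [^]\<^bsub>R\<^esub> (i + j) \<odot>\<^bsub>M\<^esub> x = \<zero>\<^bsub>M\<^esub>" by (simp add: add.commute)
qed

lemma torsion_submodule:
  assumes "noetherian_ring R" "module R M" "ideal \<aa> R"
  shows "submodule (carrier (torsion_part R \<aa> M)) R M"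
proof (rule submoduleI'[OF assms(2)])
  interpret module R M by fact
  let ?T = "carrier (torsion_part R \<aa> M)"
  note tor = torsion_iff[OF assms]
  have ac: "s \<in> carrier R" if "s \<in> \<aa>" for s using ideal.Icarr[OF assms(3) that] .
  show "?T \<subseteq> carrier M" using tor by blast
  show "\<zero>\<^bsub>M\<^esub> \<in> ?T" unfolding tor using ac by auto
  show "x \<oplus>\<^bsub>M\<^esub> y \<in> ?T" if xy: "x \<in> ?T" "y \<in> ?T" for x y
  proof -
    have c: "x \<in> carrier M" "y \<in> carrier M" using xy tor by blast+
    have "\<exists>k :: nat. s [^]\<^bsub>R\<^esub> k \<odot>\<^bsub>M\<^esub> (x \<oplus>\<^bsub>M\<^esub> y) = \<zero>\<^bsub>M\<^esub>" if s: "s \<in> \<aa>" for s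
    proof -
      from xy tor s obtain i j :: nat where "s [^]\<^bsub>R\<^esub> i \<odot>\<^bsub>M\<^esub> x = \<zero>\<^bsub>M\<^esub>" "s [^]\<^bsub>R\<^esub> j \<odot>\<^bsub>M\<^esub> y = \<zero>\<^bsub>M\<^esub>" by blast
      then have "s [^]\<^bsub>R\<^esub> (i + j) \<odot>\<^bsub>M\<^esub> x = \<zero>\<^bsub>M\<^esub>" "s [^]\<^bsub>R\<^esub> (i + j) \<odot>\<^bsub>M\<^esub> y = \<zero>\<^bsub>M\<^esub>"
        using nat_pow_annihilates_add[OF assms(2) _ ac[OF s]] c by blast+
      then show ?thesis using c ac[OF s] by (intro exI[of _ "i + j"]) (simp add: smult_r_distr)
    qed
    then show ?thesis unfolding tor using c by simp
  qed
  show "r \<odot>\<^bsub>M\<^esub> x \<in> ?T" if r: "r \<in> carrier R" and x: "x \<in> ?T" for r x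
  proof -
    have c: "x \<in> carrier M" using x tor by blast
    have "\<exists>k :: nat. s [^]\<^bsub>R\<^esub> k \<odot>\<^bsub>M\<^esub> (r \<odot>\<^bsub>M\<^esub> x) = \<zero>\<^bsub>M\<^esub>" if s: "s \<in> \<aa>" for s
    proof -
      from x tor s obtain i :: nat where i: "s [^]\<^bsub>R\<^esub> i \<odot>\<^bsub>M\<^esub> x = \<zero>\<^bsub>M\<^esub>" by blast
      have "s [^]\<^bsub>R\<^esub> i \<odot>\<^bsub>M\<^esub> (r \<odot>\<^bsub>M\<^esub> x) = r \<odot>\<^bsub>M\<^esub> (s [^]\<^bsub>R\<^esub> i \<odot>\<^bsub>M\<^esub> x)"
        using ac[OF s] r c by (simp add: smult_assoc1[symmetric] R.m_comm)
      then show ?thesis using i r by auto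
    qed
    then show ?thesis unfolding tor using c r by simp
  qed
qed

lemma torsion_hom:
  assumes "noetherian_ring R" "module R M" "module R N" "ideal \<aa> R" "f \<in> mod_hom R M N"
    and "x \<in> carrier (torsion_part R \<aa> M)"
  shows "f x \<in> carrier (torsion_part R \<aa> N)"
proof -
  interpret R: cring R using module_cring[OF assms(2)] .
  have "s [^]\<^bsub>R\<^esub> i \<odot>\<^bsub>N\<^esub> f x = \<zero>\<^bsub>N\<^esub>"
    if "s \<in> \<aa>" "s [^]\<^bsub>R\<^esub> i \<odot>\<^bsub>M\<^esub> x = \<zero>\<^bsub>M\<^esub>" "x \<in> carrier M" for s and i :: nat
    using hom_smult[OF assms(5), of "s [^]\<^bsub>R\<^esub> i" x] that hom_zero[OF assms(2,3,5)]
      ideal.Icarr[OF assms(4)] by simp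
  then show ?thesis
    using assms(6) hom_closed[OF assms(5)] unfolding torsion_iff[OF assms(1,2,4)] torsion_iff[OF assms(1,3,4)]
    by blast
qed

text \<open>
  A map \<open>f\<close> from \<open>J\<close> to the torsion part is multiplication by some \<open>y\<close> in \<open>E\<close>; let \<open>K\<close> be its kernel. The
  element \<open>y\<close> need not be torsion, and it is replaced as follows. Choose an ideal \<open>L\<close> maximal with
  \<open>J \<inter> L = K\<close>. Then \<open>b + l \<mapsto> b y\<close> is well defined on \<open>J + L\<close>, and an extension of it to \<open>R\<close> gives a \<open>z\<close> that
  agrees with \<open>y\<close> on \<open>J\<close> and is killed by \<open>L\<close>. Every \<open>s\<close> in \<open>\<aa>\<close> has a power in \<open>L\<close>, so \<open>z\<close> is torsion. For
  this, let \<open>(L : s\<^sup>i)\<close> be the stable value of the chain. If \<open>c = l + r s\<^sup>i\<close> lies in \<open>J\<close>, then some \<open>s\<^sup>k c\<close> lies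
  in \<open>K\<close>, because \<open>f c\<close> is torsion; hence \<open>r s\<^bsup>i+k\<^esup>\<close> lies in \<open>L\<close>, so does \<open>r s\<^sup>i\<close>, and \<open>c\<close> lies in \<open>K\<close>. Maximality
  of \<open>L\<close> now yields \<open>s\<^sup>i \<in> L\<close>.
\<close>

lemma baer_torsion:
  assumes "noetherian_ring R" "baer R E" "ideal \<aa> R"
  shows "baer R (torsion_part R \<aa> E)"
proof -
  have mE: "module R E" by (rule baer_module[OF assms(2)])
  interpret module R E by fact
  have cr: "cring R" by (rule module_cring[OF mE])
  let ?T = "carrier (torsion_part R \<aa> E)"
  note tor = torsion_iff[OF assms(1) mE assms(3)]
  have sT: "submodule ?T R E" by (rule torsion_submodule[OF assms(1) mE assms(3)])
  have "baer R (sub E ?T)"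
  proof (rule baerI[OF submodule_module[OF mE sT]])
    fix J f assume J: "ideal J R" and f: "\<And>a. a \<in> J \<Longrightarrow> f a \<in> carrier (sub E ?T)"
      "\<And>a b. a \<in> J \<Longrightarrow> b \<in> J \<Longrightarrow> f (a \<oplus>\<^bsub>R\<^esub> b) = f a \<oplus>\<^bsub>sub E ?T\<^esub> f b"
      "\<And>r a. r \<in> carrier R \<Longrightarrow> a \<in> J \<Longrightarrow> f (r \<otimes>\<^bsub>R\<^esub> a) = r \<odot>\<^bsub>sub E ?T\<^esub> f a"
    interpret J: ideal J R by fact
    have fT: "f a \<in> ?T" if "a \<in> J" for a using f(1)[OF that] by simp
    obtain y where y: "y \<in> carrier E" "\<And>a. a \<in> J \<Longrightarrow> f a = a \<odot>\<^bsub>E\<^esub> y"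
      using assms(2) J by (rule baerD[where f = f]) (use f fT submodule_mem[OF sT] in auto)
    let ?K = "J \<inter> {r \<in> carrier R. r \<odot>\<^bsub>E\<^esub> y = \<zero>\<^bsub>E\<^esub>}"
    have K: "ideal ?K R" by (rule R.i_intersect[OF J annihilator_ideal[OF mE y(1)]])
    have "J \<inter> ?K = ?K" by blast
    from noetherian_maximal[OF assms(1) K, of "\<lambda>L. J \<inter> L = ?K", OF this]
    obtain L where L: "ideal L R" "J \<inter> L = ?K"
      and max: "\<forall>I. ideal I R \<and> J \<inter> I = ?K \<and> L \<subseteq> I \<longrightarrow> I = L" by blast
    interpret L: ideal L R by fact
    have KL: "?K \<subseteq> L" using L(2) by blast
    have pow: "\<exists>i :: nat. s [^]\<^bsub>R\<^esub> i \<in> L" if s: "s \<in> \<aa>" for s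
    proof -
      have sR: "s \<in> carrier R" using ideal.Icarr[OF assms(3) s] .
      let ?C = "\<lambda>i :: nat. {r \<in> carrier R. r \<otimes>\<^bsub>R\<^esub> s [^]\<^bsub>R\<^esub> i \<in> L}"
      have Ci: "ideal (?C i) R" for i using colon_ideal[OF cr L(1)] sR by simp
      have "\<exists>i. ?C 0 = ?C i" by blast
      from noetherian_maximal[OF assms(1) Ci, of "\<lambda>I. \<exists>i. I = ?C i", OF this]
      obtain i where i: "\<forall>I. ideal I R \<and> (\<exists>i. I = ?C i) \<and> ?C i \<subseteq> I \<longrightarrow> I = ?C i" by blast
      have mul: "r \<otimes>\<^bsub>R\<^esub> s [^]\<^bsub>R\<^esub> (i + k) = s [^]\<^bsub>R\<^esub> k \<otimes>\<^bsub>R\<^esub> (r \<otimes>\<^bsub>R\<^esub> s [^]\<^bsub>R\<^esub> i)" if "r \<in> carrier R" for r k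
        using sR that by (simp add: R.nat_pow_mult[symmetric] R.m_ac)
      have "?C i \<subseteq> ?C (i + k)" for k using L.I_l_closed sR by (auto simp: mul)
      then have stable: "?C (i + k) = ?C i" for k using i Ci by blast
      let ?L = "ideal_adjoin R L (s [^]\<^bsub>R\<^esub> i)"
      note A = ideal_adjoin[OF cr L(1), of "s [^]\<^bsub>R\<^esub> i", OF R.nat_pow_closed[OF sR]]
      have "J \<inter> ?L \<subseteq> ?K"
      proof
        fix c assume c: "c \<in> J \<inter> ?L"
        then obtain l r where lr: "l \<in> L" "r \<in> carrier R" "c = l \<oplus>\<^bsub>R\<^esub> r \<otimes>\<^bsub>R\<^esub> s [^]\<^bsub>R\<^esub> i"
          by (auto simp: ideal_adjoin_def)
        have cR: "c \<in> carrier R" and lR: "l \<in> carrier R" using c J.Icarr lr(1) L.Icarr by auto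
        obtain k :: nat where "s [^]\<^bsub>R\<^esub> k \<odot>\<^bsub>E\<^esub> f c = \<zero>\<^bsub>E\<^esub>" using fT[of c] c s tor by blast
        then have "(s [^]\<^bsub>R\<^esub> k \<otimes>\<^bsub>R\<^esub> c) \<odot>\<^bsub>E\<^esub> y = \<zero>\<^bsub>E\<^esub>" using y(2)[of c] c cR sR y(1) by (simp add: smult_assoc1)
        then have "s [^]\<^bsub>R\<^esub> k \<otimes>\<^bsub>R\<^esub> c \<in> ?K" using c cR sR J.I_l_closed by simp
        then have kc: "s [^]\<^bsub>R\<^esub> k \<otimes>\<^bsub>R\<^esub> c \<in> L" using KL by blast
        have kl: "s [^]\<^bsub>R\<^esub> k \<otimes>\<^bsub>R\<^esub> l \<in> L" using L.I_l_closed lr(1) sR by simp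
        have "s [^]\<^bsub>R\<^esub> k \<otimes>\<^bsub>R\<^esub> c = s [^]\<^bsub>R\<^esub> k \<otimes>\<^bsub>R\<^esub> l \<oplus>\<^bsub>R\<^esub> r \<otimes>\<^bsub>R\<^esub> s [^]\<^bsub>R\<^esub> (i + k)"
          unfolding lr(3) using lr(2) lR sR by (simp add: mul R.r_distr)
        then have "r \<otimes>\<^bsub>R\<^esub> s [^]\<^bsub>R\<^esub> (i + k) = \<ominus>\<^bsub>R\<^esub> (s [^]\<^bsub>R\<^esub> k \<otimes>\<^bsub>R\<^esub> l) \<oplus>\<^bsub>R\<^esub> s [^]\<^bsub>R\<^esub> k \<otimes>\<^bsub>R\<^esub> c"
          using lr(2) lR sR by (simp add: R.r_neg1)
        then have "r \<otimes>\<^bsub>R\<^esub> s [^]\<^bsub>R\<^esub> (i + k) \<in> L" using kc kl by simp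
        then have "r \<in> ?C i" using stable[of k] lr(2) by blast
        then have "c \<in> L" using lr by simp
        then show "c \<in> ?K" using c L(2) by blast
      qed
      moreover have "?K \<subseteq> J \<inter> ?L" using A(2) KL by blast
      ultimately have "?L = L" using max A(1,2) by blast
      then show ?thesis using A(3) by auto
    qed
    let ?G = "{(b \<oplus>\<^bsub>R\<^esub> l, b \<odot>\<^bsub>E\<^esub> y) | b l. b \<in> J \<and> l \<in> L}"
    have mem: "(b \<oplus>\<^bsub>R\<^esub> l, b \<odot>\<^bsub>E\<^esub> y) \<in> ?G" if "b \<in> J" "l \<in> L" for b l using that by blast
    have "linear_graph R (ring_module R) E ?G"
    proof (rule linear_graphI)
      show "(\<zero>\<^bsub>ring_module R\<^esub>, \<zero>\<^bsub>E\<^esub>) \<in> ?G" using mem[of "\<zero>\<^bsub>R\<^esub>" "\<zero>\<^bsub>R\<^esub>"] y(1) by simp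
    next
      fix x z x' z' assume "(x, z) \<in> ?G" "(x', z') \<in> ?G"
      then obtain b l b' l' where h: "b \<in> J" "l \<in> L" "b' \<in> J" "l' \<in> L"
        "x = b \<oplus>\<^bsub>R\<^esub> l" "z = b \<odot>\<^bsub>E\<^esub> y" "x' = b' \<oplus>\<^bsub>R\<^esub> l'" "z' = b' \<odot>\<^bsub>E\<^esub> y" by blast
      then have "x \<oplus>\<^bsub>R\<^esub> x' = (b \<oplus>\<^bsub>R\<^esub> b') \<oplus>\<^bsub>R\<^esub> (l \<oplus>\<^bsub>R\<^esub> l')" "z \<oplus>\<^bsub>E\<^esub> z' = (b \<oplus>\<^bsub>R\<^esub> b') \<odot>\<^bsub>E\<^esub> y"
        using J.Icarr L.Icarr y(1) by (simp_all add: R.a_ac M.a_ac smult_l_distr)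
      then show "(x \<oplus>\<^bsub>ring_module R\<^esub> x', z \<oplus>\<^bsub>E\<^esub> z') \<in> ?G"
        using mem[of "b \<oplus>\<^bsub>R\<^esub> b'" "l \<oplus>\<^bsub>R\<^esub> l'"] h by simp
    next
      fix r x z assume r: "r \<in> carrier R" and "(x, z) \<in> ?G"
      then obtain b l where h: "b \<in> J" "l \<in> L" "x = b \<oplus>\<^bsub>R\<^esub> l" "z = b \<odot>\<^bsub>E\<^esub> y" by blast
      then have "r \<otimes>\<^bsub>R\<^esub> x = r \<otimes>\<^bsub>R\<^esub> b \<oplus>\<^bsub>R\<^esub> r \<otimes>\<^bsub>R\<^esub> l" "r \<odot>\<^bsub>E\<^esub> z = (r \<otimes>\<^bsub>R\<^esub> b) \<odot>\<^bsub>E\<^esub> y"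
        using J.Icarr L.Icarr y(1) r by (simp_all add: R.r_distr smult_assoc1)
      then show "(r \<odot>\<^bsub>ring_module R\<^esub> x, r \<odot>\<^bsub>E\<^esub> z) \<in> ?G"
        using mem[OF J.I_l_closed[OF h(1) r] L.I_l_closed[OF h(2) r]] by simp
    next
      fix z assume "(\<zero>\<^bsub>ring_module R\<^esub>, z) \<in> ?G"
      then obtain b l where h: "b \<in> J" "l \<in> L" "\<zero>\<^bsub>R\<^esub> = b \<oplus>\<^bsub>R\<^esub> l" "z = b \<odot>\<^bsub>E\<^esub> y" by auto
      have "\<ominus>\<^bsub>R\<^esub> l = b" by (rule R.minus_equality) (use h J.Icarr L.Icarr in simp_all)
      then have "b \<in> J \<inter> L" using h L.a_inv_closed by blast
      then show "z = \<zero>\<^bsub>E\<^esub>" using L(2) h(4) by blast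
    next
      fix x z assume "(x, z) \<in> ?G"
      then show "x \<in> carrier (ring_module R)" "z \<in> carrier E" using J.Icarr L.Icarr y(1) by auto
    qed
    from baer_graph[OF assms(2) this] obtain z where
      z: "z \<in> carrier E" "\<And>r v. (r, v) \<in> ?G \<Longrightarrow> v = r \<odot>\<^bsub>E\<^esub> z" by blast
    have Lz: "l \<odot>\<^bsub>E\<^esub> z = \<zero>\<^bsub>E\<^esub>" if "l \<in> L" for l
      using z(2)[OF mem[OF J.zero_closed that]] L.Icarr[OF that] y(1) by simp
    have "f b = b \<odot>\<^bsub>E\<^esub> z" if "b \<in> J" for b
      using z(2)[OF mem[OF that L.zero_closed]] y(2)[OF that] J.Icarr[OF that] by simp
    moreover have "z \<in> ?T" unfolding tor using z(1) pow Lz by blast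
    ultimately show "\<exists>y\<in>carrier (sub E ?T). \<forall>a\<in>J. f a = a \<odot>\<^bsub>sub E ?T\<^esub> y" by auto
  qed
  then show ?thesis by (subst torsion_eq_sub)
qed

section \<open>Local rings\<close>

lemma local_ring_proper_ideal:
  assumes "local_ring R \<mm>" "noetherian_ring R" "ideal I R" "I \<noteq> carrier R"
  shows "I \<subseteq> \<mm>"
proof -
  have "I \<subseteq> I \<and> I \<noteq> carrier R" using assms(4) by blast
  from noetherian_maximal[OF assms(2,3), of "\<lambda>L. I \<subseteq> L \<and> L \<noteq> carrier R", OF this]
  obtain L where L: "ideal L R" "I \<subseteq> L" "L \<noteq> carrier R"
    "\<forall>K. ideal K R \<and> (I \<subseteq> K \<and> K \<noteq> carrier R) \<and> L \<subseteq> K \<longrightarrow> K = L" by auto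
  have "maximalideal L R"
  proof (rule maximalidealI[OF L(1)])
    show "carrier R \<noteq> L" using L(3) by simp
    show "J = L \<or> J = carrier R" if "ideal J R" "L \<subseteq> J" "J \<subseteq> carrier R" for J
      using L(2,4) that by blast
  qed
  then have "L = \<mm>" using assms(1) by (simp add: local_ring_def)
  with L(2) show ?thesis by simp
qed

lemma local_ring_one_minus_unit:
  assumes "local_ring R \<mm>" "noetherian_ring R" "x \<in> \<mm>"
  obtains u where "u \<in> carrier R" "u \<otimes>\<^bsub>R\<^esub> (\<one>\<^bsub>R\<^esub> \<ominus>\<^bsub>R\<^esub> x) = \<one>\<^bsub>R\<^esub>"
proof -
  have cr: "cring R" and mm: "maximalideal \<mm> R" using assms(1) by (auto simp: local_ring_def)
  interpret R: cring R by fact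
  interpret m: ideal \<mm> R by (rule maximalideal.axioms(1)[OF mm])
  have xR: "x \<in> carrier R" using m.Icarr assms(3) by blast
  let ?y = "\<one>\<^bsub>R\<^esub> \<ominus>\<^bsub>R\<^esub> x"
  have y: "?y \<in> carrier R" using xR by simp
  have id: "ideal (PIdl\<^bsub>R\<^esub> ?y) R" by (rule R.cgenideal_ideal[OF y])
  have yP: "?y \<in> PIdl\<^bsub>R\<^esub> ?y" by (rule R.cgenideal_self[OF y])
  have "PIdl\<^bsub>R\<^esub> ?y = carrier R"
  proof (rule ccontr)
    assume "PIdl\<^bsub>R\<^esub> ?y \<noteq> carrier R"
    from local_ring_proper_ideal[OF assms(1,2) id this] yP have "?y \<in> \<mm>" by blast
    then have "?y \<oplus>\<^bsub>R\<^esub> x \<in> \<mm>" using assms(3) by simp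
    moreover have "?y \<oplus>\<^bsub>R\<^esub> x = \<one>\<^bsub>R\<^esub>" using xR by (simp add: R.minus_eq R.a_assoc R.l_neg)
    ultimately have "\<mm> = carrier R" using m.one_imp_carrier by simp
    then show False using maximalideal.I_notcarr[OF mm] by simp
  qed
  then have "\<one>\<^bsub>R\<^esub> \<in> PIdl\<^bsub>R\<^esub> ?y" by simp
  then show thesis using that by (auto simp: cgenideal_def)
qed

section \<open>Chain conditions and Nakayama's lemma\<close>

text \<open>
  For submodules \<open>Y \<subseteq> X\<close> this says that the quotient \<open>X/Y\<close> is a Noetherian module.
\<close>

definition acc_between ::
  "('r, 'x) ring_scheme \<Rightarrow> ('r, 'a) module \<Rightarrow> 'a set \<Rightarrow> 'a set \<Rightarrow> bool" where
  "acc_between R M Y X \<longleftrightarrow>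
     (\<forall>Z :: nat \<Rightarrow> 'a set. (\<forall>k. submodule (Z k) R M \<and> Y \<subseteq> Z k \<and> Z k \<subseteq> X \<and> Z k \<subseteq> Z (Suc k))
        \<longrightarrow> (\<exists>N. \<forall>k\<ge>N. Z k = Z N))"

lemma acc_betweenD:
  assumes "acc_between R M Y X" "\<And>k. submodule (Z k) R M" "\<And>k. Y \<subseteq> Z k" "\<And>k. Z k \<subseteq> X"
    "\<And>k. Z k \<subseteq> Z (Suc k)"
  shows "\<exists>N. \<forall>k\<ge>N. Z k = Z N"
  using assms(1)[unfolded acc_between_def, rule_format, of Z] assms(2-5) by blast

lemma acc_between_mono:
  assumes "acc_between R M Y X" "Y \<subseteq> Y'" "X' \<subseteq> X" shows "acc_between R M Y' X'"
  unfolding acc_between_def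
proof (intro allI impI)
  fix Z :: "nat \<Rightarrow> _ set"
  assume Z: "\<forall>k. submodule (Z k) R M \<and> Y' \<subseteq> Z k \<and> Z k \<subseteq> X' \<and> Z k \<subseteq> Z (Suc k)"
  show "\<exists>N. \<forall>k\<ge>N. Z k = Z N"
    by (rule acc_betweenD[OF assms(1)]) (use Z assms(2,3) in blast)+
qed

lemma acc_between_trivial: "X \<subseteq> Y \<Longrightarrow> acc_between R M Y X"
  unfolding acc_between_def by (metis subset_antisym subset_trans)

text \<open>
  The pattern behind "\<open>A\<close> is Noetherian if a submodule and the quotient by it are": a chain becomes
  stationary as soon as two monotone images of it do, provided the two images together detect strict
  inclusions.
\<close>

lemma acc_between_reflect:
  fixes F :: "'a set \<Rightarrow> 'b set" and G :: "'a set \<Rightarrow> 'c set"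
  assumes "acc_between R M\<^sub>1 Y\<^sub>1 X\<^sub>1" "acc_between R M\<^sub>2 Y\<^sub>2 X\<^sub>2"
    and F: "\<And>Z. submodule Z R M \<Longrightarrow> Y \<subseteq> Z \<Longrightarrow> Z \<subseteq> X \<Longrightarrow> submodule (F Z) R M\<^sub>1 \<and> Y\<^sub>1 \<subseteq> F Z \<and> F Z \<subseteq> X\<^sub>1"
    and G: "\<And>Z. submodule Z R M \<Longrightarrow> Y \<subseteq> Z \<Longrightarrow> Z \<subseteq> X \<Longrightarrow> submodule (G Z) R M\<^sub>2 \<and> Y\<^sub>2 \<subseteq> G Z \<and> G Z \<subseteq> X\<^sub>2"
    and mono: "\<And>Z Z'. Z \<subseteq> Z' \<Longrightarrow> F Z \<subseteq> F Z'" "\<And>Z Z'. Z \<subseteq> Z' \<Longrightarrow> G Z \<subseteq> G Z'"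
    and reflect: "\<And>Z Z'. \<lbrakk>submodule Z R M; submodule Z' R M; Y \<subseteq> Z; Z \<subseteq> Z'; Z' \<subseteq> X; F Z = F Z'; G Z = G Z'\<rbrakk>
      \<Longrightarrow> Z' \<subseteq> Z"
  shows "acc_between R M Y X"
  unfolding acc_between_def
proof (intro allI impI)
  fix Z :: "nat \<Rightarrow> 'a set"
  assume Z': "\<forall>k. submodule (Z k) R M \<and> Y \<subseteq> Z k \<and> Z k \<subseteq> X \<and> Z k \<subseteq> Z (Suc k)"
  then have Z: "submodule (Z k) R M" "Y \<subseteq> Z k" "Z k \<subseteq> X" "Z k \<subseteq> Z (Suc k)" for k by blast+
  note FZ = F[OF Z(1-3)] and GZ = G[OF Z(1-3)]
  have "\<exists>N. \<forall>k\<ge>N. F (Z k) = F (Z N)"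
    by (rule acc_betweenD[OF assms(1)]) (use FZ mono(1)[OF Z(4)] in simp_all)
  then obtain N1 where N1: "\<And>k. k \<ge> N1 \<Longrightarrow> F (Z k) = F (Z N1)" by blast
  have "\<exists>N. \<forall>k\<ge>N. G (Z k) = G (Z N)"
    by (rule acc_betweenD[OF assms(2)]) (use GZ mono(2)[OF Z(4)] in simp_all)
  then obtain N2 where N2: "\<And>k. k \<ge> N2 \<Longrightarrow> G (Z k) = G (Z N2)" by blast
  let ?N = "max N1 N2"
  have "Z k = Z ?N" if "k \<ge> ?N" for k
  proof -
    have le: "Z ?N \<subseteq> Z k" using lift_Suc_mono_le[of Z, OF Z(4) that] .
    have "F (Z ?N) = F (Z k)" "G (Z ?N) = G (Z k)"
      using N1[of k] N1[of ?N] N2[of k] N2[of ?N] that by auto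
    from reflect[OF Z(1) Z(1) Z(2) le Z(3) this] le show ?thesis by blast
  qed
  then show "\<exists>N. \<forall>k\<ge>N. Z k = Z N" by blast
qed

lemma acc_between_maximal:
  assumes "acc_between R M Y X" "submodule Y R M" "Y \<subseteq> X" "Y \<noteq> X"
  obtains Z where "submodule Z R M" "Y \<subseteq> Z" "Z \<subset> X"
    "\<And>Z'. \<lbrakk>submodule Z' R M; Z \<subseteq> Z'; Z' \<subseteq> X\<rbrakk> \<Longrightarrow> Z' = Z \<or> Z' = X"
proof (rule ccontr)
  assume neg: "\<not> thesis"
  let ?P = "\<lambda>Z. submodule Z R M \<and> Y \<subseteq> Z \<and> Z \<subset> X"
  have "\<exists>Z. \<forall>k :: nat. ?P (Z k) \<and> Z k \<subset> Z (Suc k)"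
  proof (rule dependent_nat_choice)
    show "\<exists>Z. ?P Z" using assms(2-4) by blast
    fix Z and k :: nat assume Z: "?P Z"
    show "\<exists>Z'. ?P Z' \<and> Z \<subset> Z'"
    proof (rule ccontr)
      assume "\<not> (\<exists>Z'. ?P Z' \<and> Z \<subset> Z')"
      then have "Z' = Z \<or> Z' = X" if "submodule Z' R M" "Z \<subseteq> Z'" "Z' \<subseteq> X" for Z' using Z that by blast
      with Z that[of Z] neg show False by blast
    qed
  qed
  then obtain Z where "\<forall>k :: nat. ?P (Z k) \<and> Z k \<subset> Z (Suc k)" ..
  then have Z: "?P (Z k)" "Z k \<subset> Z (Suc k)" for k by blast+
  have "\<exists>N. \<forall>k\<ge>N. Z k = Z N"
    by (rule acc_betweenD[OF assms(1)]) (use Z in blast)+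
  then obtain N where N: "\<And>k. k \<ge> N \<Longrightarrow> Z k = Z N" by blast
  have "Z (Suc N) = Z N" by (rule N) simp
  with Z(2)[of N] show False by simp
qed

lemma submodule_sum:
  assumes "module R M" "submodule X R M" "submodule Y R M"
  shows "submodule {x \<oplus>\<^bsub>M\<^esub> y | x y. x \<in> X \<and> y \<in> Y} R M"
    "X \<subseteq> {x \<oplus>\<^bsub>M\<^esub> y | x y. x \<in> X \<and> y \<in> Y}" "Y \<subseteq> {x \<oplus>\<^bsub>M\<^esub> y | x y. x \<in> X \<and> y \<in> Y}"
proof -
  interpret module R M by fact
  note mX = submodule_mem[OF assms(2)] and mY = submodule_mem[OF assms(3)]
  let ?S = "{x \<oplus>\<^bsub>M\<^esub> y | x y. x \<in> X \<and> y \<in> Y}"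
  have mem: "x \<oplus>\<^bsub>M\<^esub> y \<in> ?S" if "x \<in> X" "y \<in> Y" for x y using that by blast
  show X: "X \<subseteq> ?S"
  proof
    fix x assume "x \<in> X" with mem[OF this submodule_zero[OF assms(3)]] mX show "x \<in> ?S" by simp
  qed
  show "Y \<subseteq> ?S"
  proof
    fix y assume "y \<in> Y" with mem[OF submodule_zero[OF assms(2)] this] mY show "y \<in> ?S" by simp
  qed
  show "submodule ?S R M"
  proof (rule submoduleI'[OF assms(1)])
    show "?S \<subseteq> carrier M" using mX mY by auto
    show "\<zero>\<^bsub>M\<^esub> \<in> ?S" using X submodule_zero[OF assms(2)] by blast
    show "a \<oplus>\<^bsub>M\<^esub> b \<in> ?S" if "a \<in> ?S" "b \<in> ?S" for a b
    proof -
      from that obtain x y x' y' where h: "x \<in> X" "y \<in> Y" "x' \<in> X" "y' \<in> Y" "a = x \<oplus>\<^bsub>M\<^esub> y" "b = x' \<oplus>\<^bsub>M\<^esub> y'" by blast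
      then have "a \<oplus>\<^bsub>M\<^esub> b = (x \<oplus>\<^bsub>M\<^esub> x') \<oplus>\<^bsub>M\<^esub> (y \<oplus>\<^bsub>M\<^esub> y')" using mX mY by (simp add: M.a_ac)
      then show ?thesis using mem[OF submodule_add[OF assms(2) h(1,3)] submodule_add[OF assms(3) h(2,4)]] by simp
    qed
    show "r \<odot>\<^bsub>M\<^esub> a \<in> ?S" if r: "r \<in> carrier R" and "a \<in> ?S" for r a
    proof -
      from that obtain x y where h: "x \<in> X" "y \<in> Y" "a = x \<oplus>\<^bsub>M\<^esub> y" by blast
      then have "r \<odot>\<^bsub>M\<^esub> a = r \<odot>\<^bsub>M\<^esub> x \<oplus>\<^bsub>M\<^esub> r \<odot>\<^bsub>M\<^esub> y" using mX mY r by (simp add: smult_r_distr)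
      then show ?thesis using mem[OF submodule_smult[OF assms(2) r h(1)] submodule_smult[OF assms(3) r h(2)]] by simp
    qed
  qed
qed

lemma hom_smult_map:
  assumes "module R M" "a \<in> carrier R" shows "(\<lambda>x. a \<odot>\<^bsub>M\<^esub> x) \<in> mod_hom R M M"
proof -
  interpret module R M by fact
  have "a \<odot>\<^bsub>M\<^esub> (r \<odot>\<^bsub>M\<^esub> x) = r \<odot>\<^bsub>M\<^esub> (a \<odot>\<^bsub>M\<^esub> x)" if "r \<in> carrier R" "x \<in> carrier M" for r x
    using that assms(2) by (simp add: smult_assoc1[symmetric] R.m_comm)
  then show ?thesis using assms(2) by (intro mod_homI) (simp_all add: smult_r_distr)
qed

lemma submodule_multiples:
  fixes M :: "('r, 'a) module"
  assumes "module R M" "w \<in> carrier M" shows "submodule ((\<lambda>r. r \<odot>\<^bsub>M\<^esub> w) ` carrier R) R M"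
proof -
  interpret module R M by fact
  have "(\<lambda>r. r \<odot>\<^bsub>M\<^esub> w) \<in> mod_hom R (ring_module R) M"
    using assms(2) by (intro mod_homI) (simp_all add: smult_l_distr smult_assoc1)
  from submodule_image[OF ring_module[OF module_cring[OF assms(1)]] assms(1) this
      submodule_carrier[OF ring_module[OF module_cring[OF assms(1)]]]]
  show ?thesis by simp
qed

text \<open>
  If \<open>X \<noteq> Y\<close>, the chain condition gives a maximal proper submodule \<open>Z\<close> of \<open>X\<close> above \<open>Y\<close>. Pick \<open>w\<close> in \<open>X\<close>
  outside \<open>Z\<close> and write \<open>w = x v\<close> with \<open>v = z + r w\<close>, \<open>z\<close> in \<open>Z\<close>. Then \<open>(1 - r x) w\<close> lies in \<open>Z\<close>, and \<open>1 - r x\<close>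
  is a unit.
\<close>

lemma nakayama_acc:
  assumes "local_ring R \<mm>" "noetherian_ring R" "module R M" "x \<in> \<mm>"
    "acc_between R M Y X" "submodule X R M" "submodule Y R M" "Y \<subseteq> X"
    and div: "\<And>u. u \<in> X \<Longrightarrow> \<exists>v\<in>X. u = x \<odot>\<^bsub>M\<^esub> v"
  shows "X = Y"
proof (rule ccontr)
  assume "X \<noteq> Y"
  interpret module R M by fact
  have mm: "ideal \<mm> R" using assms(1) by (simp add: local_ring_def maximalideal.axioms(1))
  have xR: "x \<in> carrier R" by (rule ideal.Icarr[OF mm assms(4)])
  from \<open>X \<noteq> Y\<close> obtain Z where Z: "submodule Z R M" "Y \<subseteq> Z" "Z \<subset> X"
    "\<And>Z'. \<lbrakk>submodule Z' R M; Z \<subseteq> Z'; Z' \<subseteq> X\<rbrakk> \<Longrightarrow> Z' = Z \<or> Z' = X"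
    using acc_between_maximal[OF assms(5,7,8)] by blast
  then obtain w where w: "w \<in> X" "w \<notin> Z" by blast
  have wM: "w \<in> carrier M" using submodule_mem[OF assms(6) w(1)] .
  let ?W = "(\<lambda>r. r \<odot>\<^bsub>M\<^esub> w) ` carrier R"
  let ?S = "{z \<oplus>\<^bsub>M\<^esub> y | z y. z \<in> Z \<and> y \<in> ?W}"
  note S = submodule_sum[OF assms(3) Z(1) submodule_multiples[OF assms(3) wM]]
  have "?S \<subseteq> X" using Z(3) w(1) submodule_add[OF assms(6)] submodule_smult[OF assms(6)] by blast
  moreover have "w \<in> ?W" using wM by (intro image_eqI[of _ _ "\<one>\<^bsub>R\<^esub>"]) simp_all
  then have "w \<in> ?S" using S(3) by blast
  ultimately have "?S = X" using Z(4)[OF S(1,2)] w(2) by blast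
  moreover obtain v where v: "v \<in> X" "w = x \<odot>\<^bsub>M\<^esub> v" using div[OF w(1)] by blast
  ultimately have "v \<in> ?S" by simp
  then obtain z r where zr: "z \<in> Z" "r \<in> carrier R" "v = z \<oplus>\<^bsub>M\<^esub> r \<odot>\<^bsub>M\<^esub> w" by blast
  have zM: "z \<in> carrier M" using submodule_mem[OF Z(1) zr(1)] .
  have rx: "r \<otimes>\<^bsub>R\<^esub> x \<in> \<mm>" using ideal.I_l_closed[OF mm assms(4) zr(2)] .
  obtain u where u: "u \<in> carrier R" "u \<otimes>\<^bsub>R\<^esub> (\<one>\<^bsub>R\<^esub> \<ominus>\<^bsub>R\<^esub> r \<otimes>\<^bsub>R\<^esub> x) = \<one>\<^bsub>R\<^esub>"
    using local_ring_one_minus_unit[OF assms(1,2) rx] by blast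
  have "w = x \<odot>\<^bsub>M\<^esub> z \<oplus>\<^bsub>M\<^esub> (r \<otimes>\<^bsub>R\<^esub> x) \<odot>\<^bsub>M\<^esub> w"
    using v(2) zr zM wM xR by (simp add: smult_r_distr smult_assoc1[symmetric] R.m_comm)
  then have "(r \<otimes>\<^bsub>R\<^esub> x) \<odot>\<^bsub>M\<^esub> w \<oplus>\<^bsub>M\<^esub> x \<odot>\<^bsub>M\<^esub> z = w"
    using zM wM xR zr(2) by (simp add: M.a_comm)
  then have xz: "x \<odot>\<^bsub>M\<^esub> z = w \<ominus>\<^bsub>M\<^esub> (r \<otimes>\<^bsub>R\<^esub> x) \<odot>\<^bsub>M\<^esub> w"
    using zM wM xR zr(2) by (subst (asm) add_eq_iff_diff) auto
  have "(\<one>\<^bsub>R\<^esub> \<ominus>\<^bsub>R\<^esub> r \<otimes>\<^bsub>R\<^esub> x) \<odot>\<^bsub>M\<^esub> w = x \<odot>\<^bsub>M\<^esub> z"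
    unfolding xz using wM xR zr(2) by (simp add: R.minus_eq M.minus_eq smult_l_distr smult_l_minus)
  then have "(\<one>\<^bsub>R\<^esub> \<ominus>\<^bsub>R\<^esub> r \<otimes>\<^bsub>R\<^esub> x) \<odot>\<^bsub>M\<^esub> w \<in> Z" using submodule_smult[OF Z(1) xR zr(1)] by simp
  then have "u \<odot>\<^bsub>M\<^esub> ((\<one>\<^bsub>R\<^esub> \<ominus>\<^bsub>R\<^esub> r \<otimes>\<^bsub>R\<^esub> x) \<odot>\<^bsub>M\<^esub> w) \<in> Z" by (rule submodule_smult[OF Z(1) u(1)])
  moreover have "u \<odot>\<^bsub>M\<^esub> ((\<one>\<^bsub>R\<^esub> \<ominus>\<^bsub>R\<^esub> r \<otimes>\<^bsub>R\<^esub> x) \<odot>\<^bsub>M\<^esub> w) = w"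
    using u wM xR zr(2) by (simp add: smult_assoc1[symmetric])
  ultimately show False using w(2) by simp
qed

lemma acc_ring:
  assumes "noetherian_ring R" "cring R"
  shows "acc_between R (ring_module R) {\<zero>\<^bsub>R\<^esub>} (carrier R)"
  unfolding acc_between_def
proof (intro allI impI)
  fix Z :: "nat \<Rightarrow> _ set"
  assume Z': "\<forall>k. submodule (Z k) R (ring_module R) \<and> {\<zero>\<^bsub>R\<^esub>} \<subseteq> Z k \<and> Z k \<subseteq> carrier R \<and> Z k \<subseteq> Z (Suc k)"
  have id: "ideal (Z k) R" for k
    using Z'[rule_format, of k] submodule_add[of "Z k" R "ring_module R"] submodule_smult[of "Z k" R "ring_module R"]
    by (intro idealI'[OF assms(2)]) auto
  have mono: "Z k \<subseteq> Z l" if "k \<le> l" for k l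
    by (rule lift_Suc_mono_le[OF _ that]) (use Z' in blast)
  then have "subset.chain {I. ideal I R} (range Z)"
    using id by (auto simp: subset_chain_def) (metis nat_le_linear subsetD)
  from noetherian_ring.ideal_chain_is_trivial[OF assms(1) _ this] obtain N where "\<Union>(range Z) = Z N" by auto
  then have "Z k = Z N" if "k \<ge> N" for k using mono[OF that] by blast
  then show "\<exists>N. \<forall>k\<ge>N. Z k = Z N" by blast
qed

text \<open>
  Induction on the number of generators: a chain in the span of \<open>S \<union> {s}\<close> is controlled by its traces on
  the span of \<open>S\<close> and by the ideals of coefficients of \<open>s\<close>.
\<close>

lemma acc_finitely_generated:
  fixes M :: "('r, 'a) module"
  assumes "noetherian_ring R" "module R M" "finitely_generated_module R M"
  shows "acc_between R M {\<zero>\<^bsub>M\<^esub>} (carrier M)"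
proof -
  interpret module R M by fact
  let ?span = "\<lambda>S. {(\<Oplus>\<^bsub>M\<^esub>s\<in>S. c s \<odot>\<^bsub>M\<^esub> s) | c. c \<in> S \<rightarrow> carrier R}"
  have cl: "(\<lambda>s. c s \<odot>\<^bsub>M\<^esub> s) \<in> S \<rightarrow> carrier M" if "S \<subseteq> carrier M" "c \<in> S \<rightarrow> carrier R" for c S
    using that by auto
  have sub: "submodule (?span S) R M" if S: "finite S" "S \<subseteq> carrier M" for S
  proof (rule submoduleI'[OF assms(2)])
    show "?span S \<subseteq> carrier M" using cl[OF S(2)] by auto
    have "(\<Oplus>\<^bsub>M\<^esub>s\<in>S. \<zero>\<^bsub>R\<^esub> \<odot>\<^bsub>M\<^esub> s) = (\<Oplus>\<^bsub>M\<^esub>s\<in>S. \<zero>\<^bsub>M\<^esub>)" using S(2) by (intro M.finsum_cong') auto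
    then show "\<zero>\<^bsub>M\<^esub> \<in> ?span S" by (intro CollectI exI[of _ "\<lambda>_. \<zero>\<^bsub>R\<^esub>"]) (auto simp: M.finsum_zero)
    show "a \<oplus>\<^bsub>M\<^esub> b \<in> ?span S" if "a \<in> ?span S" "b \<in> ?span S" for a b
    proof -
      from that obtain c d where h: "c \<in> S \<rightarrow> carrier R" "d \<in> S \<rightarrow> carrier R"
        "a = (\<Oplus>\<^bsub>M\<^esub>s\<in>S. c s \<odot>\<^bsub>M\<^esub> s)" "b = (\<Oplus>\<^bsub>M\<^esub>s\<in>S. d s \<odot>\<^bsub>M\<^esub> s)" by blast
      have "a \<oplus>\<^bsub>M\<^esub> b = (\<Oplus>\<^bsub>M\<^esub>s\<in>S. c s \<odot>\<^bsub>M\<^esub> s \<oplus>\<^bsub>M\<^esub> d s \<odot>\<^bsub>M\<^esub> s)"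
        unfolding h using cl[OF S(2)] h(1,2) by (intro M.finsum_addf[symmetric]) auto
      also have "\<dots> = (\<Oplus>\<^bsub>M\<^esub>s\<in>S. (c s \<oplus>\<^bsub>R\<^esub> d s) \<odot>\<^bsub>M\<^esub> s)"
        using h(1,2) S(2) by (intro M.finsum_cong') (auto simp: smult_l_distr Pi_iff subset_iff)
      finally show ?thesis using h(1,2) by (intro CollectI exI[of _ "\<lambda>s. c s \<oplus>\<^bsub>R\<^esub> d s"]) auto
    qed
    show "r \<odot>\<^bsub>M\<^esub> a \<in> ?span S" if "r \<in> carrier R" "a \<in> ?span S" for r a
    proof -
      from that obtain c where h: "c \<in> S \<rightarrow> carrier R" "a = (\<Oplus>\<^bsub>M\<^esub>s\<in>S. c s \<odot>\<^bsub>M\<^esub> s)" by blast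
      have "r \<odot>\<^bsub>M\<^esub> a = (\<Oplus>\<^bsub>M\<^esub>s\<in>S. r \<odot>\<^bsub>M\<^esub> (c s \<odot>\<^bsub>M\<^esub> s))"
        unfolding h using cl[OF S(2) h(1)] S(1) that(1) by (intro finsum_smult_ldistr) auto
      also have "\<dots> = (\<Oplus>\<^bsub>M\<^esub>s\<in>S. (r \<otimes>\<^bsub>R\<^esub> c s) \<odot>\<^bsub>M\<^esub> s)"
        using h(1) S(2) that(1) by (intro M.finsum_cong') (auto simp: smult_assoc1 Pi_iff subset_iff)
      finally show ?thesis using h(1) that(1) by (intro CollectI exI[of _ "\<lambda>s. r \<otimes>\<^bsub>R\<^esub> c s"]) auto
    qed
  qed
  have acc: "acc_between R M {\<zero>\<^bsub>M\<^esub>} (?span S)" if "finite S" "S \<subseteq> carrier M" for S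
    using that
  proof (induction S)
    case empty
    have "?span {} \<subseteq> {\<zero>\<^bsub>M\<^esub>}" by auto
    then show ?case by (rule acc_between_trivial)
  next
    case (insert s S)
    then have S: "S \<subseteq> carrier M" "s \<in> carrier M" "finite S" by auto
    have split: "\<exists>r\<in>carrier R. \<exists>x\<in>?span S. u = r \<odot>\<^bsub>M\<^esub> s \<oplus>\<^bsub>M\<^esub> x" if "u \<in> ?span (insert s S)" for u
    proof -
      from that obtain c where c: "c \<in> insert s S \<rightarrow> carrier R" "u = (\<Oplus>\<^bsub>M\<^esub>s\<in>insert s S. c s \<odot>\<^bsub>M\<^esub> s)" by blast
      then have "u = c s \<odot>\<^bsub>M\<^esub> s \<oplus>\<^bsub>M\<^esub> (\<Oplus>\<^bsub>M\<^esub>s\<in>S. c s \<odot>\<^bsub>M\<^esub> s)"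
        using cl[OF S(1), of c] S insert(2) by (simp add: M.finsum_insert)
      then show ?thesis using c(1) by (intro bexI[of _ "c s"] bexI[of _ "\<Oplus>\<^bsub>M\<^esub>s\<in>S. c s \<odot>\<^bsub>M\<^esub> s"]) auto
    qed
    define X where "X = ?span S"
    define X' where "X' = ?span (insert s S)"
    have split': "\<exists>r\<in>carrier R. \<exists>x\<in>X. u = r \<odot>\<^bsub>M\<^esub> s \<oplus>\<^bsub>M\<^esub> x" if "u \<in> X'" for u
      using split that unfolding X_def X'_def .
    have sX: "submodule X R M" unfolding X_def by (rule sub[OF S(3,1)])
    note mX = submodule_mem[OF sX]
    let ?F = "\<lambda>Z. Z \<inter> X" and ?G = "\<lambda>Z. {r \<in> carrier R. \<exists>x\<in>X. r \<odot>\<^bsub>M\<^esub> s \<oplus>\<^bsub>M\<^esub> x \<in> Z}"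
    have acc1: "acc_between R M {\<zero>\<^bsub>M\<^esub>} X" unfolding X_def using insert by simp
    have acc2: "acc_between R (ring_module R) {\<zero>\<^bsub>R\<^esub>} (carrier R)"
      by (rule acc_ring[OF assms(1) module_cring[OF assms(2)]])
    have "acc_between R M {\<zero>\<^bsub>M\<^esub>} X'"
    proof (rule acc_between_reflect[OF acc1 acc2, where F = ?F and G = ?G])
      fix Z assume Z: "submodule Z R M" "{\<zero>\<^bsub>M\<^esub>} \<subseteq> Z" "Z \<subseteq> X'"
      show "submodule (?F Z) R M \<and> {\<zero>\<^bsub>M\<^esub>} \<subseteq> ?F Z \<and> ?F Z \<subseteq> X"
        using submodule_Int[OF assms(2) Z(1) sX] submodule_zero[OF Z(1)] submodule_zero[OF sX] by blast
      note mZ = submodule_mem[OF Z(1)]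
      have G0: "\<zero>\<^bsub>R\<^esub> \<in> ?G Z" using submodule_zero[OF Z(1)] submodule_zero[OF sX] S(2)
        by (intro CollectI conjI bexI[of _ "\<zero>\<^bsub>M\<^esub>"]) simp_all
      have "submodule (?G Z) R (ring_module R)"
      proof (rule submoduleI'[OF ring_module[OF module_cring[OF assms(2)]]])
        fix a b assume "a \<in> ?G Z" "b \<in> ?G Z"
        then obtain x y where h: "a \<in> carrier R" "b \<in> carrier R" "x \<in> X" "y \<in> X"
          "a \<odot>\<^bsub>M\<^esub> s \<oplus>\<^bsub>M\<^esub> x \<in> Z" "b \<odot>\<^bsub>M\<^esub> s \<oplus>\<^bsub>M\<^esub> y \<in> Z" by blast
        have "(a \<oplus>\<^bsub>R\<^esub> b) \<odot>\<^bsub>M\<^esub> s \<oplus>\<^bsub>M\<^esub> (x \<oplus>\<^bsub>M\<^esub> y) = (a \<odot>\<^bsub>M\<^esub> s \<oplus>\<^bsub>M\<^esub> x) \<oplus>\<^bsub>M\<^esub> (b \<odot>\<^bsub>M\<^esub> s \<oplus>\<^bsub>M\<^esub> y)"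
          using h(1,2) mX[OF h(3)] mX[OF h(4)] S(2) by (simp add: smult_l_distr M.a_ac)
        then have "(a \<oplus>\<^bsub>R\<^esub> b) \<odot>\<^bsub>M\<^esub> s \<oplus>\<^bsub>M\<^esub> (x \<oplus>\<^bsub>M\<^esub> y) \<in> Z" using submodule_add[OF Z(1) h(5,6)] by simp
        moreover have "x \<oplus>\<^bsub>M\<^esub> y \<in> X" by (rule submodule_add[OF sX h(3,4)])
        ultimately show "a \<oplus>\<^bsub>ring_module R\<^esub> b \<in> ?G Z" using h(1,2) by (simp only: ring_module_simps) blast
      next
        fix r a assume r: "r \<in> carrier R" and "a \<in> ?G Z"
        then obtain x where h: "a \<in> carrier R" "x \<in> X" "a \<odot>\<^bsub>M\<^esub> s \<oplus>\<^bsub>M\<^esub> x \<in> Z" by blast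
        have "(r \<otimes>\<^bsub>R\<^esub> a) \<odot>\<^bsub>M\<^esub> s \<oplus>\<^bsub>M\<^esub> r \<odot>\<^bsub>M\<^esub> x = r \<odot>\<^bsub>M\<^esub> (a \<odot>\<^bsub>M\<^esub> s \<oplus>\<^bsub>M\<^esub> x)"
          using h(1) r mX[OF h(2)] S(2) by (simp add: smult_assoc1 smult_r_distr)
        then have "(r \<otimes>\<^bsub>R\<^esub> a) \<odot>\<^bsub>M\<^esub> s \<oplus>\<^bsub>M\<^esub> r \<odot>\<^bsub>M\<^esub> x \<in> Z" using submodule_smult[OF Z(1) r h(3)] by simp
        moreover have "r \<odot>\<^bsub>M\<^esub> x \<in> X" by (rule submodule_smult[OF sX r h(2)])
        ultimately show "r \<odot>\<^bsub>ring_module R\<^esub> a \<in> ?G Z" using h(1) r R.m_closed by (simp only: ring_module_simps) blast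
      qed (use G0 in auto)
      then show "submodule (?G Z) R (ring_module R) \<and> {\<zero>\<^bsub>R\<^esub>} \<subseteq> ?G Z \<and> ?G Z \<subseteq> carrier R" using G0 by blast
    next
      fix Z Z' assume Z: "submodule Z R M" "submodule Z' R M" "Z \<subseteq> Z'" "Z' \<subseteq> X'"
        "?F Z = ?F Z'" "?G Z = ?G Z'"
      show "Z' \<subseteq> Z"
      proof
        fix u assume u: "u \<in> Z'"
        then obtain r x where rx: "r \<in> carrier R" "x \<in> X" "u = r \<odot>\<^bsub>M\<^esub> s \<oplus>\<^bsub>M\<^esub> x" using split' Z(4) by blast
        then have "r \<in> ?G Z'" using u by blast
        then obtain y where y: "y \<in> X" "r \<odot>\<^bsub>M\<^esub> s \<oplus>\<^bsub>M\<^esub> y \<in> Z" unfolding Z(6)[symmetric] by blast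
        let ?z = "r \<odot>\<^bsub>M\<^esub> s \<oplus>\<^bsub>M\<^esub> y"
        have zM: "?z \<in> carrier M" "u \<in> carrier M" using submodule_mem[OF Z(1) y(2)] submodule_mem[OF Z(2) u] .
        have "u \<ominus>\<^bsub>M\<^esub> ?z = x \<ominus>\<^bsub>M\<^esub> y"
          unfolding rx(3) using rx(1) mX[OF rx(2)] mX[OF y(1)] S(2)
          by (simp add: M.minus_eq M.minus_add M.a_ac M.r_neg2 M.r_neg1) (simp add: M.r_neg)
        then have "u \<ominus>\<^bsub>M\<^esub> ?z \<in> X" using submodule_diff[OF assms(2) sX rx(2) y(1)] by simp
        moreover have "u \<ominus>\<^bsub>M\<^esub> ?z \<in> Z'" by (rule submodule_diff[OF assms(2) Z(2) u]) (use y(2) Z(3) in blast)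
        ultimately have "u \<ominus>\<^bsub>M\<^esub> ?z \<in> Z" using Z(5) by blast
        then have "?z \<oplus>\<^bsub>M\<^esub> (u \<ominus>\<^bsub>M\<^esub> ?z) \<in> Z" by (rule submodule_add[OF Z(1) y(2)])
        then show "u \<in> Z" using zM by simp
      qed
    next
      fix Z Z' :: "'a set" assume "Z \<subseteq> Z'"
      then show "?F Z \<subseteq> ?F Z'" "?G Z \<subseteq> ?G Z'" by blast+
    qed
    then show ?case unfolding X'_def .
  qed
  obtain S where S: "finite S" "S \<subseteq> carrier M"
    "\<forall>x\<in>carrier M. \<exists>c\<in>S \<rightarrow> carrier R. x = (\<Oplus>\<^bsub>M\<^esub>s\<in>S. c s \<odot>\<^bsub>M\<^esub> s)"
    using assms(3) unfolding finitely_generated_module_def by blast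
  have "carrier M \<subseteq> ?span S" using S(3) by blast
  with acc[OF S(1,2)] show ?thesis using acc_between_mono by blast
qed

section \<open>Vanishing of Ext for cyclic modules\<close>

definition annihilated :: "('r, 'a) module \<Rightarrow> 'r set \<Rightarrow> 'a set" where
  "annihilated M I = {x \<in> carrier M. \<forall>r\<in>I. r \<odot>\<^bsub>M\<^esub> x = \<zero>\<^bsub>M\<^esub>}"

lemma annihilated_iff: "x \<in> annihilated M I \<longleftrightarrow> x \<in> carrier M \<and> (\<forall>r\<in>I. r \<odot>\<^bsub>M\<^esub> x = \<zero>\<^bsub>M\<^esub>)"
  by (simp add: annihilated_def)

lemma annihilated_antimono: "I \<subseteq> I' \<Longrightarrow> annihilated M I' \<subseteq> annihilated M I"
  unfolding annihilated_def by blast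

lemma submodule_annihilated:
  assumes "module R M" "ideal I R" shows "submodule (annihilated M I) R M"
proof (rule submoduleI'[OF assms(1)])
  interpret module R M by fact
  have I: "r \<in> carrier R" if "r \<in> I" for r using ideal.Icarr[OF assms(2) that] .
  show "annihilated M I \<subseteq> carrier M" by (auto simp: annihilated_iff)
  show "\<zero>\<^bsub>M\<^esub> \<in> annihilated M I" using I by (simp add: annihilated_iff)
  show "x \<oplus>\<^bsub>M\<^esub> y \<in> annihilated M I" if "x \<in> annihilated M I" "y \<in> annihilated M I" for x y
    using that I by (simp add: annihilated_iff smult_r_distr)
  show "s \<odot>\<^bsub>M\<^esub> x \<in> annihilated M I" if s: "s \<in> carrier R" and x: "x \<in> annihilated M I" for s x
  proof -
    have xM: "x \<in> carrier M" using x by (simp add: annihilated_iff)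
    have "r \<odot>\<^bsub>M\<^esub> (s \<odot>\<^bsub>M\<^esub> x) = s \<odot>\<^bsub>M\<^esub> (r \<odot>\<^bsub>M\<^esub> x)" if "r \<in> I" for r
      using I[OF that] s xM by (simp add: smult_assoc1[symmetric] R.m_comm)
    then show ?thesis using x s xM by (simp add: annihilated_iff)
  qed
qed

lemma hom_annihilated:
  assumes "module R M" "module R N" "f \<in> mod_hom R M N" "ideal I R" "x \<in> annihilated M I"
  shows "f x \<in> annihilated N I"
proof -
  have xM: "x \<in> carrier M" using assms(5) by (simp add: annihilated_iff)
  have "r \<odot>\<^bsub>N\<^esub> f x = \<zero>\<^bsub>N\<^esub>" if "r \<in> I" for r
    using hom_smult[OF assms(3) ideal.Icarr[OF assms(4) that] xM] assms(5) that hom_zero[OF assms(1-3)]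
    by (simp add: annihilated_iff)
  then show ?thesis using hom_closed[OF assms(3) xM] by (simp add: annihilated_iff)
qed

text \<open>
  A homomorphism \<open>R/I \<rightarrow> X\<close> is an element of \<open>X\<close> killed by \<open>I\<close>. Hence, if \<open>E\<close> is an injective resolution of
  \<open>M\<close>, the group \<open>Ext\<^sup>i(R/I, M)\<close> is the quotient of \<open>ext_cocycles E \<delta> i I\<close> by \<open>ext_coboundaries E \<delta> i I\<close>.
\<close>

definition ext_cocycles ::
  "(nat \<Rightarrow> ('r, 'e) module) \<Rightarrow> (nat \<Rightarrow> 'e \<Rightarrow> 'e) \<Rightarrow> nat \<Rightarrow> 'r set \<Rightarrow> 'e set" where
  "ext_cocycles E \<delta> i I = cocycles E \<delta> i \<inter> annihilated (E i) I"

definition ext_coboundaries ::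
  "(nat \<Rightarrow> ('r, 'e) module) \<Rightarrow> (nat \<Rightarrow> 'e \<Rightarrow> 'e) \<Rightarrow> nat \<Rightarrow> 'r set \<Rightarrow> 'e set" where
  "ext_coboundaries E \<delta> i I =
     (case i of 0 \<Rightarrow> {\<zero>\<^bsub>E 0\<^esub>} | Suc j \<Rightarrow> \<delta> j ` annihilated (E j) I)"

lemma ext_coboundaries_simps [simp]:
  "ext_coboundaries E \<delta> 0 I = {\<zero>\<^bsub>E 0\<^esub>}"
  "ext_coboundaries E \<delta> (Suc j) I = \<delta> j ` annihilated (E j) I"
  by (simp_all add: ext_coboundaries_def)

lemma ext_coboundaries_antimono:
  "I \<subseteq> I' \<Longrightarrow> ext_coboundaries E \<delta> i I' \<subseteq> ext_coboundaries E \<delta> i I"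
  by (cases i) (simp_all add: image_mono annihilated_antimono)

lemma ext_cocycles_antimono:
  "I \<subseteq> I' \<Longrightarrow> ext_cocycles E \<delta> i I' \<subseteq> ext_cocycles E \<delta> i I"
  unfolding ext_cocycles_def by (intro Int_mono annihilated_antimono subset_refl)

context
  fixes R :: "('r, 'x) ring_scheme" and E :: "nat \<Rightarrow> ('r, 'e) module" and \<delta>
  assumes E: "exact_baer R E \<delta>"
begin

lemma submodule_ext_cocycles: "ideal I R \<Longrightarrow> submodule (ext_cocycles E \<delta> i I) R (E i)"
  unfolding ext_cocycles_def
  by (intro submodule_Int submodule_cocycles submodule_annihilated exact_baerD[OF E] E)

lemma submodule_ext_coboundaries: "ideal I R \<Longrightarrow> submodule (ext_coboundaries E \<delta> i I) R (E i)"
  by (cases i)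
     (auto intro!: submodule_singleton_zero submodule_image[of R "E _"] submodule_annihilated
        exact_baerD[OF E])

lemma ext_coboundaries_subset:
  assumes "ideal I R" shows "ext_coboundaries E \<delta> i I \<subseteq> ext_cocycles E \<delta> i I"
proof (cases i)
  case 0
  then show ?thesis using submodule_zero[OF submodule_ext_cocycles[OF assms, of 0]] by simp
next
  case (Suc j)
  have "\<delta> j x \<in> ext_cocycles E \<delta> (Suc j) I" if x: "x \<in> annihilated (E j) I" for x
    using hom_annihilated[OF exact_baerD(2,2,3)[OF E] assms x] exact_baerD(4)[OF E, of j] x
    by (auto simp: ext_cocycles_def annihilated_iff)
  then show ?thesis using Suc by auto
qed

text \<open>
  The embedding of \<open>R/(I : a)\<close> into \<open>R/I\<close> by multiplication by \<open>a\<close> induces a surjection on maps into an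
  injective module.
\<close>

lemma ext_coboundaries_divide:
  assumes "ideal I R" "a \<in> carrier R" "b \<in> ext_coboundaries E \<delta> i {r \<in> carrier R. r \<otimes>\<^bsub>R\<^esub> a \<in> I}"
  shows "\<exists>c\<in>ext_coboundaries E \<delta> i I. a \<odot>\<^bsub>E i\<^esub> c = b"
proof (cases i)
  case 0
  interpret E0: module R "E 0" by (rule exact_baerD(2)[OF E])
  show ?thesis using assms(2,3) 0 by simp
next
  case (Suc j)
  with assms(3) obtain w where w: "w \<in> annihilated (E j) {r \<in> carrier R. r \<otimes>\<^bsub>R\<^esub> a \<in> I}" "b = \<delta> j w"
    by auto
  then have wE: "w \<in> carrier (E j)"
    "\<And>r. r \<in> carrier R \<Longrightarrow> r \<otimes>\<^bsub>R\<^esub> a \<in> I \<Longrightarrow> r \<odot>\<^bsub>E j\<^esub> w = \<zero>\<^bsub>E j\<^esub>" by (auto simp: annihilated_iff)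
  obtain v where v: "v \<in> carrier (E j)" "a \<odot>\<^bsub>E j\<^esub> v = w" "\<And>l. l \<in> I \<Longrightarrow> l \<odot>\<^bsub>E j\<^esub> v = \<zero>\<^bsub>E j\<^esub>"
    using baer_solve[OF exact_baerD(1)[OF E] assms(1,2) wE] by blast
  have "a \<odot>\<^bsub>E i\<^esub> \<delta> j v = b" using hom_smult[OF exact_baerD(3)[OF E] assms(2) v(1)] v(2) w(2) Suc by simp
  moreover have "\<delta> j v \<in> ext_coboundaries E \<delta> i I"
    unfolding Suc ext_coboundaries_simps using v by (intro imageI) (simp add: annihilated_iff)
  ultimately show ?thesis by blast
qed

text \<open>
  Let \<open>J = (I : a)\<close>. The kernel of \<open>R/I \<rightarrow> R/(I + a R)\<close> is a copy of \<open>R/J\<close>, so \<open>Ext\<^sup>i\<^sup>+\<^sup>1(R/(I + a R), M)\<close> is an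
  extension of a submodule of \<open>Ext\<^sup>i\<^sup>+\<^sup>1(R/I, M)\<close> by a quotient of \<open>Ext\<^sup>i(R/J, M)\<close>. Chains are compared
  through these two: \<open>F Z\<close> adds the coboundaries for \<open>I\<close>, and \<open>G Z\<close> collects \<open>a y\<close> for the \<open>y\<close> that are
  killed by \<open>I\<close> and have their coboundary in \<open>Z\<close>.
\<close>

lemma acc_ext_step:
  assumes "cring R" "ideal I R" "a \<in> carrier R"
    and acc: "acc_between R (E (Suc i)) (ext_coboundaries E \<delta> (Suc i) I) (ext_cocycles E \<delta> (Suc i) I)"
    and acc': "acc_between R (E i) (ext_coboundaries E \<delta> i {r \<in> carrier R. r \<otimes>\<^bsub>R\<^esub> a \<in> I})
        (ext_cocycles E \<delta> i {r \<in> carrier R. r \<otimes>\<^bsub>R\<^esub> a \<in> I})"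
  shows "acc_between R (E (Suc i)) (ext_coboundaries E \<delta> (Suc i) (ideal_adjoin R I a))
        (ext_cocycles E \<delta> (Suc i) (ideal_adjoin R I a))"
proof -
  note e = exact_baerD[OF E]
  interpret Ei: module R "E i" by (rule e(2))
  interpret E1: module R "E (Suc i)" by (rule e(2))
  let ?J = "{r \<in> carrier R. r \<otimes>\<^bsub>R\<^esub> a \<in> I}" and ?I = "ideal_adjoin R I a"
  have J: "ideal ?J R" by (rule colon_ideal[OF assms(1-3)])
  note A = ideal_adjoin[OF assms(1-3)]
  have Ic: "r \<in> carrier R" if "r \<in> I" for r using ideal.Icarr[OF assms(2) that] .
  define B where "B = ext_coboundaries E \<delta> (Suc i) I"
  define B' where "B' = ext_coboundaries E \<delta> i ?J"
  have sB: "submodule B R (E (Suc i))" unfolding B_def by (rule submodule_ext_coboundaries[OF assms(2)])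
  have sB': "submodule B' R (E i)" unfolding B'_def by (rule submodule_ext_coboundaries[OF J])
  define P where "P Z = {y \<in> annihilated (E i) I. \<delta> i y \<in> Z}" for Z
  have PI: "y \<in> carrier (E i)" "\<delta> i y \<in> Z" "\<And>r. r \<in> I \<Longrightarrow> r \<odot>\<^bsub>E i\<^esub> y = \<zero>\<^bsub>E i\<^esub>" if "y \<in> P Z" for y Z
    using that by (auto simp: P_def annihilated_iff)
  have sP: "submodule (P Z) R (E i)" if "submodule Z R (E (Suc i))" for Z
  proof -
    have "P Z = annihilated (E i) I \<inter> {y \<in> carrier (E i). \<delta> i y \<in> Z}" by (auto simp: P_def annihilated_iff)
    then show ?thesis
      using submodule_Int[OF e(2) submodule_annihilated[OF e(2) assms(2)] submodule_vimage[OF e(2,2,3) that]]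
      by simp
  qed
  let ?F = "\<lambda>Z. {z \<oplus>\<^bsub>E (Suc i)\<^esub> b | z b. z \<in> Z \<and> b \<in> B}"
  let ?G = "\<lambda>Z. {y \<oplus>\<^bsub>E i\<^esub> b | y b. y \<in> (\<lambda>y. a \<odot>\<^bsub>E i\<^esub> y) ` P Z \<and> b \<in> B'}"
  show ?thesis
  proof (rule acc_between_reflect[OF acc acc', where F = ?F and G = ?G])
    fix Z assume Z: "submodule Z R (E (Suc i))" "ext_coboundaries E \<delta> (Suc i) ?I \<subseteq> Z"
      "Z \<subseteq> ext_cocycles E \<delta> (Suc i) ?I"
    have "Z \<subseteq> ext_cocycles E \<delta> (Suc i) I" using Z(3) ext_cocycles_antimono[OF A(2)] by (rule subset_trans)
    then have "?F Z \<subseteq> ext_cocycles E \<delta> (Suc i) I"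
      using submodule_add[OF submodule_ext_cocycles[OF assms(2)]] ext_coboundaries_subset[OF assms(2), of "Suc i"]
      unfolding B_def by blast
    then show "submodule (?F Z) R (E (Suc i)) \<and> ext_coboundaries E \<delta> (Suc i) I \<subseteq> ?F Z \<and>
        ?F Z \<subseteq> ext_cocycles E \<delta> (Suc i) I"
      using submodule_sum[OF e(2) Z(1) sB] unfolding B_def by blast
    have sG: "submodule ((\<lambda>y. a \<odot>\<^bsub>E i\<^esub> y) ` P Z) R (E i)"
      by (rule submodule_image[OF e(2,2) hom_smult_map[OF e(2) assms(3)] sP[OF Z(1)]])
    have "a \<odot>\<^bsub>E i\<^esub> y \<in> ext_cocycles E \<delta> i ?J" if y: "y \<in> P Z" for y
    proof -
      note p = PI[OF y]
      have "a \<odot>\<^bsub>E (Suc i)\<^esub> \<delta> i y = \<zero>\<^bsub>E (Suc i)\<^esub>"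
        using p(2) Z(3) A(3) by (auto simp: ext_cocycles_def annihilated_iff)
      then have "\<delta> i (a \<odot>\<^bsub>E i\<^esub> y) = \<zero>\<^bsub>E (Suc i)\<^esub>" using hom_smult[OF e(3) assms(3) p(1)] by simp
      moreover have "r \<odot>\<^bsub>E i\<^esub> (a \<odot>\<^bsub>E i\<^esub> y) = \<zero>\<^bsub>E i\<^esub>" if "r \<in> ?J" for r
        using p(1,3) that assms(3) by (simp add: Ei.smult_assoc1[symmetric])
      ultimately show ?thesis using p(1) assms(3) by (simp add: ext_cocycles_def annihilated_iff cocycles_iff)
    qed
    then have "?G Z \<subseteq> ext_cocycles E \<delta> i ?J"
      using submodule_add[OF submodule_ext_cocycles[OF J]] ext_coboundaries_subset[OF J, of i]
      unfolding B'_def by blast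
    then show "submodule (?G Z) R (E i) \<and> ext_coboundaries E \<delta> i ?J \<subseteq> ?G Z \<and> ?G Z \<subseteq> ext_cocycles E \<delta> i ?J"
      using submodule_sum[OF e(2) sG sB'] unfolding B'_def by blast
  next
    fix Z Z' :: "'e set" assume "Z \<subseteq> Z'"
    moreover from this have "P Z \<subseteq> P Z'" by (auto simp: P_def)
    ultimately show "?F Z \<subseteq> ?F Z'" "?G Z \<subseteq> ?G Z'" by blast+
  next
    fix Z Z' assume Z: "submodule Z R (E (Suc i))" "submodule Z' R (E (Suc i))"
      "ext_coboundaries E \<delta> (Suc i) ?I \<subseteq> Z" "Z \<subseteq> Z'" "Z' \<subseteq> ext_cocycles E \<delta> (Suc i) ?I"
      and FG: "?F Z = ?F Z'" "?G Z = ?G Z'"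
    show "Z' \<subseteq> Z"
    proof
      fix z' assume z': "z' \<in> Z'"
      then have "z' \<in> ?F Z'" using submodule_sum(2)[OF e(2) Z(2) sB] by blast
      then obtain z b where zb: "z \<in> Z" "b \<in> B" "z' = z \<oplus>\<^bsub>E (Suc i)\<^esub> b" unfolding FG(1)[symmetric] by blast
      obtain y where y: "y \<in> annihilated (E i) I" "b = \<delta> i y" using zb(2) by (auto simp: B_def)
      have zc: "z \<in> carrier (E (Suc i))" "z' \<in> carrier (E (Suc i))" "b \<in> carrier (E (Suc i))"
        using submodule_mem[OF Z(1) zb(1)] submodule_mem[OF Z(2) z'] submodule_mem[OF sB zb(2)] .
      have "b = z' \<ominus>\<^bsub>E (Suc i)\<^esub> z" using E1.add_eq_iff_diff[OF zc(1,3,2)] zb(3) by simp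
      then have "b \<in> Z'" using submodule_diff[OF e(2) Z(2) z', of z] zb(1) Z(4) by blast
      then have yP: "y \<in> P Z'" using y by (simp add: P_def)
      then have "a \<odot>\<^bsub>E i\<^esub> y \<in> ?G Z'"
        using submodule_sum(2)[OF e(2) submodule_image[OF e(2,2) hom_smult_map[OF e(2) assms(3)] sP[OF Z(2)]] sB']
        by blast
      then obtain y2 b' where y2: "y2 \<in> P Z" "b' \<in> B'" "a \<odot>\<^bsub>E i\<^esub> y = a \<odot>\<^bsub>E i\<^esub> y2 \<oplus>\<^bsub>E i\<^esub> b'"
        unfolding FG(2)[symmetric] by blast
      obtain c where c: "c \<in> ext_coboundaries E \<delta> i I" "a \<odot>\<^bsub>E i\<^esub> c = b'"
        using ext_coboundaries_divide[OF assms(2,3)] y2(2) unfolding B'_def by blast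
      have cc: "c \<in> ext_cocycles E \<delta> i I" using c(1) ext_coboundaries_subset[OF assms(2)] by blast
      then have c': "c \<in> carrier (E i)" "\<delta> i c = \<zero>\<^bsub>E (Suc i)\<^esub>" "c \<in> annihilated (E i) I"
        by (auto simp: ext_cocycles_def cocycles_iff)
      have yc: "y \<in> carrier (E i)" "y2 \<in> carrier (E i)" using PI(1) yP y2(1) by blast+
      define y3 where "y3 = y \<ominus>\<^bsub>E i\<^esub> (y2 \<oplus>\<^bsub>E i\<^esub> c)"
      have y3c: "y3 \<in> carrier (E i)" using yc c'(1) by (simp add: y3_def)
      have a3: "a \<odot>\<^bsub>E i\<^esub> y3 = \<zero>\<^bsub>E i\<^esub>"
        using yc c'(1) assms(3) hom_closed[OF hom_smult_map[OF e(2) assms(3)]]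
        by (simp add: y3_def Ei.smult_diff Ei.smult_r_distr y2(3) c(2)[symmetric])
      have "y2 \<in> annihilated (E i) I" using y2(1) by (simp add: P_def)
      then have I3: "y3 \<in> annihilated (E i) I"
        unfolding y3_def using y(1) c'(3) submodule_annihilated[OF e(2) assms(2), of i]
        by (intro submodule_diff[OF e(2)] submodule_add) auto
      have "y3 \<in> annihilated (E i) ?I"
      proof -
        have "r \<odot>\<^bsub>E i\<^esub> y3 = \<zero>\<^bsub>E i\<^esub>" if "r \<in> ?I" for r
        proof -
          from that obtain l s where ls: "l \<in> I" "s \<in> carrier R" "r = l \<oplus>\<^bsub>R\<^esub> s \<otimes>\<^bsub>R\<^esub> a"
            by (auto simp: ideal_adjoin_def)
          then show ?thesis using I3 a3 y3c Ic assms(3)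
            by (simp add: Ei.smult_l_distr Ei.smult_assoc1 annihilated_iff)
        qed
        then show ?thesis using y3c by (simp add: annihilated_iff)
      qed
      then have "\<delta> i y3 \<in> Z" using Z(3) by auto
      moreover have "\<delta> i y3 = \<delta> i y \<ominus>\<^bsub>E (Suc i)\<^esub> \<delta> i y2"
        using yc c' hom_closed[OF e(3)] by (simp add: y3_def hom_diff[OF e(2,2,3)] hom_add[OF e(3)])
      ultimately have "\<delta> i y2 \<oplus>\<^bsub>E (Suc i)\<^esub> (\<delta> i y \<ominus>\<^bsub>E (Suc i)\<^esub> \<delta> i y2) \<in> Z"
        using submodule_add[OF Z(1) PI(2)[OF y2(1)]] by simp
      then have "\<delta> i y \<in> Z" using hom_closed[OF e(3)] yc by simp
      then show "z' \<in> Z" using zb y(2) submodule_add[OF Z(1)] by simp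
    qed
  qed
qed

text \<open>
  For a finitely generated \<open>M\<close> the modules \<open>Ext\<^sup>i(R/I, M)\<close> are Noetherian. The proof stays inside
  the injective resolution: it is an induction on \<open>i\<close> and on the construction of \<open>I\<close> from the zero ideal.
\<close>

lemma acc_ext:
  assumes "noetherian_ring R" "cring R" "acc_between R (E 0) {\<zero>\<^bsub>E 0\<^esub>} (cocycles E \<delta> 0)" "ideal I R"
  shows "acc_between R (E i) (ext_coboundaries E \<delta> i I) (ext_cocycles E \<delta> i I)"
  using assms(4)
proof (induction i arbitrary: I)
  case 0
  show ?case by (rule acc_between_mono[OF assms(3)]) (auto simp: ext_cocycles_def)
next
  case (Suc i)
  show ?case
  proof (rule noetherian_adjoin_induct[OF assms(1,2) Suc.prems])
    interpret Ei: module R "E i" by (rule exact_baerD(2)[OF E])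
    have "annihilated (E i) {\<zero>\<^bsub>R\<^esub>} = carrier (E i)" by (auto simp: annihilated_iff)
    then have "ext_cocycles E \<delta> (Suc i) {\<zero>\<^bsub>R\<^esub>} \<subseteq> ext_coboundaries E \<delta> (Suc i) {\<zero>\<^bsub>R\<^esub>}"
      using exact_baerD(4)[OF E, of i] by (simp add: ext_cocycles_def)
    then show "acc_between R (E (Suc i)) (ext_coboundaries E \<delta> (Suc i) {\<zero>\<^bsub>R\<^esub>}) (ext_cocycles E \<delta> (Suc i) {\<zero>\<^bsub>R\<^esub>})"
      by (rule acc_between_trivial)
    fix I a assume "ideal I R" "a \<in> carrier R"
      "acc_between R (E (Suc i)) (ext_coboundaries E \<delta> (Suc i) I) (ext_cocycles E \<delta> (Suc i) I)"
    then show "acc_between R (E (Suc i)) (ext_coboundaries E \<delta> (Suc i) (ideal_adjoin R I a))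
        (ext_cocycles E \<delta> (Suc i) (ideal_adjoin R I a))"
      by (intro acc_ext_step[OF assms(2)] Suc.IH colon_ideal[OF assms(2)])
  qed
qed

text \<open>
  An argument of Bass. By Noetherian induction the claim holds for all ideals that are larger than
  \<open>I\<close>. If \<open>I\<close> is not the maximal ideal, pick \<open>x\<close> in \<open>\<mm>\<close> outside \<open>I\<close> and put \<open>J = (I : x)\<close>; there is an exact
  sequence \<open>0 \<rightarrow> R/J \<rightarrow> R/I \<rightarrow> R/(I + x R) \<rightarrow> 0\<close>, whose first map is multiplication by \<open>x\<close>. If \<open>J\<close> is larger
  than \<open>I\<close>, both outer terms have vanishing Ext in degree \<open>j\<close>, and so has \<open>R/I\<close>. If \<open>J = I\<close>, the vanishing
  of \<open>Ext\<^sup>j\<^sup>+\<^sup>1(R/(I + x R), M)\<close> makes multiplication by \<open>x\<close> surjective on \<open>Ext\<^sup>j(R/I, M)\<close>, which is zero by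
  Nakayama's lemma.
\<close>

theorem ext_vanishing_from_residue_field:
  assumes "local_ring R \<mm>" "noetherian_ring R" "acc_between R (E 0) {\<zero>\<^bsub>E 0\<^esub>} (cocycles E \<delta> 0)"
    and res: "\<And>j. j \<ge> s \<Longrightarrow> ext_cocycles E \<delta> j \<mm> \<subseteq> ext_coboundaries E \<delta> j \<mm>"
    and I: "ideal I R" and j: "j \<ge> s"
  shows "ext_cocycles E \<delta> j I \<subseteq> ext_coboundaries E \<delta> j I"
proof -
  have cr: "cring R" using assms(1) by (simp add: local_ring_def)
  interpret R: cring R by (rule cr)
  note e = exact_baerD[OF E]
  have mm: "ideal \<mm> R" using assms(1) by (simp add: local_ring_def maximalideal.axioms(1))
  have "\<forall>j\<ge>s. ext_cocycles E \<delta> j I \<subseteq> ext_coboundaries E \<delta> j I" using assms(2) I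
  proof (rule noetherian_induct)
    fix I assume I: "ideal I R" and IH: "\<And>J. ideal J R \<Longrightarrow> I \<subset> J \<Longrightarrow>
      \<forall>j\<ge>s. ext_cocycles E \<delta> j J \<subseteq> ext_coboundaries E \<delta> j J"
    have Ic: "r \<in> carrier R" if "r \<in> I" for r using ideal.Icarr[OF I that] .
    show "\<forall>j\<ge>s. ext_cocycles E \<delta> j I \<subseteq> ext_coboundaries E \<delta> j I"
    proof (cases "I = carrier R")
      case True
      have "ext_cocycles E \<delta> j I \<subseteq> {\<zero>\<^bsub>E j\<^esub>}" for j
      proof
        interpret Ej: module R "E j" by (rule e(2))
        fix x assume "x \<in> ext_cocycles E \<delta> j I"
        then have "x \<in> carrier (E j)" "\<one>\<^bsub>R\<^esub> \<odot>\<^bsub>E j\<^esub> x = \<zero>\<^bsub>E j\<^esub>"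
          using True by (auto simp: ext_cocycles_def annihilated_iff)
        then show "x \<in> {\<zero>\<^bsub>E j\<^esub>}" by simp
      qed
      moreover have "\<zero>\<^bsub>E j\<^esub> \<in> ext_coboundaries E \<delta> j I" for j
        by (rule submodule_zero[OF submodule_ext_coboundaries[OF I]])
      ultimately show ?thesis by blast
    next
      case False
      then have Im: "I \<subseteq> \<mm>" by (rule local_ring_proper_ideal[OF assms(1,2) I])
      show ?thesis
      proof (cases "I = \<mm>")
        case True
        then show ?thesis using res by blast
      next
        case False
        with Im obtain x where x: "x \<in> \<mm>" "x \<notin> I" by blast
        have xR: "x \<in> carrier R" using ideal.Icarr[OF mm x(1)] .
        note A = ideal_adjoin[OF cr I xR]
        let ?I = "ideal_adjoin R I x" and ?J = "{r \<in> carrier R. r \<otimes>\<^bsub>R\<^esub> x \<in> I}"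
        have AV: "ext_cocycles E \<delta> j ?I \<subseteq> ext_coboundaries E \<delta> j ?I" if "j \<ge> s" for j
          using IH[OF A(1)] A(2,3) x(2) that by blast
        have ann: "u \<in> annihilated (E j) ?I"
          if "u \<in> annihilated (E j) I" "x \<odot>\<^bsub>E j\<^esub> u = \<zero>\<^bsub>E j\<^esub>" for u j
        proof -
          interpret Ej: module R "E j" by (rule e(2))
          show ?thesis using that Ic xR
            by (auto simp: annihilated_iff ideal_adjoin_def Ej.smult_l_distr Ej.smult_assoc1)
        qed
        have IJ: "I \<subseteq> ?J" using Ic ideal.I_r_closed[OF I] xR by auto
        have J: "ideal ?J R" by (rule colon_ideal[OF cr I xR])
        show ?thesis
        proof (cases "I = ?J")
          case False
          then have JV: "ext_cocycles E \<delta> j ?J \<subseteq> ext_coboundaries E \<delta> j ?J" if "j \<ge> s" for j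
            using IH[OF J] IJ that by blast
          show ?thesis
          proof (intro allI impI subsetI)
            fix j u assume j: "j \<ge> s" and u: "u \<in> ext_cocycles E \<delta> j I"
            interpret Ej: module R "E j" by (rule e(2))
            have uc: "u \<in> carrier (E j)" "u \<in> annihilated (E j) I" using u by (auto simp: ext_cocycles_def annihilated_iff)
            have "x \<odot>\<^bsub>E j\<^esub> u \<in> cocycles E \<delta> j"
              using u submodule_smult[OF submodule_cocycles[OF E] xR] by (simp add: ext_cocycles_def)
            moreover have "r \<odot>\<^bsub>E j\<^esub> (x \<odot>\<^bsub>E j\<^esub> u) = \<zero>\<^bsub>E j\<^esub>" if "r \<in> ?J" for r
              using that uc xR by (simp add: Ej.smult_assoc1[symmetric] annihilated_iff)
            ultimately have "x \<odot>\<^bsub>E j\<^esub> u \<in> ext_cocycles E \<delta> j ?J"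
              using uc xR by (simp add: ext_cocycles_def annihilated_iff)
            then have "x \<odot>\<^bsub>E j\<^esub> u \<in> ext_coboundaries E \<delta> j ?J" using JV[OF j] by blast
            then obtain c where c: "c \<in> ext_coboundaries E \<delta> j I" "x \<odot>\<^bsub>E j\<^esub> c = x \<odot>\<^bsub>E j\<^esub> u"
              using ext_coboundaries_divide[OF I xR] by blast
            have cc: "c \<in> ext_cocycles E \<delta> j I" using c(1) ext_coboundaries_subset[OF I] by blast
            have cE: "c \<in> carrier (E j)" using submodule_mem[OF submodule_ext_cocycles[OF I] cc] .
            have uc': "u \<ominus>\<^bsub>E j\<^esub> c \<in> ext_cocycles E \<delta> j I"
              by (rule submodule_diff[OF e(2) submodule_ext_cocycles[OF I] u cc])
            have "x \<odot>\<^bsub>E j\<^esub> (u \<ominus>\<^bsub>E j\<^esub> c) = \<zero>\<^bsub>E j\<^esub>" using c(2) cE uc xR by (simp add: Ej.smult_diff)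
            then have "u \<ominus>\<^bsub>E j\<^esub> c \<in> ext_cocycles E \<delta> j ?I" using ann uc' by (simp add: ext_cocycles_def)
            then have "u \<ominus>\<^bsub>E j\<^esub> c \<in> ext_coboundaries E \<delta> j I"
              by (rule subsetD[OF ext_coboundaries_antimono[OF A(2)] subsetD[OF AV[OF j]]])
            then have "c \<oplus>\<^bsub>E j\<^esub> (u \<ominus>\<^bsub>E j\<^esub> c) \<in> ext_coboundaries E \<delta> j I"
              by (rule submodule_add[OF submodule_ext_coboundaries[OF I] c(1)])
            then show "u \<in> ext_coboundaries E \<delta> j I" using cE uc by simp
          qed
        next
          case True
          show ?thesis
          proof (intro allI impI)
            fix j assume j: "j \<ge> s"
            interpret Ej: module R "E j" by (rule e(2))
            interpret E1: module R "E (Suc j)" by (rule e(2))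
            have "ext_cocycles E \<delta> j I = ext_coboundaries E \<delta> j I"
            proof (rule nakayama_acc[OF assms(1,2) e(2) x(1) acc_ext[OF assms(2) cr assms(3) I]
                  submodule_ext_cocycles[OF I] submodule_ext_coboundaries[OF I] ext_coboundaries_subset[OF I]])
              fix u assume u: "u \<in> ext_cocycles E \<delta> j I"
              have uc: "u \<in> carrier (E j)" "\<delta> j u = \<zero>\<^bsub>E (Suc j)\<^esub>" "u \<in> annihilated (E j) I"
                using u by (auto simp: ext_cocycles_def cocycles_iff)
              have "r \<odot>\<^bsub>E j\<^esub> u = \<zero>\<^bsub>E j\<^esub>" if "r \<in> carrier R" "r \<otimes>\<^bsub>R\<^esub> x \<in> I" for r
                using uc(3) True that by (auto simp: annihilated_iff)
              then obtain v where v: "v \<in> carrier (E j)" "x \<odot>\<^bsub>E j\<^esub> v = u"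
                "\<And>l. l \<in> I \<Longrightarrow> l \<odot>\<^bsub>E j\<^esub> v = \<zero>\<^bsub>E j\<^esub>"
                using baer_solve[OF e(1) I xR uc(1)] by blast
              have vI: "v \<in> annihilated (E j) I" using v by (simp add: annihilated_iff)
              have "\<delta> j v \<in> cocycles E \<delta> (Suc j)" using v(1) e(4)[of j] by blast
              moreover have "\<delta> j v \<in> annihilated (E (Suc j)) I" by (rule hom_annihilated[OF e(2,2,3) I vI])
              moreover have "x \<odot>\<^bsub>E (Suc j)\<^esub> \<delta> j v = \<zero>\<^bsub>E (Suc j)\<^esub>"
                using hom_smult[OF e(3) xR v(1)] v(2) uc(2) by simp
              ultimately have "\<delta> j v \<in> ext_cocycles E \<delta> (Suc j) ?I" using ann by (simp add: ext_cocycles_def)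
              then have "\<delta> j v \<in> ext_coboundaries E \<delta> (Suc j) ?I" using AV[of "Suc j"] j by auto
              then obtain w where w: "w \<in> annihilated (E j) ?I" "\<delta> j v = \<delta> j w" by auto
              have wc: "w \<in> carrier (E j)" "x \<odot>\<^bsub>E j\<^esub> w = \<zero>\<^bsub>E j\<^esub>" "w \<in> annihilated (E j) I"
                using w(1) A(3) subsetD[OF annihilated_antimono[OF A(2)] w(1)] by (simp_all add: annihilated_iff)
              have "v \<ominus>\<^bsub>E j\<^esub> w \<in> annihilated (E j) I"
                by (rule submodule_diff[OF e(2) submodule_annihilated[OF e(2) I] vI wc(3)])
              moreover have "\<delta> j (v \<ominus>\<^bsub>E j\<^esub> w) = \<zero>\<^bsub>E (Suc j)\<^esub>"
                using w(2) v(1) wc(1) hom_closed[OF e(3)] by (simp add: hom_diff[OF e(2,2,3)])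
              ultimately have "v \<ominus>\<^bsub>E j\<^esub> w \<in> ext_cocycles E \<delta> j I"
                using v(1) wc(1) by (simp add: ext_cocycles_def cocycles_iff)
              moreover have "u = x \<odot>\<^bsub>E j\<^esub> (v \<ominus>\<^bsub>E j\<^esub> w)" using v wc xR uc(1) by (simp add: Ej.smult_diff)
              ultimately show "\<exists>v\<in>ext_cocycles E \<delta> j I. u = x \<odot>\<^bsub>E j\<^esub> v" by blast
            qed
            then show "ext_cocycles E \<delta> j I \<subseteq> ext_coboundaries E \<delta> j I" by simp
          qed
        qed
      qed
    qed
  qed
  with j show ?thesis by blast
qed

lemma baer_cocycles_if_ext_vanishes:
  assumes "\<And>I. ideal I R \<Longrightarrow> ext_cocycles E \<delta> (Suc d) I \<subseteq> ext_coboundaries E \<delta> (Suc d) I"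
  shows "baer R (sub (E d) (cocycles E \<delta> d))"
  unfolding cocycles_def
proof (rule baer_kernelI[OF exact_baerD(1,2,3)[OF E]])
  fix y J assume J: "ideal J R" and y: "y \<in> \<delta> d ` carrier (E d)"
    and ann: "\<And>r. r \<in> J \<Longrightarrow> r \<odot>\<^bsub>E (Suc d)\<^esub> y = \<zero>\<^bsub>E (Suc d)\<^esub>"
  have "y \<in> ext_cocycles E \<delta> (Suc d) J"
    using y ann exact_baerD(4)[OF E, of d] by (auto simp: ext_cocycles_def annihilated_iff cocycles_iff)
  then have "y \<in> ext_coboundaries E \<delta> (Suc d) J" using assms[OF J] by blast
  then show "\<exists>e\<in>carrier (E d). \<delta> d e = y \<and> (\<forall>r\<in>J. r \<odot>\<^bsub>E d\<^esub> e = \<zero>\<^bsub>E d\<^esub>)"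
    by (auto simp: annihilated_iff)
qed

end

section \<open>Complexes of injective modules with a single cohomology module\<close>

definition baer_complex ::
  "('r, 'x) ring_scheme \<Rightarrow> (nat \<Rightarrow> ('r, 'e) module) \<Rightarrow> (nat \<Rightarrow> 'e \<Rightarrow> 'e) \<Rightarrow> bool" where
  "baer_complex R C \<delta> \<longleftrightarrow> (\<forall>i. baer R (C i)) \<and> (\<forall>i. \<delta> i \<in> mod_hom R (C i) (C (Suc i))) \<and>
     (\<forall>i. coboundaries C \<delta> i \<subseteq> cocycles C \<delta> i)"

lemma coboundaries_simps [simp]:
  "coboundaries C \<delta> 0 = {\<zero>\<^bsub>C 0\<^esub>}" "coboundaries C \<delta> (Suc j) = \<delta> j ` carrier (C j)"
  by (simp_all add: coboundaries_def)

lemma baer_complexD: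
  assumes "baer_complex R C \<delta>"
  shows "baer R (C i)" "module R (C i)" "\<delta> i \<in> mod_hom R (C i) (C (Suc i))"
    "coboundaries C \<delta> i \<subseteq> cocycles C \<delta> i"
    "submodule (cocycles C \<delta> i) R (C i)" "submodule (coboundaries C \<delta> i) R (C i)"
proof -
  show *: "baer R (C i)" "module R (C i)" "\<delta> i \<in> mod_hom R (C i) (C (Suc i))"
    "coboundaries C \<delta> i \<subseteq> cocycles C \<delta> i" for i
    using assms baer_module by (auto simp: baer_complex_def)
  show "submodule (cocycles C \<delta> i) R (C i)" unfolding cocycles_def by (intro submodule_kernel *)
  show "submodule (coboundaries C \<delta> i) R (C i)"
    by (cases i)
       (auto intro!: submodule_singleton_zero * submodule_image[OF *(2,2,3)] submodule_carrier[OF *(2)])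
qed

lemma cohomology_quotient:
  fixes i :: nat
  assumes "baer_complex R C \<delta>"
  defines "p \<equiv> \<lambda>x. coboundaries C \<delta> i +>\<^bsub>sub (C i) (cocycles C \<delta> i)\<^esub> x"
  shows "module R (sub (C i) (cocycles C \<delta> i))" "module R (cohomology C \<delta> i)"
    "p \<in> mod_hom R (sub (C i) (cocycles C \<delta> i)) (cohomology C \<delta> i)"
    "p ` cocycles C \<delta> i = carrier (cohomology C \<delta> i)"
    "\<And>x. x \<in> cocycles C \<delta> i \<Longrightarrow> p x = \<zero>\<^bsub>cohomology C \<delta> i\<^esub> \<longleftrightarrow> x \<in> coboundaries C \<delta> i"
proof -
  note c = baer_complexD[OF assms(1)]
  show m: "module R (sub (C i) (cocycles C \<delta> i))" by (rule submodule_module[OF c(2,5)])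
  have s: "submodule (coboundaries C \<delta> i) R (sub (C i) (cocycles C \<delta> i))"
    by (rule submodule_of_sub[OF c(2,5,6,4)])
  note q = quotient_module[OF m s, folded p_def cohomology_def]
  show "module R (cohomology C \<delta> i)" "p \<in> mod_hom R (sub (C i) (cocycles C \<delta> i)) (cohomology C \<delta> i)"
    "p ` cocycles C \<delta> i = carrier (cohomology C \<delta> i)" using q(1-3) by simp_all
  show "p x = \<zero>\<^bsub>cohomology C \<delta> i\<^esub> \<longleftrightarrow> x \<in> coboundaries C \<delta> i" if "x \<in> cocycles C \<delta> i" for x
    using q(4) that by (auto simp: kernel_iff set_eq_iff)
qed

lemma zero_cohomology_iff:
  assumes "baer_complex R C \<delta>"
  shows "zero_module (cohomology C \<delta> i) \<longleftrightarrow> cocycles C \<delta> i = coboundaries C \<delta> i"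
proof -
  note q = cohomology_quotient[OF assms, where i = i]
  let ?p = "\<lambda>x. coboundaries C \<delta> i +>\<^bsub>sub (C i) (cocycles C \<delta> i)\<^esub> x"
  have ne: "\<zero>\<^bsub>C i\<^esub> \<in> cocycles C \<delta> i" by (rule submodule_zero[OF baer_complexD(5)[OF assms]])
  have "zero_module (cohomology C \<delta> i) \<longleftrightarrow> (\<forall>x\<in>cocycles C \<delta> i. ?p x = \<zero>\<^bsub>cohomology C \<delta> i\<^esub>)"
    unfolding q(4)[symmetric] using ne by blast
  also have "\<dots> \<longleftrightarrow> cocycles C \<delta> i \<subseteq> coboundaries C \<delta> i" using q(5) by blast
  finally show ?thesis using baer_complexD(4)[OF assms, of i] by blast
qed

text \<open>
  Where the complex is exact it splits, starting from degree \<open>0\<close>.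
\<close>

lemma baer_coboundaries:
  assumes "baer_complex R C \<delta>" "\<And>i. i < n \<Longrightarrow> cocycles C \<delta> i = coboundaries C \<delta> i"
  shows "baer R (sub (C n) (coboundaries C \<delta> n))"
  using assms(2)
proof (induction n)
  case 0
  show ?case
    by (rule baer_zero[OF submodule_module[OF baer_complexD(2,6)[OF assms(1)]]]) simp
next
  case (Suc n)
  note c = baer_complexD[OF assms(1)]
  have "baer R (sub (C n) (a_kernel (C n) (C (Suc n)) (\<delta> n)))"
    using Suc.IH Suc.prems(1) Suc.prems(1)[of n] by (simp add: cocycles_def)
  from baer_image[OF c(1,2,3) this] show ?case by simp
qed

text \<open>
  Local cohomology is the cohomology of a complex of injective modules again.
\<close>

lemma torsion_complex:
  assumes "noetherian_ring R" "ideal \<aa> R" "exact_baer R E \<delta>"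
  shows "baer_complex R (\<lambda>j. torsion_part R \<aa> (E j)) \<delta>"
    "cocycles (\<lambda>j. torsion_part R \<aa> (E j)) \<delta> i = carrier (torsion_part R \<aa> (E i)) \<inter> cocycles E \<delta> i"
    "zero (torsion_part R \<aa> (E i)) = zero (E i)" "smult (torsion_part R \<aa> (E i)) = smult (E i)"
proof -
  note e = exact_baerD[OF assms(3)]
  let ?T = "\<lambda>i. carrier (torsion_part R \<aa> (E i))"
  have T: "?T i \<subseteq> carrier (E i)" for i by (auto simp: torsion_part_def)
  show z: "zero (torsion_part R \<aa> (E i)) = zero (E i)" and "smult (torsion_part R \<aa> (E i)) = smult (E i)" for i
    by (simp_all add: torsion_part_def)
  show coc: "cocycles (\<lambda>j. torsion_part R \<aa> (E j)) \<delta> i = ?T i \<inter> cocycles E \<delta> i" for i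
    using T[of i] by (auto simp: cocycles_iff z)
  have \<delta>T: "\<delta> i x \<in> ?T (Suc i)" if "x \<in> ?T i" for i x
    by (rule torsion_hom[OF assms(1) e(2,2) assms(2) e(3) that])
  have "\<delta> i \<in> mod_hom R (torsion_part R \<aa> (E i)) (torsion_part R \<aa> (E (Suc i)))" for i
  proof (subst torsion_eq_sub, subst torsion_eq_sub[of R \<aa> "E (Suc i)"])
    show "\<delta> i \<in> mod_hom R (sub (E i) (?T i)) (sub (E (Suc i)) (?T (Suc i)))"
      using hom_corestrict[OF hom_restrict[OF e(3) T], of i "?T (Suc i)"] \<delta>T by (simp add: image_subset_iff)
  qed
  moreover have "coboundaries (\<lambda>j. torsion_part R \<aa> (E j)) \<delta> i \<subseteq> cocycles (\<lambda>j. torsion_part R \<aa> (E j)) \<delta> i" for i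
  proof (cases i)
    case 0
    then show ?thesis
      unfolding coc using submodule_zero[OF torsion_submodule[OF assms(1) e(2) assms(2)]]
        submodule_zero[OF submodule_cocycles[OF assms(3)]] by (simp add: z)
  next
    case (Suc j)
    have "\<delta> j x \<in> cocycles E \<delta> (Suc j)" if "x \<in> ?T j" for x
      using that T[of j] e(4)[of j] by blast
    then show ?thesis unfolding coc Suc using \<delta>T by auto
  qed
  ultimately show "baer_complex R (\<lambda>j. torsion_part R \<aa> (E j)) \<delta>"
    unfolding baer_complex_def using baer_torsion[OF assms(1) e(1) assms(2)] by blast
qed

text \<open>
  The coboundaries \<open>B\<close> in degree \<open>n\<close> are injective, so \<open>C n = B \<oplus> P\<close>, where \<open>P\<close> is the kernel of a
  retraction \<open>\<rho>\<close> onto \<open>B\<close>. The differential has the same image on \<open>P\<close> as on \<open>C n\<close>, and the projection \<open>\<pi>\<close>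
  onto \<open>P\<close> identifies the cohomology with the cocycles in \<open>P\<close>. Hence \<open>P \<rightarrow> C (n + 1) \<rightarrow> \<dots>\<close> is an injective
  resolution of the cohomology.
\<close>

lemma cohomology_resolution:
  fixes C :: "nat \<Rightarrow> ('r, 'e) module"
  assumes C: "baer_complex R C \<delta>" and ex: "\<And>i. i \<noteq> n \<Longrightarrow> cocycles C \<delta> i = coboundaries C \<delta> i"
  obtains P \<epsilon> \<pi> where
    "exact_baer R (\<lambda>i. if i = 0 then sub (C n) P else C (n + i)) (\<lambda>i. \<delta> (n + i))"
    "\<epsilon> \<in> mod_hom R (cohomology C \<delta> n) (sub (C n) P)" "inj_on \<epsilon> (carrier (cohomology C \<delta> n))"
    "\<epsilon> ` carrier (cohomology C \<delta> n) = P \<inter> cocycles C \<delta> n"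
    "submodule P R (C n)" "\<pi> \<in> mod_hom R (C n) (sub (C n) P)" "\<And>x. x \<in> P \<Longrightarrow> \<pi> x = x"
    "\<And>x. x \<in> cocycles C \<delta> n \<Longrightarrow> \<pi> x \<in> P \<inter> cocycles C \<delta> n"
proof -
  note c = baer_complexD[OF C]
  interpret Cn: module R "C n" by (rule c(2))
  let ?B = "coboundaries C \<delta> n" and ?Z = "cocycles C \<delta> n" and ?H = "cohomology C \<delta> n"
  have bB: "baer R (sub (C n) ?B)" by (rule baer_coboundaries[OF C]) (use ex in auto)
  have sB: "submodule ?B R (C n)" and sZ: "submodule ?Z R (C n)" by (rule c)+
  have id: "(\<lambda>x. x) \<in> mod_hom R (sub (C n) ?B) (sub (C n) ?B)" by (auto simp: mod_hom_def)
  obtain \<rho> where \<rho>: "\<rho> \<in> mod_hom R (C n) (sub (C n) ?B)" "\<And>x. x \<in> ?B \<Longrightarrow> \<rho> x = x"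
    using baer_extend_sub[OF c(2) bB sB id] by blast
  have \<rho>B: "\<rho> x \<in> ?B" if "x \<in> carrier (C n)" for x using hom_closed[OF \<rho>(1) that] by simp
  have \<rho>': "\<rho> \<in> mod_hom R (C n) (C n)" using hom_enlarge[OF \<rho>(1)] submodule_mem[OF sB] by blast
  define P where "P = a_kernel (C n) (C n) \<rho>"
  have P: "x \<in> P \<longleftrightarrow> x \<in> carrier (C n) \<and> \<rho> x = \<zero>\<^bsub>C n\<^esub>" for x by (simp add: P_def kernel_iff)
  have sP: "submodule P R (C n)" unfolding P_def by (rule submodule_kernel[OF c(2,2) \<rho>'])
  define \<pi> where "\<pi> x = x \<ominus>\<^bsub>C n\<^esub> \<rho> x" for x
  have \<pi>': "\<pi> \<in> mod_hom R (C n) (C n)"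
    unfolding \<pi>_def by (rule hom_id_minus[OF c(2) \<rho>'])
  have \<pi>P: "\<pi> x \<in> P" if "x \<in> carrier (C n)" for x
    using that hom_closed[OF \<rho>'] \<rho>(2)[OF \<rho>B[OF that]] by (simp add: P \<pi>_def hom_diff[OF c(2,2) \<rho>'])
  have \<pi>: "\<pi> \<in> mod_hom R (C n) (sub (C n) P)" using hom_corestrict[OF \<pi>'] \<pi>P by blast
  have \<pi>id: "\<pi> x = x" if "x \<in> P" for x using that by (simp add: P \<pi>_def)
  have BZ: "x \<in> ?Z" if "x \<in> ?B" for x using that c(4) by blast
  have \<pi>Z: "\<pi> x \<in> P \<inter> ?Z" if "x \<in> ?Z" for x
  proof -
    have xc: "x \<in> carrier (C n)" using submodule_mem[OF sZ that] .
    then show ?thesis using \<pi>P[OF xc] submodule_diff[OF c(2) sZ that BZ[OF \<rho>B[OF xc]]] by (simp add: \<pi>_def)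
  qed
  let ?L = "\<lambda>i. if i = 0 then sub (C n) P else C (n + i)" and ?\<gamma> = "\<lambda>i. \<delta> (n + i)"
  have coc: "cocycles ?L ?\<gamma> (Suc i) = cocycles C \<delta> (Suc (n + i))" for i by (auto simp: cocycles_iff)
  have dP: "\<delta> n ` P = \<delta> n ` carrier (C n)"
  proof
    show "\<delta> n ` P \<subseteq> \<delta> n ` carrier (C n)" using submodule_mem[OF sP] by blast
    show "\<delta> n ` carrier (C n) \<subseteq> \<delta> n ` P"
    proof
      fix y assume "y \<in> \<delta> n ` carrier (C n)"
      then obtain x where x: "x \<in> carrier (C n)" "y = \<delta> n x" by blast
      interpret C1: module R "C (Suc n)" by (rule c(2))
      have "\<delta> n (\<rho> x) = \<zero>\<^bsub>C (Suc n)\<^esub>" using BZ[OF \<rho>B[OF x(1)]] by (simp add: cocycles_iff)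
      then have "\<delta> n (\<pi> x) = y"
        using x hom_closed[OF \<rho>'] hom_closed[OF c(3)] by (simp add: \<pi>_def hom_diff[OF c(2,2,3)])
      then show "y \<in> \<delta> n ` P" using \<pi>P[OF x(1)] by blast
    qed
  qed
  have "exact_baer R ?L ?\<gamma>"
    unfolding exact_baer_def
  proof (intro conjI allI)
    have "baer R (sub (C n) P)"
      by (rule baer_retract[OF c(1) submodule_module[OF c(2) sP] \<pi> hom_sub_id])
         (use submodule_mem[OF sP] \<pi>id in auto)
    then show "baer R (?L i)" for i using c(1) by simp
    show "?\<gamma> i \<in> mod_hom R (?L i) (?L (Suc i))" for i
    proof (cases i)
      case 0
      then show ?thesis using hom_restrict[OF c(3), of P n] submodule_mem[OF sP] by (simp add: subset_iff)
    next
      case (Suc j)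
      then show ?thesis using c(3)[of "n + i"] by simp
    qed
    show "?\<gamma> i ` carrier (?L i) = cocycles ?L ?\<gamma> (Suc i)" for i
      unfolding coc using ex[of "Suc (n + i)"] dP by (cases i) simp_all
  qed
  moreover
  note q = cohomology_quotient[OF C, where i = n]
  let ?p = "\<lambda>x. ?B +>\<^bsub>sub (C n) ?Z\<^esub> x"
  have \<pi>r: "\<pi> \<in> mod_hom R (sub (C n) ?Z) (sub (C n) P)"
    using hom_restrict[OF \<pi>] submodule_mem[OF sZ] by blast
  have k: "\<pi> x = \<zero>\<^bsub>C n\<^esub> \<longleftrightarrow> x \<in> ?B" if "x \<in> carrier (C n)" for x
  proof
    assume "\<pi> x = \<zero>\<^bsub>C n\<^esub>"
    then have "x = \<rho> x" using that hom_closed[OF \<rho>'] by (simp add: \<pi>_def)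
    then show "x \<in> ?B" using \<rho>B[OF that] by simp
  next
    assume "x \<in> ?B" then show "\<pi> x = \<zero>\<^bsub>C n\<^esub>" using \<rho>(2) that by (simp add: \<pi>_def)
  qed
  obtain \<epsilon> where \<epsilon>: "\<epsilon> \<in> mod_hom R ?H (sub (C n) P)" "\<And>x. x \<in> ?Z \<Longrightarrow> \<epsilon> (?p x) = \<pi> x"
  proof (rule hom_factor[OF q(1,2) submodule_module[OF c(2) sP] q(3) _ \<pi>r])
    show "?p ` carrier (sub (C n) ?Z) = carrier ?H" using q(4) by simp
    show "\<pi> x = \<zero>\<^bsub>sub (C n) P\<^esub>" if "x \<in> carrier (sub (C n) ?Z)" "?p x = \<zero>\<^bsub>?H\<^esub>" for x
      using that q(5)[of x] k[of x] submodule_mem[OF sZ] by simp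
  qed simp
  have "inj_on \<epsilon> (carrier ?H)"
  proof (rule hom_inj_onI[OF q(2) submodule_module[OF c(2) sP] \<epsilon>(1)])
    fix h assume h: "h \<in> carrier ?H" "\<epsilon> h = \<zero>\<^bsub>sub (C n) P\<^esub>"
    then obtain x where x: "x \<in> ?Z" "h = ?p x" unfolding q(4)[symmetric] by blast
    then have "\<pi> x = \<zero>\<^bsub>C n\<^esub>" using \<epsilon>(2) h(2) by simp
    then show "h = \<zero>\<^bsub>?H\<^esub>" using x q(5)[OF x(1)] k submodule_mem[OF sZ x(1)] by simp
  qed
  moreover have "\<epsilon> ` carrier ?H = P \<inter> ?Z"
  proof
    show "\<epsilon> ` carrier ?H \<subseteq> P \<inter> ?Z" unfolding q(4)[symmetric] using \<epsilon>(2) \<pi>Z by auto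
    show "P \<inter> ?Z \<subseteq> \<epsilon> ` carrier ?H"
    proof
      fix x assume x: "x \<in> P \<inter> ?Z"
      then have "\<epsilon> (?p x) = x" using \<epsilon>(2) \<pi>id by simp
      moreover have "?p x \<in> carrier ?H" using x unfolding q(4)[symmetric] by blast
      ultimately show "x \<in> \<epsilon> ` carrier ?H" by force
    qed
  qed
  ultimately show thesis using that[of P \<epsilon> \<pi>] \<epsilon>(1) sP \<pi> \<pi>id \<pi>Z by blast
qed

lemma local_cohomology_eq:
  fixes M :: "('r, 'a) module" and R :: "('r, 'x) ring_scheme"
  assumes "noetherian_ring R" "module R M"
  obtains \<epsilon> and E :: "nat \<Rightarrow> ('r, ('r, 'a) universe) module" and \<delta> where
    "injective_resolution R M \<epsilon> E \<delta>"
    "\<And>i. local_cohomology R \<aa> M i = cohomology (\<lambda>j. torsion_part R \<aa> (E j)) \<delta> i"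
proof -
  let ?P = "\<lambda>(E :: nat \<Rightarrow> ('r, ('r, 'a) universe) module, \<delta>). \<exists>\<epsilon>. injective_resolution R M \<epsilon> E \<delta>"
  obtain E \<delta> where Ed: "(SOME x. ?P x) = (E, \<delta>)" by (cases "SOME x. ?P x")
  have "?P (SOME x. ?P x)"
    by (rule someI_ex) (use injective_resolution_exists[OF assms] in auto)
  then obtain \<epsilon> where "injective_resolution R M \<epsilon> E \<delta>" unfolding Ed by auto
  moreover have "local_cohomology R \<aa> M i = cohomology (\<lambda>j. torsion_part R \<aa> (E j)) \<delta> i" for i
    unfolding local_cohomology_def Ed by simp
  ultimately show thesis using that by blast
qed

lemma ereal_nat_bound:
  assumes "(x :: ereal) < \<infinity>" obtains d :: nat where "x \<le> ereal (real d)"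
proof (cases x)
  case (real r)
  then show thesis using that[of "nat \<lceil>r\<rceil>"] by (simp add: of_nat_ceiling)
qed (use assms that[of 0] in auto)

lemma injdim_nonzero_cases:
  assumes "\<not> zero_module X"
  shows "injdim R X = \<infinity> \<or> (\<exists>d :: nat. injdim R X = ereal (real d))"
proof -
  obtain S :: "nat set" where S: "injdim R X = Inf ((\<lambda>d. ereal (real d)) ` S)"
    using assms unfolding injdim_def by (simp add: image_Collect[symmetric])
  show ?thesis
  proof (cases "S = {}")
    case True
    then show ?thesis using S by (simp add: top_ereal_def)
  next
    case False
    then have "(LEAST d. d \<in> S) \<in> S" "\<And>d. d \<in> S \<Longrightarrow> (LEAST d. d \<in> S) \<le> d"
      by (auto intro: LeastI Least_le)
    then have "injdim R X = ereal (real (LEAST d. d \<in> S))"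
      unfolding S by (intro antisym Inf_lower Inf_greatest) auto
    then show ?thesis by blast
  qed
qed

section \<open>Injective dimension of local cohomology\<close>

lemma torsion_of_sub:
  assumes "X \<subseteq> carrier M"
  shows "torsion_part R \<aa> (sub M X) = sub M (carrier (torsion_part R \<aa> M) \<inter> X)"
proof -
  have "{x \<in> X. \<exists>k. \<forall>r\<in>ideal_power R \<aa> k. r \<odot>\<^bsub>M\<^esub> x = \<zero>\<^bsub>M\<^esub>} =
      {x \<in> carrier M. \<exists>k. \<forall>r\<in>ideal_power R \<aa> k. r \<odot>\<^bsub>M\<^esub> x = \<zero>\<^bsub>M\<^esub>} \<inter> X"
    using assms by blast
  then show ?thesis by (simp add: torsion_part_def)
qed

text \<open>
  This is the Noetherian property of \<open>M\<close>, seen inside the resolution.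
\<close>

lemma acc_resolution:
  assumes "noetherian_ring R" "module R M" "finitely_generated_module R M"
    and "injective_resolution R M \<epsilon> E \<delta>"
  shows "acc_between R (E 0) {\<zero>\<^bsub>E 0\<^esub>} (cocycles E \<delta> 0)"
proof -
  have E: "exact_baer R E \<delta>" "\<epsilon> \<in> mod_hom R M (E 0)" "\<epsilon> ` carrier M = cocycles E \<delta> 0"
    using assms(4) by (auto simp: injective_resolution_iff)
  note acc = acc_finitely_generated[OF assms(1-3)]
  let ?F = "\<lambda>Z. {x \<in> carrier M. \<epsilon> x \<in> Z}"
  show ?thesis
  proof (rule acc_between_reflect[OF acc acc, where F = ?F and G = ?F])
    fix Z assume Z: "submodule Z R (E 0)"
    have s: "submodule (?F Z) R M" by (rule submodule_vimage[OF assms(2) exact_baerD(2)[OF E(1)] E(2) Z])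
    with submodule_zero[OF s]
    show "submodule (?F Z) R M \<and> {\<zero>\<^bsub>M\<^esub>} \<subseteq> ?F Z \<and> ?F Z \<subseteq> carrier M"
      "submodule (?F Z) R M \<and> {\<zero>\<^bsub>M\<^esub>} \<subseteq> ?F Z \<and> ?F Z \<subseteq> carrier M" by blast+
  next
    fix Z Z' assume h: "Z' \<subseteq> cocycles E \<delta> 0" "?F Z = ?F Z'"
    show "Z' \<subseteq> Z"
    proof
      fix z assume z: "z \<in> Z'"
      then obtain x where x: "x \<in> carrier M" "z = \<epsilon> x" using h(1) E(3) by blast
      then have "x \<in> ?F Z" unfolding h(2) using z by simp
      then show "z \<in> Z" using x by simp
    qed
  qed blast+
qed

theorem theorem2p5:
  fixes R :: "('r, 'x) ring_scheme" and \<mm> \<aa> :: "'r set"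
    and M :: "('r, 'a) module" and n :: nat
  assumes "local_ring R \<mm>" and "noetherian_ring R"
    and "ideal \<aa> R" and "\<aa> \<noteq> carrier R"
    and "module R M"
    and "\<forall>i. i \<noteq> n \<longrightarrow> zero_module (local_cohomology R \<aa> M i)"
  shows "(injdim R M < \<infinity> \<longrightarrow> injdim R (local_cohomology R \<aa> M n) < \<infinity>) \<and>
    (finitely_generated_module R M \<and> injdim R (local_cohomology R \<aa> M n) < \<infinity>
       \<longrightarrow> injdim R M < \<infinity>) \<and>
    (finitely_generated_module R M \<and> \<not> zero_module M
       \<longrightarrow> injdim R (local_cohomology R \<aa> M n) = injdim R M - ereal (real n))"
proof -
  note noeth = assms(2) and a = assms(3)
  have cr: "cring R" using assms(1) by (simp add: local_ring_def)
  interpret R: cring R by (rule cr)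
  have mm: "ideal \<mm> R" using assms(1) by (simp add: local_ring_def maximalideal.axioms(1))
  have am: "\<aa> \<subseteq> \<mm>" by (rule local_ring_proper_ideal[OF assms(1,2,3,4)])
  obtain \<epsilon> \<delta> and E :: "nat \<Rightarrow> ('r, ('r, 'a) universe) module" where
    res: "injective_resolution R M \<epsilon> E \<delta>" and
    H: "\<And>i. local_cohomology R \<aa> M i = cohomology (\<lambda>j. torsion_part R \<aa> (E j)) \<delta> i"
    using local_cohomology_eq[OF assms(2,5), of \<aa>] by blast
  have E: "exact_baer R E \<delta>" and \<epsilon>: "\<epsilon> \<in> mod_hom R M (E 0)" "inj_on \<epsilon> (carrier M)"
    "\<epsilon> ` carrier M = cocycles E \<delta> 0" using res by (auto simp: injective_resolution_iff)
  note e = exact_baerD[OF E]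
  define C where "C = (\<lambda>j. torsion_part R \<aa> (E j))"
  have C: "baer_complex R C \<delta>" unfolding C_def by (rule torsion_complex(1)[OF noeth a E])
  have cocC: "cocycles C \<delta> i = carrier (C i) \<inter> cocycles E \<delta> i" for i
    unfolding C_def by (rule torsion_complex(2)[OF noeth a E])
  have C0: "zero (C i) = zero (E i)" and Csm: "smult (C i) = smult (E i)" for i
    unfolding C_def by (rule torsion_complex(3)[OF noeth a E], rule torsion_complex(4)[OF noeth a E])
  have CE: "x \<in> carrier (E i)" if "x \<in> carrier (C i)" for x i using that by (auto simp: C_def torsion_part_def)
  note c = baer_complexD[OF C]
  let ?H = "local_cohomology R \<aa> M n"
  have Hn: "?H = cohomology C \<delta> n" unfolding H C_def ..
  have exC: "cocycles C \<delta> i = coboundaries C \<delta> i" if "i \<noteq> n" for i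
    using assms(6) that zero_cohomology_iff[OF C] H unfolding C_def by simp
  obtain P \<eta> \<pi> where L: "exact_baer R (\<lambda>i. if i = 0 then sub (C n) P else C (n + i)) (\<lambda>i. \<delta> (n + i))"
    and \<eta>: "\<eta> \<in> mod_hom R ?H (sub (C n) P)" "inj_on \<eta> (carrier ?H)"
    "\<eta> ` carrier ?H = P \<inter> cocycles C \<delta> n"
    and sP: "submodule P R (C n)" and \<pi>: "\<pi> \<in> mod_hom R (C n) (sub (C n) P)" "\<And>x. x \<in> P \<Longrightarrow> \<pi> x = x"
    "\<And>x. x \<in> cocycles C \<delta> n \<Longrightarrow> \<pi> x \<in> P \<inter> cocycles C \<delta> n"
    unfolding Hn using cohomology_resolution[OF C exC] by blast
  define L where "L = (\<lambda>i. if i = 0 then sub (C n) P else C (n + i))"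
  define \<gamma> where "\<gamma> = (\<lambda>i. \<delta> (n + i))"
  have L: "exact_baer R L \<gamma>" unfolding L_def \<gamma>_def by (rule L)
  note l = exact_baerD[OF L]
  have L0: "L 0 = sub (C n) P" and LS: "L (Suc i) = C (Suc (n + i))" for i by (simp_all add: L_def)
  have cL0: "cocycles L \<gamma> 0 = P \<inter> cocycles C \<delta> n"
    using submodule_mem[OF sP] by (auto simp: cocycles_iff L0 LS \<gamma>_def)
  have cLS: "cocycles L \<gamma> (Suc i) = cocycles C \<delta> (Suc (n + i))" for i
    by (auto simp: cocycles_iff L_def \<gamma>_def)
  have \<eta>': "\<eta> \<in> mod_hom R ?H (L 0)" "\<eta> ` carrier ?H = cocycles L \<gamma> 0"
    using \<eta>(1,3) cL0 by (simp_all add: L0)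
  have mH: "module R ?H" unfolding Hn by (rule cohomology_quotient(2)[OF C])
  have mM: "module R M" by fact

  \<comment> \<open>Injective dimension is from now on expressed by the cosyzygies of \<open>E\<close> and \<open>L\<close>.\<close>
  have upM: "injdim R M \<le> ereal (real t)" if "baer R (sub (E t) (cocycles E \<delta> t))" for t
    by (rule injdim_leI[OF E \<epsilon>, of "\<lambda>x. x"]) (use that in auto)
  have downM: "baer R (sub (E t) (cocycles E \<delta> t))" if "injdim R M \<le> ereal (real t)" for t
    by (rule injdim_leD[OF mM E \<epsilon> that])
  have "inj (\<lambda>x. (\<lambda>_. ({x}, 0)) :: ('r, ('r, 'a) universe set) universe)"
    by (auto intro!: injI dest: fun_cong)
  then have upH: "injdim R ?H \<le> ereal (real d)" if "baer R (sub (L d) (cocycles L \<gamma> d))" for d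
    by (rule injdim_leI[OF L \<eta>'(1) \<eta>(2) \<eta>'(2) _ that])
  have downH: "baer R (sub (L d) (cocycles L \<gamma> d))" if "injdim R ?H \<le> ereal (real d)" for d
    by (rule injdim_leD[OF mH L \<eta>'(1) \<eta>(2) \<eta>'(2) that])

  \<comment> \<open>The cocycles of the torsion complex are the torsion part of the cocycles of \<open>E\<close>.\<close>
  have baerC: "baer R (sub (C j) (cocycles C \<delta> j))" if "baer R (sub (E j) (cocycles E \<delta> j))" for j
  proof -
    have "baer R (torsion_part R \<aa> (sub (E j) (cocycles E \<delta> j)))" by (rule baer_torsion[OF noeth that a])
    moreover have "cocycles E \<delta> j \<subseteq> carrier (E j)" by (auto simp: cocycles_iff)
    ultimately have "baer R (sub (E j) (carrier (C j) \<inter> cocycles E \<delta> j))"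
      using torsion_of_sub[of "cocycles E \<delta> j" "E j" R \<aa>] by (simp add: C_def)
    then show ?thesis unfolding cocC by (simp add: C_def torsion_part_def)
  qed
  have upper: "injdim R ?H \<le> ereal (real d)" if le: "injdim R M \<le> ereal (real t)" and td: "t \<le> n + d" for t d
  proof (rule upH)
    have b: "baer R (sub (C (n + d)) (cocycles C \<delta> (n + d)))"
      by (rule baerC[OF baer_cocycles_mono[OF E downM[OF le] td]])
    show "baer R (sub (L d) (cocycles L \<gamma> d))"
    proof (cases d)
      case 0
      have "baer R (sub (C n) (P \<inter> cocycles C \<delta> n))"
      proof (rule baer_retract[of R "sub (C n) (cocycles C \<delta> n)" _ \<pi> "\<lambda>x. x"])
        show "baer R (sub (C n) (cocycles C \<delta> n))" using b 0 by simp
        show "module R (sub (C n) (P \<inter> cocycles C \<delta> n))"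
          by (rule submodule_module[OF c(2) submodule_Int[OF c(2) sP c(5)]])
        have "\<pi> \<in> mod_hom R (sub (C n) (cocycles C \<delta> n)) (sub (C n) P)"
          using hom_restrict[OF \<pi>(1)] submodule_mem[OF c(5)] by blast
        then have "\<pi> \<in> mod_hom R (sub (C n) (cocycles C \<delta> n)) (C n)"
          by (rule hom_enlarge) (use submodule_mem[OF sP] in blast)
        from hom_corestrict[OF this, of "P \<inter> cocycles C \<delta> n"]
        show "\<pi> \<in> mod_hom R (sub (C n) (cocycles C \<delta> n)) (sub (C n) (P \<inter> cocycles C \<delta> n))"
          using \<pi>(3) by (simp add: image_subset_iff)
        show "(\<lambda>x. x) \<in> mod_hom R (sub (C n) (P \<inter> cocycles C \<delta> n)) (sub (C n) (cocycles C \<delta> n))"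
          by (auto simp: mod_hom_def)
        show "\<pi> x = x" if "x \<in> carrier (sub (C n) (P \<inter> cocycles C \<delta> n))" for x
          using that \<pi>(2) by simp
      qed
      then show ?thesis unfolding 0 L0 cL0 by simp
    next
      case (Suc k)
      then show ?thesis using b by (simp add: LS cLS)
    qed
  qed
  \<comment> \<open>An injective cosyzygy in degree \<open>j\<close> lets cocycles of degree \<open>j + 1\<close> be lifted with the same
    annihilator, and such a lift of a torsion element is torsion.\<close>
  have vanish: "zero_module ?H" if le: "injdim R M \<le> ereal (real t)" and tn: "t < n" for t
  proof -
    obtain j where j: "n = Suc j" "t \<le> j" using tn by (cases n) auto
    have b: "baer R (sub (E j) (cocycles E \<delta> j))" by (rule baer_cocycles_mono[OF E downM[OF le] j(2)])
    have "cocycles C \<delta> (Suc j) \<subseteq> \<delta> j ` carrier (C j)"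
    proof
      fix y assume y: "y \<in> cocycles C \<delta> (Suc j)"
      then have yE: "y \<in> cocycles E \<delta> (Suc j)" and yC: "y \<in> carrier (C (Suc j))" by (auto simp: cocC)
      obtain x where x: "x \<in> carrier (E j)" "\<delta> j x = y"
        "\<And>r. r \<in> carrier R \<Longrightarrow> r \<odot>\<^bsub>E (Suc j)\<^esub> y = \<zero>\<^bsub>E (Suc j)\<^esub> \<Longrightarrow> r \<odot>\<^bsub>E j\<^esub> x = \<zero>\<^bsub>E j\<^esub>"
        using cocycle_lift[OF E b yE] by blast
      have "x \<in> carrier (C j)"
        using yC x(1,3) ideal.Icarr[OF a] R.nat_pow_closed
        unfolding C_def torsion_iff[OF noeth e(2) a] by meson
      then show "y \<in> \<delta> j ` carrier (C j)" using x(2) by blast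
    qed
    then have "cocycles C \<delta> n = coboundaries C \<delta> n" using c(4)[of n] j(1) by auto
    then show ?thesis unfolding Hn zero_cohomology_iff[OF C] .
  qed

  \<comment> \<open>Elements killed by \<open>\<mm>\<close> are \<open>\<aa>\<close>-torsion, so Ext of the residue field is computed by \<open>C\<close> as well.\<close>
  have resid: "u \<in> cocycles C \<delta> j" if "u \<in> ext_cocycles E \<delta> j \<mm>" for u j
  proof -
    have u: "u \<in> carrier (E j)" "u \<in> cocycles E \<delta> j" "\<And>r. r \<in> \<mm> \<Longrightarrow> r \<odot>\<^bsub>E j\<^esub> u = \<zero>\<^bsub>E j\<^esub>"
      using that by (auto simp: ext_cocycles_def annihilated_iff)
    have "s [^]\<^bsub>R\<^esub> (1 :: nat) \<odot>\<^bsub>E j\<^esub> u = \<zero>\<^bsub>E j\<^esub>" if "s \<in> \<aa>" for s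
      using that am u(3) ideal.Icarr[OF a that] by auto
    then have "u \<in> carrier (C j)" unfolding C_def torsion_iff[OF noeth e(2) a] using u(1) by blast
    with u(2) show ?thesis by (simp add: cocC)
  qed
  have ext_lift: "u \<in> ext_coboundaries E \<delta> (Suc j) \<mm>"
    if "u \<in> ext_cocycles E \<delta> (Suc j) \<mm>" "x \<in> carrier (C j)" "\<delta> j x = u"
      "\<And>r. r \<in> carrier R \<Longrightarrow> r \<odot>\<^bsub>E (Suc j)\<^esub> u = \<zero>\<^bsub>E (Suc j)\<^esub> \<Longrightarrow> r \<odot>\<^bsub>E j\<^esub> x = \<zero>\<^bsub>E j\<^esub>" for u x j
  proof -
    have "x \<in> annihilated (E j) \<mm>"
      using that CE ideal.Icarr[OF mm] by (auto simp: ext_cocycles_def annihilated_iff)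
    then show ?thesis using that(3) by auto
  qed
  \<comment> \<open>Above degree \<open>n + d\<close> the complexes \<open>C\<close> and \<open>L\<close> agree up to the shift by \<open>n\<close>, and the cosyzygies of \<open>L\<close>
    from degree \<open>d\<close> on are injective.\<close>
  have lower: "injdim R M \<le> ereal (real (n + d))"
    if fg: "finitely_generated_module R M" and le: "injdim R ?H \<le> ereal (real d)" for d
  proof (rule upM, rule baer_cocycles_if_ext_vanishes[OF E])
    fix I assume I: "ideal I R"
    show "ext_cocycles E \<delta> (Suc (n + d)) I \<subseteq> ext_coboundaries E \<delta> (Suc (n + d)) I"
    proof (rule ext_vanishing_from_residue_field[OF E assms(1,2) acc_resolution[OF noeth mM fg res] _ I order_refl])
      fix j assume "Suc (n + d) \<le> j"
      then obtain k where k: "j = Suc (n + k)" "d \<le> k" by (metis add_Suc add.assoc le_add1 le_iff_add)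
      have b: "baer R (sub (L k) (cocycles L \<gamma> k))" by (rule baer_cocycles_mono[OF L downH[OF le] k(2)])
      show "ext_cocycles E \<delta> j \<mm> \<subseteq> ext_coboundaries E \<delta> j \<mm>"
      proof
        fix u assume u: "u \<in> ext_cocycles E \<delta> j \<mm>"
        have "u \<in> cocycles L \<gamma> (Suc k)" using resid[OF u] unfolding k(1) cLS .
        then obtain x where x: "x \<in> carrier (L k)" "\<gamma> k x = u"
          "\<And>r. r \<in> carrier R \<Longrightarrow> r \<odot>\<^bsub>L (Suc k)\<^esub> u = \<zero>\<^bsub>L (Suc k)\<^esub> \<Longrightarrow> r \<odot>\<^bsub>L k\<^esub> x = \<zero>\<^bsub>L k\<^esub>"
          using cocycle_lift[OF L b] by blast
        have Lk: "x \<in> carrier (C (n + k))" "smult (L k) = smult (E (n + k))" "zero (L k) = zero (E (n + k))"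
          "smult (L (Suc k)) = smult (E (Suc (n + k)))" "zero (L (Suc k)) = zero (E (Suc (n + k)))"
          using x(1) submodule_mem[OF sP] by (auto simp: L_def C0 Csm split: if_splits)
        show "u \<in> ext_coboundaries E \<delta> j \<mm>"
          unfolding k(1)
          by (rule ext_lift[OF u[unfolded k(1)] Lk(1)]) (use x(2,3) Lk in \<open>simp_all add: \<gamma>_def\<close>)
      qed
    qed
  qed
  \<comment> \<open>If \<open>H\<close> were zero, \<open>C\<close> would be exact and Ext of the residue field would vanish in all degrees,
    so \<open>Ext\<^sup>0(R, M) = M\<close> would vanish.\<close>
  have nonzero: "\<not> zero_module ?H" if fg: "finitely_generated_module R M" and nz: "\<not> zero_module M"
  proof
    assume "zero_module ?H"
    then have "cocycles C \<delta> n = coboundaries C \<delta> n" unfolding Hn zero_cohomology_iff[OF C] .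
    then have ex: "cocycles C \<delta> i = coboundaries C \<delta> i" for i using exC by (cases "i = n") simp_all
    have van: "ext_cocycles E \<delta> j \<mm> \<subseteq> ext_coboundaries E \<delta> j \<mm>" for j
    proof (cases j)
      case 0
      then show ?thesis using resid[of _ 0] ex[of 0] by (auto simp: C0)
    next
      case (Suc i)
      show ?thesis
      proof
        fix u assume u: "u \<in> ext_cocycles E \<delta> j \<mm>"
        have b: "baer R (sub (C i) (a_kernel (C i) (C (Suc i)) (\<delta> i)))"
          using baer_coboundaries[OF C, of i] ex unfolding cocycles_def by simp
        have "u \<in> \<delta> i ` carrier (C i)" using resid[OF u] ex[of j] Suc by simp
        then obtain x where x: "x \<in> carrier (C i)" "\<delta> i x = u"
          "\<And>r. r \<in> carrier R \<Longrightarrow> r \<odot>\<^bsub>C (Suc i)\<^esub> u = \<zero>\<^bsub>C (Suc i)\<^esub> \<Longrightarrow> r \<odot>\<^bsub>C i\<^esub> x = \<zero>\<^bsub>C i\<^esub>"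
          using annihilator_preserving_lift[OF c(2,2,3) b] by blast
        show "u \<in> ext_coboundaries E \<delta> j \<mm>"
          unfolding Suc by (rule ext_lift[OF u[unfolded Suc] x(1,2)]) (use x(3) in \<open>simp add: C0 Csm\<close>)
      qed
    qed
    have "ext_cocycles E \<delta> 0 {\<zero>\<^bsub>R\<^esub>} \<subseteq> ext_coboundaries E \<delta> 0 {\<zero>\<^bsub>R\<^esub>}"
      by (rule ext_vanishing_from_residue_field[OF E assms(1,2) acc_resolution[OF noeth mM fg res] van R.zeroideal order_refl])
    moreover interpret E0: module R "E 0" by (rule e(2))
    have "annihilated (E 0) {\<zero>\<^bsub>R\<^esub>} = carrier (E 0)" by (auto simp: annihilated_iff)
    ultimately have Z0: "\<epsilon> ` carrier M \<subseteq> {\<zero>\<^bsub>E 0\<^esub>}"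
      unfolding \<epsilon>(3) by (auto simp: ext_cocycles_def cocycles_iff)
    interpret M: module R M by (rule mM)
    have "x = \<zero>\<^bsub>M\<^esub>" if "x \<in> carrier M" for x
      using Z0 that inj_onD[OF \<epsilon>(2), of x "\<zero>\<^bsub>M\<^esub>"] hom_zero[OF mM e(2) \<epsilon>(1)] by auto
    then have "zero_module M" by auto
    with nz show False by simp
  qed
  show ?thesis
  proof (intro conjI impI)
    assume "injdim R M < \<infinity>"
    then obtain t :: nat where "injdim R M \<le> ereal (real t)" using ereal_nat_bound by blast
    then have "injdim R ?H \<le> ereal (real t)" by (rule upper) simp
    then show "injdim R ?H < \<infinity>" by (rule order_le_less_trans) simp
  next
    assume h: "finitely_generated_module R M \<and> injdim R ?H < \<infinity>"
    then obtain d :: nat where "injdim R ?H \<le> ereal (real d)" using ereal_nat_bound by blast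
    then have "injdim R M \<le> ereal (real (n + d))" using lower h by blast
    then show "injdim R M < \<infinity>" by (rule order_le_less_trans) simp
  next
    assume h: "finitely_generated_module R M \<and> \<not> zero_module M"
    then have nzH: "\<not> zero_module ?H" using nonzero by blast
    have casesM: "injdim R M = \<infinity> \<or> (\<exists>t :: nat. injdim R M = ereal (real t))"
      by (rule injdim_nonzero_cases[OF conjunct2[OF h]])
    have tn: "n \<le> t" if "injdim R M = ereal (real t)" for t
      using vanish[of t] nzH that by (metis order_refl not_le)
    consider "injdim R ?H = \<infinity>" | d :: nat where "injdim R ?H = ereal (real d)"
      using injdim_nonzero_cases[OF nzH] by blast
    then show "injdim R ?H = injdim R M - ereal (real n)"
    proof cases
      case 1
      have "injdim R M = \<infinity>"
      proof (rule ccontr)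
        assume "injdim R M \<noteq> \<infinity>"
        then obtain t :: nat where "injdim R M = ereal (real t)" using casesM by blast
        then have "injdim R ?H \<le> ereal (real t)" by (intro upper[of t]) simp_all
        with 1 show False by simp
      qed
      with 1 show ?thesis by simp
    next
      case 2
      then have le: "injdim R M \<le> ereal (real (n + d))" using lower h by simp
      then have "injdim R M \<noteq> \<infinity>" by auto
      then obtain t :: nat where t: "injdim R M = ereal (real t)" using casesM by blast
      have "injdim R ?H \<le> ereal (real (t - n))" by (rule upper[of t]) (use t tn[OF t] in simp_all)
      then have "d \<le> t - n" using 2 by simp
      moreover have "t \<le> n + d" using le t by simp
      ultimately have "t = n + d" using tn[OF t] by simp
      then show ?thesis using 2 t by simp
    qed
  qed
qed

end
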